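(* Let $\{X_n\}$ be the Bessel-like walk of the context with $\delta>-1$. For every $\theta>0$ there exists $\chi_0(\theta)>0$ such that for every $\chi\in(0,\chi_0)$ there exists $n_0(\theta,\chi)$ such that for all $n\ge n_0$ the following hold. Write $\tilde n=n$ if $n$ is even and $\tilde n=n+1$ if $n$ is odd, and $\Gamma_\kappa(x)=\int_x^\infty\frac{1}{\Gamma(\kappa)}u^{\kappa-1}e^{-u}\,du$. (i) For all integers $k$ with $k<\sqrt{\chi n}$ and $n-k$ even, \[ (1-\theta)P_0(X_{\tilde n}=0)\le P_k(X_n=0)\le(1+\theta)P_0(X_{\tilde n}=0). \] (ii) If $E_0(\tau_0)<\infty$, then for all $k$ with $\sqrt{n\chi}\le k\le\sqrt{n/\chi}$ and $n-k$ even, \[ \frac{2-\theta}{E_0(\tau_0)}\Gamma_\kappa\!\left(\frac{k^2}{2n}\right)\le P_k(X_n=0)\le\frac{2+\theta}{E_0(\tau_0)}\Gamma_\kappa\!\left(\frac{k^2}{2n}\right), \] and for all $k>\sqrt{n/\chi}$ with $n-k$ even, $P_k(X_n=0)\le\frac{8}{E_0(\tau_0)}e^{-k^2/8n}$. (iii) If $-1<\delta<1$, then for all $k$ with $\sqrt{n\chi}\le k\le\sqrt{n/\chi}$ and $n-k$ even, \[ \frac{(1-\theta)2^\kappa K_0}{\Gamma(1-\kappa)}n^{-(1-\kappa)}L(\sqrt n)^{-1}e^{-k^2/2n}\le P_k(X_n=0)\le\frac{(1+\theta)2^\kappa K_0}{\Gamma(1-\kappa)}n^{-(1-\kappa)}L(\sqrt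 n)^{-1}e^{-k^2/2n}, \] and there exists a constant $K_1$ (depending on $\kappa$ and the walk) such that for all $k>\sqrt{n/\chi}$ with $n-k$ even, $P_k(X_n=0)\le K_1e^{-k^2/8n}n^{-(1-\kappa)}L(\sqrt n)^{-1}$. (iv) If $\delta=1$ and $E_0(\tau_0)=\infty$, then for all $k$ with $\sqrt{n\chi}\le k\le\sqrt{n/\chi}$ and $n-k$ even, \[ \frac{2-\theta}{\mu_0(n)}\Gamma_\kappa\!\left(\frac{k^2}{2n}\right)\le P_k(X_n=0)\le\frac{2+\theta}{\mu_0(n)}\Gamma_\kappa\!\left(\frac{k^2}{2n}\right), \] and for all $k>\sqrt{n/\chi}$ with $n-k$ even, $P_k(X_n=0)\le\frac{8}{\mu_0(n)}e^{-k^2/8n}$.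
   Context: Let $\{X_n\}_{n\ge0}$ be a Markov chain on $\mathbb{Z}_+=\{0,1,2,\dots\}$ with steps $\pm1$, reflecting at $0$ (i.e. $p(0,1)=1$), and for $x\ge1$ transition probabilities $p_x=p(x,x+1)$, $q_x=p(x,x-1)=1-p_x$. A drift parameter $\delta$ is fixed and $R_x$ is defined by $p_x=\frac12\left(1-\frac{\delta}{2x}+\frac{R_x}{2}\right)$, where it is assumed that $R_x=o(1/x)$. Uniform ellipticity is assumed: there is $\epsilon>0$ with $p_x,q_x\in[\epsilon,1-\epsilon]$ for all $x\ge1$. Set $\kappa=(1+\delta)/2$. Define $\lambda_0=1$, $\lambda_x=\prod_{k=1}^x q_k/p_k$ for $x\ge1$, and $L(x)=\exp(R_1+\dots+R_x)$ for integers $x\ge1$, extended to $[1,\infty)$ by linear interpolation. There is a constant $K_0>0$ such that $\lambda_x\sim K_0x^{2\kappa-1}L(x)^{-1}$ as $x\to\infty$; $K_0$ denotes this constant. $P_j,E_j$ denote probability and expectation for the chain started at $j$, and $\tau_0=\min\{n\ge1:X_n=0\}$ (under $P_0$ it is the first return time to 0). $\mu_0(n)=\sum_{l=1}^n l\,P_0(\tau_0=l)$ is the truncated mean. *)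

theory Defs
  imports "HOL-Analysis.Analysis" "HOL-Library.Landau_Symbols"
begin

text \<open>Birth-death chain on the nonnegative integers. p x = p(x,x+1) for x >= 1,
  q x = 1 - p x; from 0 the chain moves to 1 with probability 1 (reflection),
  so the value p 0 is irrelevant.\<close>

fun walk_prob :: "(nat \<Rightarrow> real) \<Rightarrow> nat \<Rightarrow> nat \<Rightarrow> nat \<Rightarrow> real" where
  "walk_prob p 0 k j = (if k = j then 1 else 0)"
| "walk_prob p (Suc n) k j =
     (if k = 0 then walk_prob p n 1 j
      else p k * walk_prob p n (k + 1) j + (1 - p k) * walk_prob p n (k - 1) j)"

text \<open>first_hit p n k = P_k(tau_0 = n), tau_0 = min{m >= 1. X_m = 0}.\<close>
fun first_hit :: "(nat \<Rightarrow> real) \<Rightarrow> nat \<Rightarrow> nat \<Rightarrow> real" where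
  "first_hit p 0 k = 0"
| "first_hit p (Suc n) k =
     (if k = 0 then (if n = 0 then 0 else first_hit p n 1)
      else p k * (if n = 0 then 0 else first_hit p n (k + 1))
         + (1 - p k) * (if k = 1 then (if n = 0 then 1 else 0)
                        else (if n = 0 then 0 else first_hit p n (k - 1))))"

text \<open>E_0(tau_0) as an extended nonnegative real (the chain is recurrent when
  delta > -1, so P_0(tau_0 < infinity) = 1).\<close>
definition E0tau :: "(nat \<Rightarrow> real) \<Rightarrow> ennreal" where
  "E0tau p = (\<Sum>l. ennreal (real l * first_hit p l 0))"

definition mu0 :: "(nat \<Rightarrow> real) \<Rightarrow> nat \<Rightarrow> real" where
  "mu0 p n = (\<Sum>l=1..n. real l * first_hit p l 0)"

text \<open>R_x defined by p_x = (1 - delta/(2x) + R_x/2)/2\<close>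
definition Rterm :: "(nat \<Rightarrow> real) \<Rightarrow> real \<Rightarrow> nat \<Rightarrow> real" where
  "Rterm p \<delta> x = 4 * p x - 2 + \<delta> / real x"

definition lam :: "(nat \<Rightarrow> real) \<Rightarrow> nat \<Rightarrow> real" where
  "lam p x = (\<Prod>k=1..x. (1 - p k) / p k)"

definition Lnat :: "(nat \<Rightarrow> real) \<Rightarrow> real \<Rightarrow> nat \<Rightarrow> real" where
  "Lnat p \<delta> x = exp (\<Sum>i=1..x. Rterm p \<delta> i)"

definition Lfun :: "(nat \<Rightarrow> real) \<Rightarrow> real \<Rightarrow> real \<Rightarrow> real" where
  "Lfun p \<delta> t = (let m = nat \<lfloor>t\<rfloor> in
      Lnat p \<delta> m + (t - real m) * (Lnat p \<delta> (m + 1) - Lnat p \<delta> m))"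

definition Gamma_up :: "real \<Rightarrow> real \<Rightarrow> real" where
  "Gamma_up \<kappa> x = integral {x..} (\<lambda>u. u powr (\<kappa> - 1) * exp (- u)) / Gamma \<kappa>"

end

theory Submission
  imports Defs
begin

text \<open>
  Write $u_n(k)=P_k(X_n=0)$. Three elementary facts carry the proof. First, $u_n$ is nonincreasing
  along each parity class and $u_{2m}(0)$ is nonincreasing in $m$, so averaged information in space or
  time becomes pointwise information. Secondly, reversibility gives $P_0(X_n=k)=\pi_k u_n(k)$. Thirdly,
  exchanging the up and down probabilities yields a dual walk $Z$, with drift parameter $-\delta$, such
  that $P_k(\tau_0\le n)=P_0(Z_{n+1}>k)$ when $n-k$ is even.

  The one analytic input is that $X_n^2/(2n)$ converges to a Gamma law of shape $(1-\delta)/2$ when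
  $\delta<1$ (and to 0 when $\delta=1$ and the walk is null recurrent). It follows by telescoping along the
  approximate martingale $t^{-a}e^{-x^2/(2t)}$, which gives the Laplace transforms, and the Weierstrass
  approximation theorem. Applied to $Z$ it gives $P_k(\tau_0\le n)\to\Gamma_\kappa(k^2/2n)$; applied to $X$,
  together with monotonicity and the regular variation of $\pi$, it gives the local limit theorem (iii).

  For (i), (ii) and (iv), restarting at time $\tau_0$ gives $u_n(k)\ge P_k(\tau_0\le n)\,u_{\tilde n}(0)$, and
  averaging $u$ over a short time window gives the reverse inequality provided $u_{2m}(0)$ varies slowly.
  In that case renewal theory gives $u_{\tilde n}(0)\,\mu_0(n)\to2$. Slow variation is clear for finite mean; for
  $\delta=1$ and infinite mean it holds because $X_n/\sqrt n\to0$. The Gaussian tails come from the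
  exponential moments of $X_n^2/n$.
\<close>


subsection \<open>Birth--death walks: monotonicity, reversibility, duality\<close>

text \<open>The starting point k ranges up to order sqrt(n) and beyond, yet no limit theorem uniform
  in the starting point is proved directly. Duality turns hitting from k into a law started at 0,
  and reversibility does the same for return probabilities. One limit theorem for walks started at 0
  then serves twice: with shape \<kappa> for the dual walk and 1 - \<kappa> for the walk itself. The
  obstacle in that theorem is that x R_x is small only far from 0. The telescoped error is the mean
  of its modulus along the walk, and this mean vanishes once the walk leaves every finite set, that
  is, once the return probabilities tend to 0. They do for \<delta> < 1, hence for the dual of every
  walk with \<delta> > -1; at \<delta> = 1 this is deduced from an infinite mean of tau_0. All
  windows are fixed proportions of n, sqrt(n) or k, chosen before n grows. For k between sqrt(n
  \<chi>) and sqrt(n/\<chi>) the limits are bounded below, so absolute errors of the limit theorem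
  become relative ones. For larger k the limit theorem says nothing useful and Gaussian bounds take
  over. In the code c stands for \<chi>.\<close>

definition step :: "(nat \<Rightarrow> real) \<Rightarrow> (nat \<Rightarrow> real) \<Rightarrow> nat \<Rightarrow> real" where
  "step p g k = (if k = 0 then g 1 else p k * g (k + 1) + (1 - p k) * g (k - 1))"

text \<open>\<^term>\<open>expect p n g k\<close> is $E_k\,g(X_n)$.\<close>
definition expect :: "(nat \<Rightarrow> real) \<Rightarrow> nat \<Rightarrow> (nat \<Rightarrow> real) \<Rightarrow> nat \<Rightarrow> real" where
  "expect p n g = (step p ^^ n) g"

lemma expect_0 [simp]: "expect p 0 g = g"
  by (simp add: expect_def)

lemma expect_Suc: "expect p (Suc n) g = step p (expect p n g)"
  by (simp add: expect_def)

lemma expect_Suc_inner: "expect p (Suc n) g = expect p n (step p g)"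
  by (simp add: expect_def funpow_swap1)

lemma expect_plus: "expect p (m + n) g = expect p m (expect p n g)"
  by (simp add: expect_def funpow_add)

lemma walk_prob_eq_expect: "walk_prob p n k j = expect p n (\<lambda>x. if x = j then 1 else 0) k"
  by (induction n arbitrary: k) (auto simp: expect_Suc step_def)

lemma expect_add: "expect p n (\<lambda>x. g x + h x) k = expect p n g k + expect p n h k"
  by (induction n arbitrary: k) (auto simp: expect_Suc step_def algebra_simps)

lemma expect_cmult: "expect p n (\<lambda>x. c * g x) k = c * expect p n g k"
  by (induction n arbitrary: k) (auto simp: expect_Suc step_def algebra_simps)

lemma expect_diff: "expect p n (\<lambda>x. g x - h x) k = expect p n g k - expect p n h k"
  using expect_add[of p n g "\<lambda>x. (-1) * h x" k] by (simp only: expect_cmult) simp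

lemma expect_const [simp]: "expect p n (\<lambda>x. c) k = c"
  by (induction n arbitrary: k) (auto simp: expect_Suc step_def algebra_simps)

lemma expect_sum: "expect p n (\<lambda>x. \<Sum>i\<in>I. g i x) k = (\<Sum>i\<in>I. expect p n (g i) k)"
  by (induction I rule: infinite_finite_induct) (auto simp: expect_add)

text \<open>The probability that the walk from k has visited 0 by time n, time 0 included. For k >=
  1 this is the distribution function of \<open>first_hit\<close>; at k = 0 it is constantly 1,
  whereas \<open>first_hit\<close> counts returns there.\<close>

fun hit :: "(nat \<Rightarrow> real) \<Rightarrow> nat \<Rightarrow> nat \<Rightarrow> real" where
  "hit p 0 k = (if k = 0 then 1 else 0)"
| "hit p (Suc n) k = (if k = 0 then 1 else p k * hit p n (k + 1) + (1 - p k) * hit p n (k - 1))"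

text \<open>The reversible measure with mass 1 at 0. Because 0 is left upwards with probability 1,
  the product of the ratios p(j-1,j)/p(j,j-1) collapses to 1/(p_k \<lambda>_k) and not to
  1/\<lambda>_k.\<close>

definition rev_meas :: "(nat \<Rightarrow> real) \<Rightarrow> nat \<Rightarrow> real" where
  "rev_meas p k = (if k = 0 then 1 else 1 / (p k * lam p k))"

abbreviation tail_prob :: "(nat \<Rightarrow> real) \<Rightarrow> nat \<Rightarrow> real \<Rightarrow> real" where
  "tail_prob p n y \<equiv> expect p n (\<lambda>x. if y < real x then 1 else 0) 0"

locale walk =
  fixes p :: "nat \<Rightarrow> real"
  assumes p_pos: "x \<ge> 1 \<Longrightarrow> 0 < p x" and p_less: "x \<ge> 1 \<Longrightarrow> p x < 1"
begin

text \<open>After \<open>n\<close> steps from \<open>k\<close> only states of the parity of \<open>n + k\<close> carry mass.\<close>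
lemma expect_mono:
  assumes "\<And>x. x \<le> k + n \<Longrightarrow> even (x + k + n) \<Longrightarrow> g x \<le> h x"
  shows "expect p n g k \<le> expect p n h k"
  using assms
proof (induction n arbitrary: k)
  case 0
  then show ?case by simp
next
  case (Suc n)
  show ?case
  proof (cases "k = 0")
    case True
    have "expect p n g 1 \<le> expect p n h 1"
      by (rule Suc.IH) (use Suc.prems True in auto)
    then show ?thesis using True by (simp add: expect_Suc step_def)
  next
    case False
    have "expect p n g (k + 1) \<le> expect p n h (k + 1)"
      by (rule Suc.IH) (use Suc.prems False in auto)
    moreover have "expect p n g (k - 1) \<le> expect p n h (k - 1)"
      by (rule Suc.IH) (use Suc.prems False in auto)
    ultimately show ?thesis
      using False p_pos[of k] p_less[of k]
      by (auto simp: expect_Suc step_def intro!: add_mono mult_left_mono)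
  qed
qed

lemma expect_cong:
  assumes "\<And>x. x \<le> k + n \<Longrightarrow> even (x + k + n) \<Longrightarrow> g x = h x"
  shows "expect p n g k = expect p n h k"
  by (intro antisym expect_mono) (use assms in auto)

lemma expect_nonneg: "(\<And>x. 0 \<le> g x) \<Longrightarrow> 0 \<le> expect p n g k"
  using expect_mono[of k n "\<lambda>_. 0" g] by simp

lemma expect_abs_le: "\<bar>expect p n g k\<bar> \<le> expect p n (\<lambda>x. \<bar>g x\<bar>) k"
proof -
  have "expect p n g k \<le> expect p n (\<lambda>x. \<bar>g x\<bar>) k" by (rule expect_mono) simp
  moreover have "expect p n (\<lambda>x. (-1) * g x) k \<le> expect p n (\<lambda>x. \<bar>g x\<bar>) k" by (rule expect_mono) simp
  ultimately show ?thesis unfolding expect_cmult by simp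
qed

lemma expect_ident_0: "expect p n g 0 = (\<Sum>j\<le>n. g j * walk_prob p n 0 j)"
proof -
  have "expect p n g 0 = expect p n (\<lambda>x. \<Sum>j\<le>n. g j * (if x = j then 1 else 0)) 0"
    by (rule expect_cong) (simp add: if_distrib cong: if_cong)
  also have "\<dots> = (\<Sum>j\<le>n. g j * walk_prob p n 0 j)"
    unfolding expect_sum expect_cmult walk_prob_eq_expect ..
  finally show ?thesis .
qed

abbreviation ret :: "nat \<Rightarrow> nat \<Rightarrow> real" where "ret n k \<equiv> walk_prob p n k 0"

lemma ret_nonneg: "0 \<le> ret n k"
  unfolding walk_prob_eq_expect by (rule expect_nonneg) simp

lemma ret_odd: "odd (n + k) \<Longrightarrow> ret n k = 0"
proof -
  assume a: "odd (n + k)"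
  have "expect p n (\<lambda>x. if x = 0 then 1 else 0) k = expect p n (\<lambda>x. 0) k"
    by (rule expect_cong) (use a in \<open>auto simp: add.commute\<close>)
  then show ?thesis by (simp add: walk_prob_eq_expect)
qed

lemma ret_far: "n < k \<Longrightarrow> ret n k = 0"
proof (induction n arbitrary: k)
  case (Suc n)
  then show ?case by auto
qed simp

lemma ret_nonzeroD: "ret n k \<noteq> 0 \<Longrightarrow> k \<le> n"
  using ret_far by (meson not_le)

lemma ret_Suc: "k > 0 \<Longrightarrow> ret (Suc n) k = p k * ret n (k + 1) + (1 - p k) * ret n (k - 1)"
  by simp

lemma convex_comb_le:
  assumes "x \<ge> 1" "a \<le> c" "b \<le> (c::real)"
  shows "p x * a + (1 - p x) * b \<le> c"
proof -
  have "p x * a + (1 - p x) * b \<le> p x * c + (1 - p x) * c"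
    using assms p_pos[of x] p_less[of x] by (intro add_mono mult_left_mono) auto
  then show ?thesis by (simp add: algebra_simps)
qed

lemma convex_comb_ge:
  assumes "x \<ge> 1" "c \<le> a" "(c::real) \<le> b"
  shows "c \<le> p x * a + (1 - p x) * b"
  using convex_comb_le[of x "-a" "-c" "-b"] assms by simp

text \<open>The values at \<open>k\<close> and \<open>k + 2\<close> are convex combinations of values separated by the one at \<open>k + 1\<close>.\<close>
lemma ret_step2: "ret n (k + 2) \<le> ret n k"
proof (induction n arbitrary: k)
  case 0
  then show ?case by simp
next
  case (Suc n)
  have "ret (Suc n) (k + 2) \<le> ret n (k + 1)"
    using convex_comb_le[of "k + 2" "ret n (k + 3)" "ret n (k + 1)" "ret n (k + 1)"] Suc.IH[of "k + 1"]
    by (simp add: numeral_eq_Suc)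
  also have "\<dots> \<le> ret (Suc n) k"
  proof (cases k)
    case (Suc m)
    show ?thesis
      using convex_comb_ge[of k "ret n (k + 1)" "ret n (k + 1)" "ret n m"] Suc.IH[of m] Suc
      by simp
  qed simp
  finally show ?case .
qed

lemma ret_antimono:
  assumes "k \<le> l" "even (l - k)"
  shows "ret n l \<le> ret n k"
proof -
  obtain d where d: "l - k = 2 * d" using assms(2) by (elim evenE)
  have "ret n (k + 2 * d) \<le> ret n k"
  proof (induction d)
    case (Suc d)
    then show ?case using ret_step2[of n "k + 2 * d"] by simp
  qed simp
  then show ?thesis using d assms(1) by (metis le_add_diff_inverse)
qed

text \<open>Two steps from 0 lead to 0 or 2, and the return probability from 2 is the smaller one;
  monotonicity in time is inherited from monotonicity in space.\<close>

lemma ret_even_step: "ret (2 * Suc i) 0 \<le> ret (2 * i) 0"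
proof -
  have "ret (2 * Suc i) 0 = ret (Suc (2 * i)) 1"
    by (simp add: numeral_eq_Suc)
  also have "\<dots> \<le> ret (2 * i) 0"
    using convex_comb_le[of 1 "ret (2*i) 2" "ret (2*i) 0" "ret (2*i) 0"] ret_step2[of "2*i" 0]
    by (simp add: numeral_2_eq_2)
  finally show ?thesis .
qed

lemma ret_even_antimono: "i \<le> j \<Longrightarrow> ret (2 * j) 0 \<le> ret (2 * i) 0"
  by (rule lift_Suc_antimono_le[of "\<lambda>i. ret (2 * i) 0"]) (use ret_even_step in auto)

text \<open>The lowest state of the parity class is 0 or 1, and from 1 the probability equals the
  one from 0 a time unit later because the first step from 0 is forced. This is the origin of
  rounding n up to an even number.\<close>

lemma ret_le_origin:
  assumes "even (n + k)"
  shows "ret n k \<le> ret (if even n then n else n + 1) 0"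
proof (cases "even n")
  case True
  then show ?thesis using ret_antimono[of 0 k n] assms by auto
next
  case False
  then have "k \<ge> 1" "even (k - 1)" using assms by (auto intro!: Suc_leI odd_pos)
  then show ?thesis using ret_antimono[of 1 k n] False by simp
qed

lemma lam_pos: "lam p k > 0"
  unfolding lam_def using p_pos p_less by (intro prod_pos) auto

lemma rev_meas_pos: "rev_meas p k > 0"
  using lam_pos[of k] p_pos[of k] by (auto simp: rev_meas_def)

lemma lam_Suc: "lam p (Suc k) = lam p k * ((1 - p (Suc k)) / p (Suc k))"
  by (simp add: lam_def)

lemma detailed_balance:
  "k > 0 \<Longrightarrow> rev_meas p k * p k = rev_meas p (Suc k) * (1 - p (Suc k))"
  "rev_meas p 1 * (1 - p 1) = 1"
proof -
  assume "k > 0"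
  then show "rev_meas p k * p k = rev_meas p (Suc k) * (1 - p (Suc k))"
    using lam_pos[of k] p_pos[of k] p_pos[of "Suc k"] p_less[of "Suc k"]
    by (simp add: rev_meas_def lam_Suc field_simps)
next
  show "rev_meas p 1 * (1 - p 1) = 1"
    using p_pos[of 1] p_less[of 1] by (simp add: rev_meas_def lam_def)
qed

text \<open>Reversibility. The induction splits off the last step instead of the first: k is entered
  from its two neighbours, and detailed balance carries their weights over to k.\<close>

lemma walk_prob_from_0: "walk_prob p n 0 k = rev_meas p k * ret n k"
proof (induction n arbitrary: k)
  case 0
  then show ?case by (simp add: rev_meas_def)
next
  case (Suc n)
  let ?w = "\<lambda>j. walk_prob p n 0 j"
  have *: "walk_prob p (Suc n) 0 k = expect p n (step p (\<lambda>x. if x = k then 1 else 0)) 0"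
    by (simp add: walk_prob_eq_expect flip: expect_Suc_inner)
  show ?case
  proof (cases k)
    case 0
    have "expect p n (step p (\<lambda>x. if x = k then 1 else 0)) 0
      = expect p n (\<lambda>x. (1 - p 1) * (if x = 1 then 1 else 0)) 0"
      by (rule expect_cong) (auto simp: step_def 0)
    also have "\<dots> = (1 - p 1) * ?w 1"
      by (simp add: expect_cmult walk_prob_eq_expect)
    also have "\<dots> = (rev_meas p 1 * (1 - p 1)) * ret n 1"
      by (simp add: Suc.IH)
    finally show ?thesis using * detailed_balance(2) by (simp add: 0 rev_meas_def)
  next
    case (Suc j)
    have "expect p n (step p (\<lambda>x. if x = k then 1 else 0)) 0
      = expect p n (\<lambda>x. (if j = 0 then 1 else p j) * (if x = j then 1 else 0)
            + (1 - p (Suc k)) * (if x = Suc k then 1 else 0)) 0"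
      by (rule expect_cong) (auto simp: step_def Suc)
    also have "\<dots> = (if j = 0 then 1 else p j) * ?w j + (1 - p (Suc k)) * ?w (Suc k)"
      by (simp add: expect_add expect_cmult walk_prob_eq_expect)
    also have "\<dots> = ((if j = 0 then 1 else p j) * rev_meas p j) * ret n j
        + (rev_meas p (Suc k) * (1 - p (Suc k))) * ret n (Suc k)"
      by (simp add: Suc.IH)
    also have "(if j = 0 then 1 else p j) * rev_meas p j = rev_meas p k * (1 - p k)"
      using detailed_balance(1)[of j] detailed_balance(2) by (auto simp: Suc rev_meas_def[of p 0] mult.commute)
    also have "rev_meas p (Suc k) * (1 - p (Suc k)) = rev_meas p k * p k"
      using detailed_balance(1)[of k] by (simp add: Suc)
    finally show ?thesis using * by (simp add: Suc algebra_simps)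
  qed
qed

lemma expect_0_eq_sum: "expect p n g 0 = (\<Sum>k\<le>n. rev_meas p k * ret n k * g k)"
  by (simp add: expect_ident_0 walk_prob_from_0 mult_ac)

lemma rev_meas_sum_ret_le:
  assumes "finite A"
  shows "(\<Sum>k\<in>A. rev_meas p k * ret n k) \<le> expect p n (\<lambda>x. if x \<in> A then 1 else 0) 0"
proof -
  have "(\<Sum>k\<in>A. rev_meas p k * ret n k) = (\<Sum>k\<in>A \<inter> {..n}. rev_meas p k * ret n k)"
    by (rule sum.mono_neutral_right) (use assms in \<open>auto simp: ret_far not_le\<close>)
  also have "\<dots> = (\<Sum>k\<le>n. rev_meas p k * ret n k * (if k \<in> A then 1 else 0))"
    by (rule sum.mono_neutral_cong_left) auto
  finally show ?thesis by (simp add: expect_0_eq_sum)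
qed

lemma expect_ind_eq_sum:
  assumes "finite A"
  shows "expect p n (\<lambda>x. if x \<in> A then 1 else 0) 0 = (\<Sum>k\<in>{k\<in>A. even (n + k)}. rev_meas p k * ret n k)"
proof -
  have "expect p n (\<lambda>x. if x \<in> A then 1 else 0) 0
      = (\<Sum>k\<le>n. rev_meas p k * ret n k * (if k \<in> A then 1 else 0))"
    by (rule expect_0_eq_sum)
  also have "\<dots> = (\<Sum>k\<in>{k\<in>A. even (n + k)} \<inter> {..n}. rev_meas p k * ret n k)"
    by (rule sum.mono_neutral_cong_right) (use ret_odd in auto)
  also have "\<dots> = (\<Sum>k\<in>{k\<in>A. even (n + k)}. rev_meas p k * ret n k)"
    by (rule sum.mono_neutral_left) (use assms ret_nonzeroD in auto)
  finally show ?thesis .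
qed

lemma first_hit_nonneg: "0 \<le> first_hit p n k"
proof (induction n arbitrary: k)
  case (Suc n)
  then show ?case using p_pos[of k] p_less[of k] by auto
qed simp

lemma first_hit_odd: "odd (n + k) \<Longrightarrow> first_hit p n k = 0"
  by (induction n arbitrary: k) auto

lemma sum_first_hit: "k \<ge> 1 \<Longrightarrow> (\<Sum>l\<le>n. first_hit p l k) = hit p n k"
proof (induction n arbitrary: k)
  case 0
  then show ?case by simp
next
  case (Suc n)
  have 1: "(\<Sum>l\<le>Suc n. first_hit p l k) = (\<Sum>l\<le>n. first_hit p (Suc l) k)"
    by (subst sum.atMost_Suc_shift) simp
  have 2: "first_hit p (Suc l) k = p k * first_hit p l (k + 1)
      + (1 - p k) * (if k = 1 then (if l = 0 then 1 else 0) else first_hit p l (k - 1))" for l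
    using Suc.prems by simp
  have 3: "(\<Sum>l\<le>n. first_hit p (Suc l) k) = p k * hit p n (k + 1)
      + (1 - p k) * (\<Sum>l\<le>n. if k = 1 then (if l = 0 then 1 else 0) else first_hit p l (k - 1))"
    using Suc.IH[of "k+1"] by (subst 2) (simp add: sum.distrib flip: sum_distrib_left)
  have 4: "(\<Sum>l\<le>n. if k = 1 then (if l = 0 then 1 else 0) else first_hit p l (k - 1)) = hit p n (k - 1)"
  proof (cases "k = 1")
    case True
    then show ?thesis by (cases n) (simp_all add: sum.If_cases)
  next
    case False
    then show ?thesis using Suc.IH[of "k-1"] Suc.prems by simp
  qed
  show ?case unfolding 1 3 4 using Suc.prems by simp
qed

text \<open>Strong Markov property at the first visit to 0. From k = 0 the visit at time 0 would be
  an extra term, so returns are treated in \<open>ret_renewal\<close>, for positive times.\<close>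

lemma ret_first_hit: "k \<ge> 1 \<Longrightarrow> ret n k = (\<Sum>m\<le>n. first_hit p m k * ret (n - m) 0)"
proof (induction n arbitrary: k)
  case 0
  then show ?case by simp
next
  case (Suc n)
  have 1: "(\<Sum>m\<le>Suc n. first_hit p m k * ret (Suc n - m) 0) = (\<Sum>m\<le>n. first_hit p (Suc m) k * ret (n - m) 0)"
    by (subst sum.atMost_Suc_shift) simp
  have 2: "first_hit p (Suc l) k = p k * first_hit p l (k + 1)
      + (1 - p k) * (if k = 1 then (if l = 0 then 1 else 0) else first_hit p l (k - 1))" for l
    using Suc.prems by simp
  have 3: "(\<Sum>m\<le>n. first_hit p (Suc m) k * ret (n - m) 0) = p k * ret n (k + 1)
      + (1 - p k) * (\<Sum>m\<le>n. (if k = 1 then (if m = 0 then 1 else 0) else first_hit p m (k - 1)) * ret (n - m) 0)"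
    using Suc.IH[of "k+1"] by (subst 2) (simp add: sum.distrib distrib_right mult.assoc flip: sum_distrib_left)
  have 4: "(\<Sum>m\<le>n. (if k = 1 then (if m = 0 then 1 else 0) else first_hit p m (k - 1)) * ret (n - m) 0) = ret n (k - 1)"
  proof (cases "k = 1")
    case True
    have "(\<Sum>m\<le>n. (if m = 0 then 1 else 0) * ret (n - m) 0) = (\<Sum>m\<in>{0}. ret (n - m) 0)"
      by (rule sum.mono_neutral_cong_right) auto
    then show ?thesis using True by simp
  next
    case False
    then show ?thesis using Suc.IH[of "k-1"] Suc.prems by simp
  qed
  show ?case unfolding 1 3 4 using Suc.prems by simp
qed

lemma first_hit_Suc_0: "first_hit p (Suc n) 0 = first_hit p n 1"
  by (cases n) auto

lemma ret_renewal: "ret (Suc n) 0 = (\<Sum>m\<le>Suc n. first_hit p m 0 * ret (Suc n - m) 0)"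
proof -
  have "ret (Suc n) 0 = (\<Sum>m\<le>n. first_hit p m 1 * ret (n - m) 0)"
    using ret_first_hit[of 1 n] by simp
  also have "\<dots> = (\<Sum>m\<le>n. first_hit p (Suc m) 0 * ret (n - m) 0)"
    by (simp only: first_hit_Suc_0)
  also have "\<dots> = (\<Sum>m\<le>Suc n. first_hit p m 0 * ret (Suc n - m) 0)"
    by (subst sum.atMost_Suc_shift[of "\<lambda>m. first_hit p m 0 * ret (Suc n - m) 0"]) simp
  finally show ?thesis .
qed

text \<open>\<^term>\<open>ret\<close> at even times decreases, so restarting at the hitting time of 0 only helps.\<close>
lemma ret_ge_hit:
  assumes "even (n + k)"
  shows "hit p n k * ret (if even n then n else n + 1) 0 \<le> ret n k"
proof (cases "k = 0")
  case True
  then show ?thesis using assms by (cases n) auto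
next
  case False
  let ?N = "if even n then n else n + 1"
  have "hit p n k * ret ?N 0 = (\<Sum>m\<le>n. first_hit p m k * ret ?N 0)"
    using sum_first_hit[of k n] False by (simp flip: sum_distrib_right)
  also have "\<dots> \<le> (\<Sum>m\<le>n. first_hit p m k * ret (n - m) 0)"
  proof (rule sum_mono)
    fix m assume m: "m \<in> {..n}"
    show "first_hit p m k * ret ?N 0 \<le> first_hit p m k * ret (n - m) 0"
    proof (cases "even (m + k)")
      case True
      then have "even (n - m)" using assms m by auto
      then have "ret ?N 0 \<le> ret (n - m) 0"
        using ret_even_antimono[of "(n - m) div 2" "?N div 2"] m by (auto simp: div_le_mono)
      then show ?thesis using first_hit_nonneg by (intro mult_left_mono) auto
    qed (simp add: first_hit_odd)
  qed
  also have "\<dots> = ret n k" using ret_first_hit[of k n] False by simp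
  finally show ?thesis .
qed

end

lemma walk_dual: "walk p \<Longrightarrow> walk (\<lambda>x. 1 - p x)"
  by (simp add: walk_def)

text \<open>Siegmund duality: the walk with the up and down probabilities exchanged describes the
  hitting times of 0.\<close>
lemma hit_eq_dual_tail:
  assumes "walk p" "even (n + k)"
  shows "hit p n k = tail_prob (\<lambda>x. 1 - p x) (Suc n) (real k)"
  using assms(2)
proof (induction n arbitrary: k)
  case 0
  then show ?case by (auto simp: expect_Suc step_def)
next
  case (Suc n)
  let ?q = "\<lambda>x. 1 - p x"
  interpret d: walk ?q by (rule walk_dual[OF assms(1)])
  show ?case
  proof (cases "k = 0")
    case True
    \<comment> \<open>With k = 0 the time \<open>Suc (Suc n)\<close> is odd, so the dual walk sits
      at an odd, hence positive, state.\<close>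
    have "expect ?q (Suc (Suc n)) (\<lambda>x. if real k < real x then 1 else 0) 0 = expect ?q (Suc (Suc n)) (\<lambda>x. 1) 0"
      by (rule d.expect_cong) (use Suc.prems True in \<open>auto intro: odd_pos\<close>)
    then show ?thesis using True by simp
  next
    case False
    have "expect ?q (Suc (Suc n)) (\<lambda>x. if real k < real x then 1 else 0) 0 =
        expect ?q (Suc n) (step ?q (\<lambda>x. if real k < real x then 1 else 0)) 0"
      by (simp only: expect_Suc_inner[of _ "Suc n"])
    also have "\<dots> = expect ?q (Suc n) (\<lambda>x. p k * (if real (k + 1) < real x then 1 else 0)
        + (1 - p k) * (if real (k - 1) < real x then 1 else 0)) 0"
    proof (rule d.expect_cong)
      fix x assume "even (x + 0 + Suc n)"
      then have e: "even (x + k)" using Suc.prems by auto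
      \<comment> \<open>By parity the state before the last step differs from k by an even number.
        Only from x = k does that step decide on which side of the threshold the walk ends; it goes
        up with the dual probability 1 - p k, the weight of \<open>k - 1\<close> in the recursion of
        \<open>hit\<close>.\<close>
      have "x \<noteq> k + 1" "x + 1 \<noteq> k" using e by auto
      then consider "x + 2 \<le> k" | "x = k" | "x \<ge> k + 2" 
        using \<open>x \<noteq> k + 1\<close> \<open>x + 1 \<noteq> k\<close> by linarith
      then show "step ?q (\<lambda>x. if real k < real x then 1 else 0) x
        = p k * (if real (k + 1) < real x then 1 else 0) + (1 - p k) * (if real (k - 1) < real x then 1 else 0)"
        using False by cases (auto simp: step_def)
    qed
    also have "\<dots> = p k * hit p n (k + 1) + (1 - p k) * hit p n (k - 1)"
      using Suc.prems False by (simp add: expect_add expect_cmult Suc.IH)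
    finally show ?thesis using False by simp
  qed
qed

subsection \<open>Averaging in time and Gaussian tails\<close>

context walk begin

lemma ret_plus: "ret (m + n) k = expect p m (ret n) k"
proof -
  have "expect p n (\<lambda>x. if x = 0 then 1 else 0) = ret n"
    by (rule ext) (simp add: walk_prob_eq_expect)
  then show ?thesis by (simp add: walk_prob_eq_expect[of p "m + n"] expect_plus)
qed

lemma expect_drift_le:
  assumes "\<And>x. step p g x \<le> g x + c"
  shows "expect p n g k \<le> g k + real n * c"
proof (induction n)
  case (Suc n)
  have "expect p (Suc n) g k \<le> expect p n (\<lambda>x. g x + c) k"
    unfolding expect_Suc_inner by (rule expect_mono) (rule assms)
  then show ?case using Suc by (simp add: expect_add algebra_simps)
qed simp

text \<open>Restarting at time m sees the window of J even times shifted. A shift to later times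
  lowers each term by monotonicity in time; a shift to earlier times leaves only an initial segment
  of the sum.\<close>

lemma sum_ret_shift_le:
  assumes "even (n + m)"
  shows "(\<Sum>i<J. if m \<le> n + 2 * i then ret (n + 2 * i - m) 0 else 0) \<le> (\<Sum>i<J. ret (2 * i) 0)"
proof (cases "m \<le> n")
  case True
  then have "even (n - m)" using assms by simp
  then obtain d where d: "n - m = 2 * d" by (elim evenE)
  have "n + 2 * i - m = 2 * (d + i)" for i using d True by auto
  moreover have "ret (2 * (d + i)) 0 \<le> ret (2 * i) 0" for i by (rule ret_even_antimono) simp
  ultimately show ?thesis using True by (intro sum_mono) auto
next
  case False
  then have "even (m - n)" using assms by simp
  then obtain d where d: "m - n = 2 * d" by (elim evenE)
  have m: "m = n + 2 * d" using d False by auto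
  have "(\<Sum>i<J. if m \<le> n + 2 * i then ret (n + 2 * i - m) 0 else 0) = (\<Sum>i\<in>{d..<J}. ret (2 * (i - d)) 0)"
    by (rule sum.mono_neutral_cong_right) (auto simp: m diff_mult_distrib2)
  also have "\<dots> = (\<Sum>i\<in>{..<J - d}. ret (2 * i) 0)"
    by (rule sum.reindex_bij_witness[of _ "\<lambda>i. i + d" "\<lambda>i. i - d"]) auto
  also have "\<dots> \<le> (\<Sum>i<J. ret (2 * i) 0)"
    by (rule sum_mono2) (auto simp: ret_nonneg)
  finally show ?thesis .
qed

text \<open>To be at 0 inside the window the walk must hit 0 before its end, and from the hitting
  time on the expected number of visits in the window is at most that of a walk started at 0 at its
  beginning.\<close>

lemma sum_ret_le_hit:
  assumes "even (n + k)"
  shows "(\<Sum>i<J. ret (n + 2 * i) k) \<le> hit p (n + 2 * J) k * (\<Sum>i<J. ret (2 * i) 0)"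
proof (cases "k = 0")
  case True
  then have "even n" using assms by simp
  then obtain d where d: "n = 2 * d" by (elim evenE)
  have "n + 2 * i = 2 * (d + i)" for i using d by simp
  moreover have "ret (2 * (d + i)) 0 \<le> ret (2 * i) 0" for i by (rule ret_even_antimono) simp
  ultimately have "(\<Sum>i<J. ret (n + 2 * i) k) \<le> (\<Sum>i<J. ret (2 * i) 0)"
    using True by (intro sum_mono) auto
  moreover have "hit p (n + 2 * J) k = 1" using True by (cases "n + 2 * J") auto
  ultimately show ?thesis by simp
next
  case False
  let ?N = "n + 2 * J"
  have "(\<Sum>i<J. ret (n + 2 * i) k) = (\<Sum>i<J. \<Sum>m\<le>?N. first_hit p m k * (if m \<le> n + 2 * i then ret (n + 2 * i - m) 0 else 0))"
  proof (rule sum.cong)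
    fix i assume "i \<in> {..<J}"
    then show "ret (n + 2 * i) k = (\<Sum>m\<le>?N. first_hit p m k * (if m \<le> n + 2 * i then ret (n + 2 * i - m) 0 else 0))"
      using ret_first_hit[of k "n + 2 * i"] False
      by (simp add: if_distrib cong: if_cong)
        (rule sum.mono_neutral_cong_left, auto)
  qed simp
  also have "\<dots> = (\<Sum>m\<le>?N. first_hit p m k * (\<Sum>i<J. if m \<le> n + 2 * i then ret (n + 2 * i - m) 0 else 0))"
    by (subst sum.swap) (simp add: sum_distrib_left)
  also have "\<dots> \<le> (\<Sum>m\<le>?N. first_hit p m k * (\<Sum>i<J. ret (2 * i) 0))"
  proof (rule sum_mono)
    fix m
    show "first_hit p m k * (\<Sum>i<J. if m \<le> n + 2 * i then ret (n + 2 * i - m) 0 else 0)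
      \<le> first_hit p m k * (\<Sum>i<J. ret (2 * i) 0)"
    proof (cases "even (m + k)")
      case True
      then show ?thesis using sum_ret_shift_le[of n m J] assms first_hit_nonneg
        by (intro mult_left_mono) auto
    qed (simp add: first_hit_odd)
  qed
  also have "\<dots> = hit p ?N k * (\<Sum>i<J. ret (2 * i) 0)"
    using sum_first_hit[of k ?N] False by (simp flip: sum_distrib_right)
  finally show ?thesis .
qed

end

section \<open>Displacement and Gaussian tail bounds for walks of bounded drift\<close>

lemma sinh_le_mult_cosh:
  assumes "0 \<le> x"
  shows "sinh (x::real) \<le> x * cosh x"
proof -
  have "(\<lambda>x. x * cosh x - sinh x) 0 \<le> (\<lambda>x::real. x * cosh x - sinh x) x"
  proof (rule DERIV_nonneg_imp_nondecreasing[OF assms])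
    fix y :: real assume "0 \<le> y"
    then have "((\<lambda>x. x * cosh x - sinh x) has_real_derivative y * sinh y) (at y)" "0 \<le> y * sinh y"
      by (auto intro!: derivative_eq_intros)
    then show "\<exists>d. ((\<lambda>x. x * cosh x - sinh x) has_real_derivative d) (at y) \<and> 0 \<le> d" by blast
  qed
  then show ?thesis by simp
qed

lemma cosh_le_exp_sq: "cosh (x::real) \<le> exp (x\<^sup>2 / 2)"
proof -
  have "exp (- y\<^sup>2 / 2) * cosh y \<le> 1" if "0 \<le> y" for y :: real
  proof -
    have "(\<lambda>x. exp (- x\<^sup>2 / 2) * cosh x) y \<le> (\<lambda>x::real. exp (- x\<^sup>2 / 2) * cosh x) 0"
    proof (rule DERIV_nonpos_imp_nonincreasing[OF that])
      fix z :: real assume "0 \<le> z"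
      then have "exp (- z\<^sup>2 / 2) * (sinh z - z * cosh z) \<le> 0"
        using sinh_le_mult_cosh[of z] by (simp add: mult_nonneg_nonpos)
      moreover have "((\<lambda>x. exp (- x\<^sup>2 / 2) * cosh x) has_real_derivative
          exp (- z\<^sup>2 / 2) * (sinh z - z * cosh z)) (at z)"
        by (auto intro!: derivative_eq_intros simp: algebra_simps)
      ultimately show "\<exists>d. ((\<lambda>x. exp (- x\<^sup>2 / 2) * cosh x) has_real_derivative d) (at z) \<and> d \<le> 0" by blast
    qed
    then show ?thesis by simp
  qed
  from this[of "\<bar>x\<bar>"] have "exp (- x\<^sup>2 / 2) * cosh x \<le> 1" by simp
  then show ?thesis by (simp add: exp_minus field_simps)
qed

text \<open>The bound is symmetric under exchanging p and 1 - p, so the walk and its dual share the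
  constant C.\<close>

locale bounded_drift_walk = walk +
  fixes C :: real
  assumes drift_le: "\<bar>real x * (2 * p x - 1)\<bar> \<le> C"
begin

lemma C_nonneg: "0 \<le> C" using drift_le[of 0] by simp

text \<open>Only the excess above the starting point is measured. There x - k <= x, so the drift
  contributes at most 2 C per step; below k the product (x - k)(2 p x - 1) could be of order k near
  the origin.\<close>

lemma expect_pos_part_sq:
  "expect p n (\<lambda>x. (max 0 (real x - real k))\<^sup>2) k \<le> real n * (1 + 2 * C)"
proof -
  have "step p (\<lambda>x. (max 0 (real x - real k))\<^sup>2) x \<le> (max 0 (real x - real k))\<^sup>2 + (1 + 2 * C)" for x
  proof -
    consider "x = 0" | "x \<ge> 1" "x \<ge> k + 1" | "x \<ge> 1" "x \<le> k" by linarith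
    then show ?thesis
    proof cases
      case 1
      then show ?thesis using C_nonneg by (cases k) (auto simp: step_def max_def power2_eq_square)
    next
      case 2
      have e: "real (x + 1) = real x + 1" "real (x - 1) = real x - 1" "x \<noteq> 0"
        using 2 by (auto simp: of_nat_diff)
      have "max 0 (real x + 1 - real k) = real x + 1 - real k" "max 0 (real x - 1 - real k) = real x - 1 - real k"
        using 2 by auto
      then have "step p (\<lambda>x. (max 0 (real x - real k))\<^sup>2) x =
        p x * (real x + 1 - real k)\<^sup>2 + (1 - p x) * (real x - 1 - real k)\<^sup>2"
        using e by (simp only: step_def if_False)
      also have "\<dots> = (real x - real k)\<^sup>2 + 1 + 2 * ((real x - real k) * (2 * p x - 1))"
        by (simp add: power2_eq_square algebra_simps)
      also have "(real x - real k) * (2 * p x - 1) \<le> \<bar>real x * (2 * p x - 1)\<bar>"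
      proof -
        have "(real x - real k) * (2 * p x - 1) \<le> \<bar>real x - real k\<bar> * \<bar>2 * p x - 1\<bar>"
          by (metis abs_ge_self abs_mult)
        also have "\<dots> \<le> \<bar>real x\<bar> * \<bar>2 * p x - 1\<bar>" using 2 by (intro mult_right_mono) auto
        finally show ?thesis by (simp add: abs_mult)
      qed
      also note drift_le
      finally show ?thesis using 2 by (simp add: max_def)
    next
      case 3
      then have "(max 0 (real (x + 1) - real k))\<^sup>2 \<le> 1" "(max 0 (real (x - 1) - real k))\<^sup>2 \<le> 1"
        by (auto intro!: power_le_one)
      then have "step p (\<lambda>x. (max 0 (real x - real k))\<^sup>2) x \<le> 1"
        using convex_comb_le[OF 3(1)] 3 by (auto simp only: step_def split: if_splits)
      then show ?thesis using C_nonneg by (smt (verit) zero_le_power2)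
    qed
  qed
  from expect_drift_le[OF this, of n k] show ?thesis by simp
qed

lemma expect_gt_le:
  assumes "k < l"
  shows "expect p n (\<lambda>x. if l < x then 1 else 0) k \<le> real n * (1 + 2 * C) / (real l - real k)\<^sup>2"
proof -
  have "expect p n (\<lambda>x. if l < x then 1 else 0) k
    \<le> expect p n (\<lambda>x. (1 / (real l - real k)\<^sup>2) * (max 0 (real x - real k))\<^sup>2) k"
  proof (rule expect_mono)
    fix x
    have "(real l - real k)\<^sup>2 \<le> (max 0 (real x - real k))\<^sup>2" if "l < x"
      using that assms by (intro power_mono) auto
    then show "(if l < x then 1 else 0) \<le> (1 / (real l - real k)\<^sup>2) * (max 0 (real x - real k))\<^sup>2"
      using assms by (auto simp: field_simps)
  qed
  also have "\<dots> \<le> (1 / (real l - real k)\<^sup>2) * (real n * (1 + 2 * C))"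
    unfolding expect_cmult by (intro mult_left_mono expect_pos_part_sq) auto
  finally show ?thesis by simp
qed

text \<open>In time \<open>2 J\<close> the walk from \<open>k'\<close> rarely exceeds \<open>k\<close>, and \<^term>\<open>ret n\<close> decreases in space; so
  \<^term>\<open>ret n k\<close> is dominated by a time average, which the first-hit decomposition evaluates.\<close>
lemma ret_le_average:
  assumes "k' < k" "even (k' + k)" "even (n + k)"
  shows "ret n k * (real J * (1 - 2 * real J * (1 + 2 * C) / (real k - real k')\<^sup>2))
    \<le> hit p (n + 2 * J) k' * (\<Sum>i<J. ret (2 * i) 0)"
proof -
  let ?\<epsilon> = "2 * real J * (1 + 2 * C) / (real k - real k')\<^sup>2"
  \<comment> \<open>Run the walk from k' for 2 i steps: unless it has ended above k, it is at a
    state of the parity class of k where \<open>ret n\<close> is at least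
    \<open>ret n k\<close>.\<close>
  have "ret n k * (1 - ?\<epsilon>) \<le> ret (n + 2 * i) k'" if "i < J" for i
  proof -
    have "real (2 * i) * (1 + 2 * C) / (real k - real k')\<^sup>2 \<le> ?\<epsilon>"
      using that C_nonneg by (intro divide_right_mono mult_right_mono) auto
    then have *: "expect p (2 * i) (\<lambda>x. if k < x then 1 else 0) k' \<le> ?\<epsilon>"
      using expect_gt_le[OF assms(1), of "2 * i"] by linarith
    have "ret n k * (1 - ?\<epsilon>) \<le> ret n k * (1 - expect p (2 * i) (\<lambda>x. if k < x then 1 else 0) k')"
      using * by (intro mult_left_mono ret_nonneg) auto
    also have "\<dots> = expect p (2 * i) (\<lambda>x. ret n k * (1 - (if k < x then 1 else 0))) k'"
      by (simp add: expect_cmult expect_diff)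
    also have "\<dots> \<le> expect p (2 * i) (ret n) k'"
    proof (rule expect_mono)
      fix x assume "even (x + k' + 2 * i)"
      then have e: "even (k - x)" if "x \<le> k" using that assms by auto
      show "ret n k * (1 - (if k < x then 1 else 0)) \<le> ret n x"
        using e ret_antimono[of x k n] ret_nonneg by (cases "k < x") auto
    qed
    also have "\<dots> = ret (n + 2 * i) k'" by (simp add: add.commute flip: ret_plus)
    finally show ?thesis .
  qed
  then have "(\<Sum>i<J. ret n k * (1 - ?\<epsilon>)) \<le> (\<Sum>i<J. ret (n + 2 * i) k')"
    by (intro sum_mono) auto
  also have "\<dots> \<le> hit p (n + 2 * J) k' * (\<Sum>i<J. ret (2 * i) 0)"
    by (rule sum_ret_le_hit) (use assms in auto)
  finally show ?thesis by (simp add: mult_ac)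
qed

text \<open>One step raises the rate c to c + 2 c^2, a discrete form of the equation c' = 2 c^2. The
  fluctuation accounts for the increase of the rate, while the drift, through sinh w <= w cosh w,
  costs only a prefactor since x (2 p x - 1) is bounded.\<close>

lemma step_exp_sq_le:
  assumes "0 \<le> c"
  shows "step p (\<lambda>x. exp (c * (real x)\<^sup>2)) x \<le> exp ((1 + 2 * C) * c) * exp ((c + 2 * c\<^sup>2) * (real x)\<^sup>2)"
proof (cases "x = 0")
  case True
  have "c \<le> (1 + 2 * C) * c" using C_nonneg assms by (simp add: mult_right_mono algebra_simps)
  then show ?thesis using True by (simp add: step_def)
next
  case False
  define w where "w = 2 * c * real x"
  have w: "w \<ge> 0" using assms by (simp add: w_def)
  have "step p (\<lambda>x. exp (c * (real x)\<^sup>2)) x = p x * exp (c * (real x + 1)\<^sup>2) + (1 - p x) * exp (c * (real x - 1)\<^sup>2)"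
    using False by (simp add: step_def of_nat_diff add.commute)
  also have "c * (real x + 1)\<^sup>2 = (c * (real x)\<^sup>2 + c) + w" by (simp add: power2_eq_square algebra_simps w_def)
  also have "c * (real x - 1)\<^sup>2 = (c * (real x)\<^sup>2 + c) + (- w)" by (simp add: power2_eq_square algebra_simps w_def)
  also have "p x * exp ((c * (real x)\<^sup>2 + c) + w) + (1 - p x) * exp ((c * (real x)\<^sup>2 + c) + (- w))
     = exp (c * (real x)\<^sup>2 + c) * (cosh w + (2 * p x - 1) * sinh w)"
    unfolding exp_add by (simp add: cosh_def sinh_def field_simps)
  also have "\<dots> \<le> exp (c * (real x)\<^sup>2 + c) * (exp (w\<^sup>2 / 2) * exp (2 * c * C))"
  proof (rule mult_left_mono)
    have "(2 * p x - 1) * sinh w \<le> \<bar>2 * p x - 1\<bar> * sinh w"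
      using w by (intro mult_right_mono) auto
    also have "\<dots> \<le> \<bar>2 * p x - 1\<bar> * (w * cosh w)"
      using w by (intro mult_left_mono sinh_le_mult_cosh) auto
    also have "\<dots> = \<bar>real x * (2 * p x - 1)\<bar> * (2 * c * cosh w)"
      by (simp add: w_def abs_mult)
    also have "\<dots> \<le> C * (2 * c * cosh w)"
      using assms cosh_real_nonneg by (intro mult_right_mono drift_le) auto
    finally have "cosh w + (2 * p x - 1) * sinh w \<le> cosh w * (1 + 2 * c * C)"
      by (simp add: algebra_simps)
    also have "\<dots> \<le> exp (w\<^sup>2 / 2) * exp (2 * c * C)"
      using assms C_nonneg by (intro mult_mono cosh_le_exp_sq exp_ge_add_one_self) auto
    finally show "cosh w + (2 * p x - 1) * sinh w \<le> exp (w\<^sup>2 / 2) * exp (2 * c * C)" .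
  qed simp
  also have "\<dots> = exp ((1 + 2 * C) * c) * exp ((c + 2 * c\<^sup>2) * (real x)\<^sup>2)"
    unfolding exp_add[symmetric] by (rule arg_cong[of _ _ exp]) (simp add: w_def power2_eq_square algebra_simps)
  finally show ?thesis .
qed

text \<open>The rates 1/(2(T - j)) solve c' = 2 c^2 with blow-up at time T, and they dominate the
  recursion c -> c + 2 c^2 exactly.\<close>

lemma expect_exp_sq_le:
  assumes "real n < T"
  shows "expect p n (\<lambda>x. exp ((real x)\<^sup>2 / (2 * T))) k
    \<le> exp ((1 + 2 * C) * (\<Sum>j<n. 1 / (2 * (T - real j)))) * exp ((real k)\<^sup>2 / (2 * (T - real n)))"
  using assms
proof (induction n arbitrary: k)
  case 0
  then show ?case by simp
next
  case (Suc n)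
  define c where "c = 1 / (2 * (T - real n))"
  define A where "A = exp ((1 + 2 * C) * (\<Sum>j<n. 1 / (2 * (T - real j))))"
  have T: "T - real n > 1" using Suc.prems by simp
  then have c: "c \<ge> 0" by (simp add: c_def)
  have "expect p (Suc n) (\<lambda>x. exp ((real x)\<^sup>2 / (2 * T))) k = expect p 1 (expect p n (\<lambda>x. exp ((real x)\<^sup>2 / (2 * T)))) k"
    by (simp add: expect_Suc)
  also have "\<dots> \<le> expect p 1 (\<lambda>x. A * exp (c * (real x)\<^sup>2)) k"
    by (rule expect_mono) (use Suc in \<open>simp add: A_def c_def\<close>)
  also have "\<dots> = A * step p (\<lambda>x. exp (c * (real x)\<^sup>2)) k"
    unfolding expect_cmult by (simp add: expect_Suc)
  also have "\<dots> \<le> A * (exp ((1 + 2 * C) * c) * exp ((c + 2 * c\<^sup>2) * (real k)\<^sup>2))"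
    using step_exp_sq_le[OF c] by (intro mult_left_mono) (auto simp: A_def)
  also have "\<dots> \<le> A * (exp ((1 + 2 * C) * c) * exp ((real k)\<^sup>2 / (2 * (T - real (Suc n)))))"
  proof -
    have "c + 2 * c\<^sup>2 \<le> 1 / (2 * (T - real (Suc n)))"
    proof -
      define s where "s = T - real n"
      have s: "s > 1" using T by (simp add: s_def)
      have "c + 2 * c\<^sup>2 = (s + 1) / (2 * s\<^sup>2)" using s by (simp add: c_def s_def[symmetric] power2_eq_square field_simps)
      also have "\<dots> \<le> 1 / (2 * (s - 1))"
        using s by (simp add: divide_simps power2_eq_square) (simp add: algebra_simps)
      finally show ?thesis by (simp add: s_def algebra_simps)
    qed
    then have "(c + 2 * c\<^sup>2) * (real k)\<^sup>2 \<le> 1 / (2 * (T - real (Suc n))) * (real k)\<^sup>2"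
      by (intro mult_right_mono) auto
    then show ?thesis by (intro mult_left_mono) (auto simp: A_def)
  qed
  also have "A * (exp ((1 + 2 * C) * c) * exp ((real k)\<^sup>2 / (2 * (T - real (Suc n)))))
     = exp ((1 + 2 * C) * (\<Sum>j<Suc n. 1 / (2 * (T - real j)))) * exp ((real k)\<^sup>2 / (2 * (T - real (Suc n))))"
    by (simp add: A_def c_def distrib_left exp_add)
  finally show ?case .
qed

text \<open>Exponential Markov inequality with T = 2 n: the sum of rates stays below 1/2, and the
  resulting rate 1/(4 n) leaves room down to the required 1/(8 n) for the windows used
  later.\<close>

lemma gaussian_tail:
  assumes "n \<ge> 1" "y \<ge> 0"
  shows "tail_prob p n y \<le> exp ((1 + 2 * C) / 2) * exp (- y\<^sup>2 / (4 * real n))"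
proof -
  have "(\<Sum>j<n. 1 / (2 * (2 * real n - real j))) \<le> (\<Sum>j<n. 1 / (2 * real n))"
    by (intro sum_mono divide_left_mono) auto
  then have S: "(\<Sum>j<n. 1 / (2 * (2 * real n - real j))) \<le> 1 / 2" using assms by simp
  have "tail_prob p n y \<le> expect p n (\<lambda>x. exp (- y\<^sup>2 / (4 * real n)) * exp ((real x)\<^sup>2 / (2 * (2 * real n)))) 0"
  proof (rule expect_mono)
    fix x
    have "y\<^sup>2 \<le> (real x)\<^sup>2" if "y < real x" using that assms by (intro power_mono) auto
    then have "y < real x \<Longrightarrow> 0 \<le> - y\<^sup>2 / (4 * real n) + (real x)\<^sup>2 / (2 * (2 * real n))"
      using assms by (simp add: field_simps)
    then show "(if y < real x then 1 else 0) \<le> exp (- y\<^sup>2 / (4 * real n)) * exp ((real x)\<^sup>2 / (2 * (2 * real n)))"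
      unfolding exp_add[symmetric] by auto
  qed
  also have "\<dots> \<le> exp (- y\<^sup>2 / (4 * real n)) * (exp ((1 + 2 * C) * (\<Sum>j<n. 1 / (2 * (2 * real n - real j)))) * 1)"
    unfolding expect_cmult using expect_exp_sq_le[of n "2 * real n" 0] assms by (intro mult_left_mono) auto
  also have "\<dots> \<le> exp (- y\<^sup>2 / (4 * real n)) * exp ((1 + 2 * C) / 2)"
    using S C_nonneg mult_left_mono[OF S, of "1 + 2 * C"] by (intro mult_left_mono) auto
  finally show ?thesis by (simp add: mult.commute)
qed

end

subsection \<open>Convergence of the law of $X_n^2/(2n)$\<close>

lemma cesaro_zero:
  fixes f :: "nat \<Rightarrow> real"
  assumes "f \<longlonglongrightarrow> 0"
  shows "(\<lambda>n. (\<Sum>m<n. f m) / real n) \<longlonglongrightarrow> 0"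
proof (rule LIMSEQ_I)
  fix e :: real assume e: "0 < e"
  obtain N where N: "\<And>m. m \<ge> N \<Longrightarrow> \<bar>f m\<bar> < e / 2"
    using LIMSEQ_D[OF assms, of "e / 2"] e by auto
  define D where "D = (\<Sum>m<N. \<bar>f m\<bar>)"
  obtain N' :: nat where N': "D / (e / 2) < real N'" using reals_Archimedean2 by blast
  have "norm ((\<Sum>m<n. f m) / real n - 0) < e" if n: "n \<ge> max N (Suc N')" for n
  proof -
    have "\<bar>\<Sum>m<n. f m\<bar> \<le> (\<Sum>m<n. \<bar>f m\<bar>)" by (rule sum_abs)
    also have "\<dots> = D + (\<Sum>m\<in>{N..<n}. \<bar>f m\<bar>)"
      using n by (simp add: D_def lessThan_atLeast0 sum.atLeastLessThan_concat)
    also have "(\<Sum>m\<in>{N..<n}. \<bar>f m\<bar>) \<le> (\<Sum>m\<in>{N..<n}. e / 2)"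
      using N by (intro sum_mono) (auto intro: less_imp_le)
    also have "\<dots> \<le> real n * (e / 2)" using e n by (simp add: field_simps)
    also have "D < real n * (e / 2)"
    proof -
      have "D < real N' * (e / 2)" using N' e by (simp add: field_simps)
      also have "\<dots> \<le> real n * (e / 2)" using e n by (intro mult_right_mono) auto
      finally show ?thesis .
    qed
    finally have "\<bar>\<Sum>m<n. f m\<bar> < e * real n" by simp
    then show ?thesis using n by (simp add: pos_divide_less_eq)
  qed
  then show "\<exists>no. \<forall>n\<ge>no. norm ((\<Sum>m<n. f m) / real n - 0) < e" by blast
qed

section \<open>Taylor estimates for the Gaussian solution of the backward equation\<close>

lemma sq_exp_le: "(u::real)\<^sup>2 * exp (- u\<^sup>2 / 2) \<le> 2"
proof -
  have "u\<^sup>2 / 2 \<le> exp (u\<^sup>2 / 2)" using exp_ge_add_one_self[of "u\<^sup>2 / 2"] by linarith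
  then show ?thesis by (simp add: exp_minus field_simps)
qed

lemma pow4_exp_le: "(u::real) ^ 4 * exp (- u\<^sup>2 / 2) \<le> 8"
proof -
  have "(u\<^sup>2 / 2)\<^sup>2 / 2 \<le> exp (u\<^sup>2 / 2)" 
    using exp_lower_Taylor_quadratic[of "u\<^sup>2 / 2"] by (smt (verit) divide_nonneg_nonneg zero_le_power2)
  then show ?thesis by (simp add: exp_minus field_simps power_divide flip: power_mult)
qed

text \<open>The third derivative (3u - u^3) G(u) is bounded by 4 + 6 + 8 = 18 on the whole line, so
  the remainder is uniform in y, with constant 18/3!.\<close>

lemma gauss_taylor:
  fixes y h :: real
  defines "G \<equiv> \<lambda>u::real. exp (- u\<^sup>2 / 2)"
  shows "\<bar>G (y + h) - (G y - h * y * G y + h\<^sup>2 / 2 * (y\<^sup>2 - 1) * G y)\<bar> \<le> 3 * \<bar>h\<bar> ^ 3"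
proof -
  define D where "D = (\<lambda>m::nat. \<lambda>s::real. (if m = 0 then 1 else if m = 1 then - (y + s) else if m = 2 then (y + s)\<^sup>2 - 1
      else 3 * (y + s) - (y + s) ^ 3) * G (y + s))"
  have "\<forall>m s. m < 3 \<and> \<bar>s\<bar> \<le> \<bar>h\<bar> \<longrightarrow> DERIV (D m) s :> D (Suc m) s"
  proof (intro allI impI)
    fix m :: nat and s :: real assume "m < 3 \<and> \<bar>s\<bar> \<le> \<bar>h\<bar>"
    then consider "m = 0" | "m = 1" | "m = 2" by linarith
    moreover have "((\<lambda>s. G (y + s)) has_real_derivative - (y + s) * G (y + s)) (at s)"
      unfolding G_def by (auto intro!: derivative_eq_intros simp: field_simps)
    ultimately show "DERIV (D m) s :> D (Suc m) s"
      by cases (auto simp: D_def intro!: derivative_eq_intros, simp_all add: power2_eq_square power3_eq_cube algebra_simps)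
  qed
  from Maclaurin_bi_le[OF _ this, of "\<lambda>s. G (y + s)"]
  obtain t where "G (y + h) = (\<Sum>m<3. D m 0 / fact m * h ^ m) + D 3 t / fact 3 * h ^ 3"
    by (auto simp: D_def)
  then have eq: "G (y + h) - (G y - h * y * G y + h\<^sup>2 / 2 * (y\<^sup>2 - 1) * G y) = D 3 t / 6 * h ^ 3"
    by (simp add: D_def eval_nat_numeral algebra_simps)
  define u where "u = y + t"
  have "\<bar>D 3 t\<bar> = \<bar>3 * u - u ^ 3\<bar> * G u" by (simp add: D_def u_def abs_mult G_def)
  also have "\<bar>3 * u - u ^ 3\<bar> \<le> 3 * (1 + u\<^sup>2) + (1 + u ^ 4)"
  proof -
    have a: "\<bar>u\<bar> \<le> 1 + u\<^sup>2" using sum_power2_ge_zero[of "\<bar>u\<bar> - 1" 0] by (simp add: power2_eq_square algebra_simps)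
    have b: "\<bar>u\<bar> ^ 3 \<le> 1 + u ^ 4"
    proof (cases "\<bar>u\<bar> \<le> 1")
      case True
      then have "\<bar>u\<bar> ^ 3 \<le> 1" by (simp add: power_le_one)
      then show ?thesis by (smt (verit) zero_le_even_power even_numeral)
    next
      case False
      then have "\<bar>u\<bar> ^ 3 \<le> \<bar>u\<bar> ^ 4" by (intro power_increasing) auto
      then show ?thesis by simp
    qed
    have "\<bar>3 * u - u ^ 3\<bar> \<le> 3 * \<bar>u\<bar> + \<bar>u\<bar> ^ 3"
      using abs_triangle_ineq4[of "3 * u" "u ^ 3"] by (simp add: abs_mult power_abs)
    also have "\<dots> \<le> 3 * (1 + u\<^sup>2) + (1 + u ^ 4)"
      using a b by (intro add_mono mult_left_mono) auto
    finally show ?thesis .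
  qed
  also have "(3 * (1 + u\<^sup>2) + (1 + u ^ 4)) * G u = 4 * G u + 3 * (u\<^sup>2 * G u) + u ^ 4 * G u"
    by (simp add: algebra_simps)
  also have "\<dots> \<le> 4 * 1 + 3 * 2 + 8"
    unfolding G_def by (intro add_mono mult_left_mono sq_exp_le pow4_exp_le) auto
  finally have "\<bar>D 3 t\<bar> \<le> 18" by (simp add: G_def mult_right_mono)
  then have "\<bar>D 3 t / 6\<bar> * \<bar>h\<bar> ^ 3 \<le> 3 * \<bar>h\<bar> ^ 3" by (intro mult_right_mono) auto
  then show ?thesis unfolding eq by (simp add: abs_mult power_abs)
qed

text \<open>For $a = (1-\delta)/2$ this solves the backward equation
  $\partial_t v = \frac12 v'' - \frac{\delta}{2x} v'$ of the limiting Bessel process.\<close>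
definition heat :: "real \<Rightarrow> real \<Rightarrow> real \<Rightarrow> real" where
  "heat a t x = t powr (-a) * exp (- x\<^sup>2 / (2 * t))"

text \<open>In the variable u = x / sqrt s the second time derivative is s^(-a-2) times a bounded
  function of u. The error is therefore smaller by a factor t than the first-order term, uniformly
  in x. The bound 2 a^2 + a + 6 uses u^4/2 <= 4 and u^2 <= 2 under the Gaussian weight.\<close>

lemma heat_time_taylor:
  assumes "a \<ge> 0" "t \<ge> 1"
  shows "\<bar>heat a (t + 1) x - (heat a t x + (- a + x\<^sup>2 / (2 * t)) / t * heat a t x)\<bar>
    \<le> (a\<^sup>2 + a + 3) * t powr (- a - 2)"
proof -
  define D where "D = (\<lambda>m::nat. \<lambda>s::real. (if m = 0 then 1 else if m = 1 then - a / s + x\<^sup>2 / (2 * s\<^sup>2)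
     else (- a / s + x\<^sup>2 / (2 * s\<^sup>2))\<^sup>2 + a / s\<^sup>2 - x\<^sup>2 / s ^ 3) * heat a s x)"
  have "\<forall>m s. m < 2 \<and> t \<le> s \<and> s \<le> t + 1 \<longrightarrow> DERIV (D m) s :> D (Suc m) s"
  proof (intro allI impI)
    fix m :: nat and s :: real assume *: "m < 2 \<and> t \<le> s \<and> s \<le> t + 1"
    then have s: "s > 0" using assms by linarith
    have h: "((\<lambda>s. heat a s x) has_real_derivative (- a / s + x\<^sup>2 / (2 * s\<^sup>2)) * heat a s x) (at s)"
      unfolding heat_def using s
      by (auto intro!: derivative_eq_intros simp: powr_diff power2_eq_square field_simps)
    have g: "((\<lambda>s. - a / s + x\<^sup>2 / (2 * s\<^sup>2)) has_real_derivative (a / s\<^sup>2 - x\<^sup>2 / s ^ 3)) (at s)"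
      using s by (auto intro!: derivative_eq_intros simp: power2_eq_square power3_eq_cube field_simps)
    consider "m = 0" | "m = 1" using * by linarith
    then show "DERIV (D m) s :> D (Suc m) s"
    proof cases
      case 1
      then show ?thesis using h by (simp add: D_def)
    next
      case 2
      have alg: "(w\<^sup>2 + b - c) * H = (b - c) * H + w * H * w" for w b c H :: real
        by (simp add: power2_eq_square algebra_simps)
      have "D m = (\<lambda>s. (- a / s + x\<^sup>2 / (2 * s\<^sup>2)) * heat a s x)"
        "D (Suc m) s = (a / s\<^sup>2 - x\<^sup>2 / s ^ 3) * heat a s x
          + (- a / s + x\<^sup>2 / (2 * s\<^sup>2)) * heat a s x * (- a / s + x\<^sup>2 / (2 * s\<^sup>2))"
        using 2 alg[of "- a / s + x\<^sup>2 / (2 * s\<^sup>2)" "a / s\<^sup>2" "x\<^sup>2 / s ^ 3" "heat a s x"] by (simp_all add: D_def)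
      then show ?thesis using DERIV_mult[OF g h] by (simp add: mult.commute)
    qed
  qed
  from Taylor_up[OF _ _ this, of "\<lambda>s. heat a s x" t]
  obtain s where s: "t < s" "s < t + 1"
    and eq0: "heat a (t + 1) x = (\<Sum>m<2. D m t / fact m * (t + 1 - t) ^ m) + D 2 s / fact 2 * (t + 1 - t) ^ 2"
    by (auto simp: D_def)
  have eq: "heat a (t + 1) x - (heat a t x + (- a + x\<^sup>2 / (2 * t)) / t * heat a t x) = D 2 s / 2"
    unfolding eq0 using assms by (simp add: D_def eval_nat_numeral field_simps)
  have s0: "s > 0" using s assms by linarith
  define u where "u = x / sqrt s"
  have u2: "x\<^sup>2 = s * u\<^sup>2" using s0 by (simp add: u_def power_divide)
  have "D 2 s = ((- a + u\<^sup>2 / 2)\<^sup>2 + a - u\<^sup>2) / s\<^sup>2 * heat a s x"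
  proof -
    have "x\<^sup>2 / (2 * s\<^sup>2) = u\<^sup>2 / (2 * s)" "x\<^sup>2 / s ^ 3 = u\<^sup>2 / s\<^sup>2"
      unfolding u2 using s0 by (simp_all add: power2_eq_square power3_eq_cube)
    then have "D 2 s = ((- a / s + u\<^sup>2 / (2 * s))\<^sup>2 + a / s\<^sup>2 - u\<^sup>2 / s\<^sup>2) * heat a s x"
      by (simp add: D_def)
    also have "- a / s + u\<^sup>2 / (2 * s) = (- a + u\<^sup>2 / 2) / s"
      using s0 by (simp add: field_simps)
    also have "((- a + u\<^sup>2 / 2) / s)\<^sup>2 + a / s\<^sup>2 - u\<^sup>2 / s\<^sup>2 = ((- a + u\<^sup>2 / 2)\<^sup>2 + a - u\<^sup>2) / s\<^sup>2"
      by (subst power_divide) (simp only: add_divide_distrib diff_divide_distrib)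
    finally show ?thesis .
  qed
  also have "\<dots> = ((- a + u\<^sup>2 / 2)\<^sup>2 + a - u\<^sup>2) * exp (- u\<^sup>2 / 2) * s powr (- a - 2)"
    using s0 by (simp add: heat_def u2 powr_diff)
  finally have "\<bar>D 2 s\<bar> = \<bar>((- a + u\<^sup>2 / 2)\<^sup>2 + a - u\<^sup>2) * exp (- u\<^sup>2 / 2)\<bar> * s powr (- a - 2)"
    by (simp add: abs_mult)
  also have "\<dots> \<le> (2 * a\<^sup>2 + a + 6) * t powr (- a - 2)"
  proof (intro mult_mono)
    have "\<bar>(- a + u\<^sup>2 / 2)\<^sup>2 + a - u\<^sup>2\<bar> \<le> 2 * a\<^sup>2 + u ^ 4 / 2 + a + u\<^sup>2"
    proof -
      have "0 \<le> (a + u\<^sup>2 / 2)\<^sup>2" by simp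
      then have "(- a + u\<^sup>2 / 2)\<^sup>2 \<le> 2 * a\<^sup>2 + u ^ 4 / 2"
        by (simp add: power2_eq_square power4_eq_xxxx algebra_simps)
      moreover have "0 \<le> (- a + u\<^sup>2 / 2)\<^sup>2" "0 \<le> u\<^sup>2" by auto
      ultimately show ?thesis using assms(1) by (smt (verit))
    qed
    then have "\<bar>((- a + u\<^sup>2 / 2)\<^sup>2 + a - u\<^sup>2) * exp (- u\<^sup>2 / 2)\<bar> \<le> (2 * a\<^sup>2 + u ^ 4 / 2 + a + u\<^sup>2) * exp (- u\<^sup>2 / 2)"
      by (simp add: abs_mult)
    also have "\<dots> = (2 * a\<^sup>2 + a) * exp (- u\<^sup>2 / 2) + (u ^ 4 * exp (- u\<^sup>2 / 2)) / 2 + u\<^sup>2 * exp (- u\<^sup>2 / 2)"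
      by (simp add: algebra_simps)
    also have "\<dots> \<le> (2 * a\<^sup>2 + a) * 1 + 8 / 2 + 2"
      using assms by (intro add_mono mult_left_mono divide_right_mono pow4_exp_le sq_exp_le) auto
    finally show "\<bar>((- a + u\<^sup>2 / 2)\<^sup>2 + a - u\<^sup>2) * exp (- u\<^sup>2 / 2)\<bar> \<le> 2 * a\<^sup>2 + a + 6" by simp
    show "s powr (- a - 2) \<le> t powr (- a - 2)"
      using assms s by (intro powr_mono2') auto
  qed (use assms in auto)
  finally show ?thesis unfolding eq using assms
    by (smt (verit, best) abs_divide distrib_right mult_right_mono powr_ge_zero field_sum_of_halves)
qed

text \<open>The condition R_x = o(1/x) written as a limit of the rescaled drift. In this form
  exchanging p and 1 - p simply replaces \<delta> by -\<delta>.\<close>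

locale bessel_walk = walk +
  fixes \<delta> :: real
  assumes drift: "(\<lambda>x. real x * (2 * p x - 1)) \<longlonglongrightarrow> - \<delta> / 2"
begin

text \<open>For x >= 1 this is x R_x / 2. At 0 it equals \<delta>/2, so
  \<open>drift_err x - \<delta> / 2\<close> vanishes there.\<close>

definition drift_err :: "nat \<Rightarrow> real" where
  "drift_err x = real x * (2 * p x - 1) + \<delta> / 2"

lemma drift_err_tendsto: "drift_err \<longlonglongrightarrow> 0"
  unfolding drift_err_def[abs_def] using tendsto_add[OF drift tendsto_const[of "\<delta> / 2"]] by simp

lemma bounded_drift: obtains C where "bounded_drift_walk p C"
proof -
  from convergent_imp_Bseq[OF convergentI[OF drift]]
  obtain C where "\<And>x. \<bar>real x * (2 * p x - 1)\<bar> \<le> C" by (auto simp: Bseq_def)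
  then show ?thesis using that[of C] walk_axioms 
    by (simp add: bounded_drift_walk_def bounded_drift_walk_axioms_def)
qed

text \<open>The spatial expansion of one step cancels the time derivative. The singular factor 1/x
  of the drift is absorbed by the spatial derivative, which is proportional to x; what remains is
  the drift error, relative to the scale 1/t, and Taylor remainders smaller by sqrt t.\<close>

lemma heat_step:
  assumes \<delta>: "a = (1 - \<delta>) / 2" "a \<ge> 0" and t: "t \<ge> 1"
  shows "\<bar>step p (\<lambda>x. heat a t (real x)) x - heat a (t + 1) (real x)\<bar>
    \<le> t powr (- a - 1) * (\<bar>drift_err x\<bar> + (a\<^sup>2 + a + 6) / sqrt t)"
proof -
  define G where "G = (\<lambda>u::real. exp (- u\<^sup>2 / 2))"
  define y where "y = real x / sqrt t"
  define h where "h = 1 / sqrt t"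
  have t0: "t > 0" "sqrt t > 0" using t by auto
  have h2: "h\<^sup>2 = 1 / t" and h3: "h ^ 3 = 1 / (t * sqrt t)" and hy: "h * y = real x / t" and y2: "y\<^sup>2 = (real x)\<^sup>2 / t"
    using t0 by (simp_all add: h_def y_def power_divide power3_eq_cube)
  have heat_G: "heat a t r = t powr (-a) * G (r / sqrt t)" for r
    using t0 by (simp add: heat_def G_def power_divide mult.commute)
  define E where "E = (\<lambda>s. G (y + s) - (G y - s * y * G y + s\<^sup>2 / 2 * (y\<^sup>2 - 1) * G y))"
  have E: "\<bar>E h\<bar> \<le> 3 * h ^ 3" "\<bar>E (- h)\<bar> \<le> 3 * h ^ 3"
    using gauss_taylor[of y h] gauss_taylor[of y "- h"] t0 by (simp_all add: E_def G_def h_def)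
  define E2 where "E2 = heat a (t + 1) (real x) - (heat a t (real x) + (- a + (real x)\<^sup>2 / (2 * t)) / t * heat a t (real x))"
  have E2: "\<bar>E2\<bar> \<le> (a\<^sup>2 + a + 3) * t powr (- a - 2)"
    unfolding E2_def by (rule heat_time_taylor) fact+
  have heat2: "heat a (t + 1) (real x) = t powr (-a) * (G y + (- a + y\<^sup>2 / 2) / t * G y) + E2"
  proof -
    have e: "heat a t (real x) = t powr (-a) * G y" "(real x)\<^sup>2 / (2 * t) = y\<^sup>2 / 2"
      unfolding y2 by (simp_all add: heat_G y_def)
    show ?thesis unfolding E2_def e by (simp add: distrib_left mult_ac)
  qed
  obtain W where W: "\<bar>W\<bar> \<le> 3 * h ^ 3" and eq:
    "step p (\<lambda>x. heat a t (real x)) x = t powr (-a) * (G y + (y\<^sup>2 - 1) / (2 * t) * G y - (drift_err x - \<delta> / 2) / t * G y + W)"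
  proof (cases "x = 0")
    case True
    \<comment> \<open>Reflection produces no boundary term: the Gaussian has slope 0 at the origin,
      so the forced step up has no first-order contribution.\<close>
    have "step p (\<lambda>x. heat a t (real x)) x = t powr (-a) * G (y + h)"
      using True by (simp add: step_def heat_G y_def h_def)
    also have "G (y + h) = G y + (y\<^sup>2 - 1) / (2 * t) * G y - (drift_err x - \<delta> / 2) / t * G y + E h"
      using True by (simp add: E_def y_def h2 drift_err_def)
    finally show ?thesis using that E by blast
  next
    case False
    have "step p (\<lambda>x. heat a t (real x)) x = t powr (-a) * (p x * G (y + h) + (1 - p x) * G (y - h))"
    proof -
      have "real (x + 1) / sqrt t = y + h" "real (x - 1) / sqrt t = y - h"
        using False by (simp_all add: y_def h_def of_nat_diff add_divide_distrib diff_divide_distrib)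
      then show ?thesis using False unfolding step_def heat_G by (simp only: if_False distrib_left mult.left_commute)
    qed
    also have "p x * G (y + h) + (1 - p x) * G (y - h) =
       (G y + h\<^sup>2 / 2 * (y\<^sup>2 - 1) * G y) - (2 * p x - 1) * (h * y) * G y + (p x * E h + (1 - p x) * E (- h))"
    proof -
      define K where "K = h\<^sup>2 / 2 * (y\<^sup>2 - 1) * G y"
      define L where "L = h * y * G y"
      have e: "G (y + h) = E h + (G y - L + K)" "G (y - h) = E (- h) + (G y + L + K)"
        by (simp_all add: E_def K_def L_def)
      have l: "(2 * p x - 1) * (h * y) * G y = (2 * p x - 1) * L" by (simp add: L_def)
      show ?thesis unfolding K_def[symmetric] e l by (simp add: algebra_simps)
    qed
    also have "\<dots> = G y + (y\<^sup>2 - 1) / (2 * t) * G y - (drift_err x - \<delta> / 2) / t * G y + (p x * E h + (1 - p x) * E (- h))"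
    proof -
      have "(2 * p x - 1) * (h * y) = (drift_err x - \<delta> / 2) / t" "h\<^sup>2 / 2 * (y\<^sup>2 - 1) = (y\<^sup>2 - 1) / (2 * t)"
        unfolding h2 hy drift_err_def using t0 by (simp_all add: field_simps)
      then show ?thesis by (simp only:)
    qed
    finally have 1: "step p (\<lambda>x. heat a t (real x)) x = t powr (-a) * (G y + (y\<^sup>2 - 1) / (2 * t) * G y
        - (drift_err x - \<delta> / 2) / t * G y + (p x * E h + (1 - p x) * E (- h)))" .
    have "p x * E h + (1 - p x) * E (- h) \<le> 3 * h ^ 3" "- (3 * h ^ 3) \<le> p x * E h + (1 - p x) * E (- h)"
      using convex_comb_le[of x "E h" "3 * h ^ 3" "E (-h)"] convex_comb_ge[of x "- (3 * h ^ 3)" "E h" "E (-h)"] E False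
      by auto
    then have "\<bar>p x * E h + (1 - p x) * E (- h)\<bar> \<le> 3 * h ^ 3" by (simp only: abs_le_iff minus_le_iff)
    from that[OF this 1] show ?thesis .
  qed
  have "step p (\<lambda>x. heat a t (real x)) x - heat a (t + 1) (real x)
      = t powr (-a) * (- (drift_err x / t * G y) + W) - E2"
  proof -
    \<comment> \<open>The choice of a is forced here: -1/2 = -a - \<delta>/2.\<close>
    have key: "(y\<^sup>2 - 1) / (2 * t) = (- a + y\<^sup>2 / 2) / t - (\<delta> / 2) / t"
      using t0 by (simp add: \<delta>(1) field_simps)
    show ?thesis unfolding eq heat2 key by (simp add: algebra_simps diff_divide_distrib)
  qed
  also have "\<bar>\<dots>\<bar> \<le> t powr (-a) * (\<bar>drift_err x\<bar> / t * 1 + 3 * h ^ 3) + (a\<^sup>2 + a + 3) * t powr (- a - 2)"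
  proof -
    have "\<bar>drift_err x / t * G y\<bar> \<le> \<bar>drift_err x\<bar> / t * 1"
      unfolding abs_mult using t0 by (intro mult_mono) (auto simp: G_def abs_divide)
    then have "\<bar>- (drift_err x / t * G y) + W\<bar> \<le> \<bar>drift_err x\<bar> / t * 1 + 3 * h ^ 3"
      using W by linarith
    then have "\<bar>t powr (-a) * (- (drift_err x / t * G y) + W)\<bar> \<le> t powr (-a) * (\<bar>drift_err x\<bar> / t * 1 + 3 * h ^ 3)"
      unfolding abs_mult by (intro mult_mono) auto
    then show ?thesis using E2 by linarith
  qed
  also have "\<dots> = t powr (- a - 1) * (\<bar>drift_err x\<bar> + 3 / sqrt t + (a\<^sup>2 + a + 3) / t)"
  proof -
    define P where "P = t powr (- a - 1)"
    have P: "t powr (-a) = P * t" "t powr (- a - 2) = P / t"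
      using t0 by (simp_all add: P_def powr_diff powr_add power2_eq_square)
    show ?thesis unfolding h3 P P_def[symmetric] using t0 by (simp add: field_simps)
  qed
  also have "\<dots> \<le> t powr (- a - 1) * (\<bar>drift_err x\<bar> + 3 / sqrt t + (a\<^sup>2 + a + 3) / sqrt t)"
  proof -
    have "sqrt t * 1 \<le> sqrt t * sqrt t" using t by (intro mult_left_mono) auto
    then have "sqrt t \<le> t" using t0 by simp
    then have "(a\<^sup>2 + a + 3) / t \<le> (a\<^sup>2 + a + 3) / sqrt t"
      using t0 \<delta>(2) by (intro divide_left_mono) auto
    then show ?thesis by (intro mult_left_mono) auto
  qed
  also have "\<dots> = t powr (- a - 1) * (\<bar>drift_err x\<bar> + (a\<^sup>2 + a + 6) / sqrt t)"
    by (simp add: add.assoc flip: add_divide_distrib)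
  finally show ?thesis .
qed

abbreviation null_recurrent_or_transient :: bool where
  "null_recurrent_or_transient \<equiv> (\<lambda>i. ret (2 * i) 0) \<longlonglongrightarrow> 0"

text \<open>The one-step equation at k - 1, solved for the value at k, expresses it through the
  values at k - 1 and k - 2; the constant l satisfies the same equation.\<close>

lemma ret_limit_propagates:
  assumes "(\<lambda>i. ret (2 * i) 0) \<longlonglongrightarrow> l"
  shows "(\<lambda>i. ret (2 * i + k) k) \<longlonglongrightarrow> l"
proof (induction k rule: less_induct)
  case (less k)
  consider "k = 0" | "k = 1" | j where "k = Suc (Suc j)" by (metis One_nat_def not0_implies_Suc)
  then show ?case
  proof cases
    case 1
    then show ?thesis using assms by simp
  next
    case 2
    have "ret (2 * i + k) k = ret (2 * Suc i) 0" for i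
      using 2 by simp
    then show ?thesis using LIMSEQ_Suc[OF assms] by simp
  next
    case 3
    have pj: "p (Suc j) > 0" using p_pos by simp
    have "ret (2 * i + k) k = (ret (2 * Suc i + Suc j) (Suc j) - (1 - p (Suc j)) * ret (2 * Suc i + j) j) / p (Suc j)" for i
      using pj ret_Suc[of "Suc j" "2 * Suc i + j"] by (simp add: 3 field_simps del: walk_prob.simps)
    moreover have "(\<lambda>i. (ret (2 * Suc i + Suc j) (Suc j) - (1 - p (Suc j)) * ret (2 * Suc i + j) j) / p (Suc j))
      \<longlonglongrightarrow> (l - (1 - p (Suc j)) * l) / p (Suc j)"
      using LIMSEQ_Suc[OF less.IH[of "Suc j"]] LIMSEQ_Suc[OF less.IH[of j]] 3 pj
      by (intro tendsto_intros) (auto simp del: walk_prob.simps)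
    ultimately show ?thesis using pj by (simp add: algebra_simps del: walk_prob.simps)
  qed
qed

text \<open>By detailed balance the claim at k is k q_(k+1) <= (k+1) p_k, and twice the difference
  of the two sides tends to 1 - \<delta> > 0. Besides the divergence of the total mass it serves to
  compare the measure at states far beyond sqrt n.\<close>

lemma rev_meas_increasing:
  assumes "\<delta> < 1"
  obtains M where "M \<ge> 1" "\<And>j k. M \<le> j \<Longrightarrow> j \<le> k \<Longrightarrow> real j * rev_meas p j \<le> real k * rev_meas p k"
proof -
  define \<alpha> where "\<alpha> = (\<lambda>k. real k * (2 * p k - 1))"
  have \<alpha>: "\<alpha> \<longlonglongrightarrow> - \<delta> / 2" using drift by (simp add: \<alpha>_def)
  have "(\<lambda>k. 1 + \<alpha> k + \<alpha> (Suc k) + \<alpha> k * (1 / real k) - \<alpha> (Suc k) * (1 / real (Suc k)))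
     \<longlonglongrightarrow> 1 + - \<delta> / 2 + - \<delta> / 2 + (- \<delta> / 2) * 0 - (- \<delta> / 2) * 0"
    by (intro tendsto_intros \<alpha> LIMSEQ_Suc[OF \<alpha>] lim_1_over_n LIMSEQ_Suc[OF lim_1_over_n])
  then have "eventually (\<lambda>k. 0 < 1 + \<alpha> k + \<alpha> (Suc k) + \<alpha> k * (1 / real k) - \<alpha> (Suc k) * (1 / real (Suc k))) sequentially"
    by (rule order_tendstoD) (use assms in simp)
  then obtain N where N: "\<And>k. k \<ge> N \<Longrightarrow> 0 < 1 + \<alpha> k + \<alpha> (Suc k) + \<alpha> k * (1 / real k) - \<alpha> (Suc k) * (1 / real (Suc k))"
    by (auto simp: eventually_sequentially)
  define M where "M = max N 1"
  have incr: "real k * rev_meas p k \<le> real (Suc k) * rev_meas p (Suc k)" if k: "k \<ge> M" for k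
  proof -
    have k1: "k \<ge> 1" "k \<ge> N" using k by (auto simp: M_def)
    have q: "0 < 1 - p (Suc k)" using p_less by simp
    have "2 * (real (Suc k) * p k - real k * (1 - p (Suc k)))
       = 1 + \<alpha> k + \<alpha> (Suc k) + \<alpha> k * (1 / real k) - \<alpha> (Suc k) * (1 / real (Suc k))"
    proof -
      have "\<alpha> k * (1 / real k) = 2 * p k - 1" "\<alpha> (Suc k) * (1 / real (Suc k)) = 2 * p (Suc k) - 1"
        using k1 by (simp_all add: \<alpha>_def)
      then show ?thesis by (simp only: \<alpha>_def of_nat_Suc) (simp add: algebra_simps)
    qed
    then have "0 < 2 * (real (Suc k) * p k - real k * (1 - p (Suc k)))" using N[OF k1(2)] by (simp only:)
    then have *: "real k * (1 - p (Suc k)) \<le> real (Suc k) * p k" by simp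
    have "real k * rev_meas p k * (1 - p (Suc k)) \<le> rev_meas p k * (real (Suc k) * p k)"
      using mult_left_mono[OF *, of "rev_meas p k"] rev_meas_pos[of k] by (simp add: mult_ac)
    also have "\<dots> = real (Suc k) * rev_meas p (Suc k) * (1 - p (Suc k))"
      using detailed_balance(1)[of k] k1 by (simp add: mult_ac)
    finally show ?thesis using q by (simp only: mult_le_cancel_right_pos)
  qed
  have "real j * rev_meas p j \<le> real k * rev_meas p k" if "M \<le> j" "j \<le> k" for j k
    using that(2)
  proof (induction k rule: dec_induct)
    case (step i)
    then show ?case using incr[of i] that(1) by linarith
  qed simp
  then show ?thesis using that[of M] by (auto simp: M_def)
qed

lemma rev_meas_lower:
  assumes "\<delta> < 1"
  obtains c N where "c > 0" "\<And>k. k \<ge> N \<Longrightarrow> c \<le> real k * rev_meas p k"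
proof -
  obtain M where M: "M \<ge> 1" "\<And>j k. M \<le> j \<Longrightarrow> j \<le> k \<Longrightarrow> real j * rev_meas p j \<le> real k * rev_meas p k"
    using rev_meas_increasing[OF assms] by blast
  then show ?thesis using that[of "real M * rev_meas p M" M] rev_meas_pos[of M] by simp
qed

text \<open>A positive limit would make the reversible measure finite, but its mass is that of $\sum k^{-\delta}$.\<close>
lemma ret_tendsto_0:
  assumes "\<delta> < 1"
  shows null_recurrent_or_transient
proof -
  have "decseq (\<lambda>i. ret (2 * i) 0)" unfolding decseq_def using ret_even_antimono by blast
  then obtain l where l: "(\<lambda>i. ret (2 * i) 0) \<longlonglongrightarrow> l"
    using decseq_convergent[of "\<lambda>i. ret (2 * i) 0" 0] ret_nonneg by metis
  have "l \<ge> 0" by (rule LIMSEQ_le_const[OF l]) (use ret_nonneg in auto)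
  moreover have "\<not> l > 0"
  proof
    assume "l > 0"
    have lim: "(\<lambda>i. ret (2 * i) (2 * j)) \<longlonglongrightarrow> l" for j
      using ret_limit_propagates[OF l, of "2 * j"]
      by (intro LIMSEQ_offset[of "\<lambda>i. ret (2 * i) (2 * j)" j]) (simp add: distrib_left del: walk_prob.simps)
    have bound: "(\<Sum>j<K. rev_meas p (2 * j)) \<le> 1 / l" for K
    proof -
      have "(\<Sum>j<K. rev_meas p (2 * j) * ret (2 * i) (2 * j)) \<le> 1" for i
      proof -
        have "(\<Sum>j<K. rev_meas p (2 * j) * ret (2 * i) (2 * j)) = (\<Sum>k\<in>(\<lambda>j. 2 * j) ` {..<K}. rev_meas p k * ret (2 * i) k)"
          by (subst sum.reindex) (auto simp: inj_on_def)
        also have "\<dots> \<le> expect p (2 * i) (\<lambda>x. if x \<in> (\<lambda>j. 2 * j) ` {..<K} then 1 else 0) 0"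
          by (rule rev_meas_sum_ret_le) simp
        also have "\<dots> \<le> expect p (2 * i) (\<lambda>x. 1) 0" by (rule expect_mono) simp
        finally show ?thesis by simp
      qed
      moreover have "(\<lambda>i. \<Sum>j<K. rev_meas p (2 * j) * ret (2 * i) (2 * j)) \<longlonglongrightarrow> (\<Sum>j<K. rev_meas p (2 * j) * l)"
        by (intro tendsto_intros lim)
      ultimately have "(\<Sum>j<K. rev_meas p (2 * j) * l) \<le> 1"
        by (intro LIMSEQ_le_const2) auto
      then show ?thesis using \<open>l > 0\<close> by (simp add: field_simps flip: sum_distrib_left)
    qed
    have sm: "summable (\<lambda>j. rev_meas p (2 * j))"
      by (rule summableI_nonneg_bounded[OF _ bound]) (use rev_meas_pos less_imp_le in blast)
    obtain c N where c: "c > 0" "\<And>k. k \<ge> N \<Longrightarrow> c \<le> real k * rev_meas p k"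
      using rev_meas_lower[OF assms] by blast
    have "c / 2 * inverse (real j) \<le> rev_meas p (2 * j)" if "j \<ge> max N 1" for j
      using c(2)[of "2 * j"] that by (simp add: field_simps)
    then have "eventually (\<lambda>j. norm (c / 2 * inverse (real j)) \<le> rev_meas p (2 * j)) sequentially"
      using c(1) by (auto simp: eventually_sequentially intro!: exI[of _ "max N 1"])
    from this sm have "summable (\<lambda>j. c / 2 * inverse (real j))"
      by (rule summable_comparison_test_ev)
    then have "summable (\<lambda>j. inverse (real j))" using c(1) by (simp add: summable_cmult_iff)
    then show False using not_summable_harmonic by blast
  qed
  ultimately show ?thesis using l by simp
qed

lemma walk_prob_from_0_tendsto_0:
  assumes null_recurrent_or_transient
  shows "(\<lambda>n. walk_prob p n 0 j) \<longlonglongrightarrow> 0"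
proof (rule Lim_null_comparison)
  have "ret n j \<le> ret (2 * ((n + 1) div 2)) 0" for n
  proof (cases "even (n + j)")
    case True
    have "(if even n then n else n + 1) = 2 * ((n + 1) div 2)" by auto
    then show ?thesis using ret_le_origin[OF True] by (simp only:)
  qed (simp add: ret_odd ret_nonneg)
  then have "\<bar>rev_meas p j * ret n j\<bar> \<le> rev_meas p j * ret (2 * ((n + 1) div 2)) 0" for n
    using less_imp_le[OF rev_meas_pos[of j]] ret_nonneg[of n j]
    by (simp only: abs_mult abs_of_nonneg mult_left_mono)
  then show "eventually (\<lambda>n. norm (walk_prob p n 0 j) \<le> rev_meas p j * ret (2 * ((n + 1) div 2)) 0) sequentially"
    by (intro always_eventually allI) (simp only: walk_prob_from_0[of _ j] real_norm_def)
  have "filterlim (\<lambda>n::nat. (n + 1) div 2) sequentially sequentially"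
    unfolding filterlim_at_top
  proof
    fix Z :: nat
    show "eventually (\<lambda>n. Z \<le> (n + 1) div 2) sequentially"
      by (rule eventually_sequentiallyI[of "2 * Z"]) linarith
  qed
  from filterlim_compose[OF assms this]
  show "(\<lambda>n. rev_meas p j * ret (2 * ((n + 1) div 2)) 0) \<longlonglongrightarrow> 0"
    by (intro tendsto_mult_right_zero)
qed

text \<open>The walk leaves every finite set in probability, so the values of f near 0, which need
  not be small, carry vanishing weight.\<close>

lemma expect_tendsto_0:
  assumes null_recurrent_or_transient "f \<longlonglongrightarrow> 0"
  shows "(\<lambda>n. expect p n (\<lambda>x. \<bar>f x\<bar>) 0) \<longlonglongrightarrow> 0"
proof (rule LIMSEQ_I)
  fix e :: real assume e: "0 < e"
  obtain N where N: "\<And>x. x \<ge> N \<Longrightarrow> \<bar>f x\<bar> < e / 2"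
    using LIMSEQ_D[OF assms(2), of "e / 2"] e by auto
  have "(\<lambda>n. \<Sum>j<N. \<bar>f j\<bar> * walk_prob p n 0 j) \<longlonglongrightarrow> (\<Sum>j<N. \<bar>f j\<bar> * 0)"
    by (intro tendsto_intros walk_prob_from_0_tendsto_0 assms)
  then have "eventually (\<lambda>n. (\<Sum>j<N. \<bar>f j\<bar> * walk_prob p n 0 j) < e / 2) sequentially"
    by (rule order_tendstoD) (use e in simp)
  then obtain M where M: "\<And>n. n \<ge> M \<Longrightarrow> (\<Sum>j<N. \<bar>f j\<bar> * walk_prob p n 0 j) < e / 2"
    by (auto simp: eventually_sequentially)
  have "norm (expect p n (\<lambda>x. \<bar>f x\<bar>) 0 - 0) < e" if "n \<ge> M" for n
  proof -
    have "expect p n (\<lambda>x. \<bar>f x\<bar>) 0 \<le> expect p n (\<lambda>x. e / 2 + (\<Sum>j<N. \<bar>f j\<bar> * (if x = j then 1 else 0))) 0"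
    proof (rule expect_mono)
      fix x
      have "(\<Sum>j<N. \<bar>f j\<bar> * (if x = j then 1 else 0)) = (if x < N then \<bar>f x\<bar> else 0)"
        by (simp add: if_distrib cong: if_cong)
      then show "\<bar>f x\<bar> \<le> e / 2 + (\<Sum>j<N. \<bar>f j\<bar> * (if x = j then 1 else 0))"
        using N[of x] e by auto
    qed
    also have "\<dots> = e / 2 + (\<Sum>j<N. \<bar>f j\<bar> * walk_prob p n 0 j)"
      unfolding expect_add expect_sum expect_cmult walk_prob_eq_expect by simp
    also have "\<dots> < e" using M[OF that] by simp
    finally show ?thesis using expect_nonneg[of "\<lambda>x. \<bar>f x\<bar>" n 0] by simp
  qed
  then show "\<exists>no. \<forall>n\<ge>no. norm (expect p n (\<lambda>x. \<bar>f x\<bar>) 0 - 0) < e" by blast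
qed

text \<open>Stopping the heat parameter at T = s n rather than at 0 keeps the Gaussian smooth on the
  scale sqrt n during all n steps, so every telescoping error is controlled at parameter T.\<close>

lemma expect_gauss_diff_le:
  assumes \<delta>: "a = (1 - \<delta>) / 2" "a \<ge> 0" and s: "s > 0" and n: "n \<ge> 1" "s * real n \<ge> 1"
  shows "\<bar>expect p n (\<lambda>x. exp (- (real x)\<^sup>2 / (2 * (s * real n)))) 0 - (s / (1 + s)) powr a\<bar>
    \<le> 1 / s * ((\<Sum>m<n. expect p m (\<lambda>x. \<bar>drift_err x\<bar>) 0) / real n + (a\<^sup>2 + a + 6) / sqrt (s * real n))"
proof -
  define T where "T = s * real n"
  define K where "K = a\<^sup>2 + a + 6"
  \<comment> \<open>Run the walk for m steps and the approximate martingale for the remaining n - m.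
    \<open>A n\<close> contains the wanted transform, and \<open>A 0\<close> is explicit because the
    walk starts at 0.\<close>
  define A where "A = (\<lambda>m. expect p m (\<lambda>x. heat a (T + real (n - m)) (real x)) 0)"
  have T: "T \<ge> 1" using n by (simp add: T_def)
  have diff: "\<bar>A (Suc m) - A m\<bar> \<le> T powr (- a - 1) * (expect p m (\<lambda>x. \<bar>drift_err x\<bar>) 0 + K / sqrt T)" if m: "m < n" for m
  proof -
    define t where "t = T + real (n - Suc m)"
    have t: "t \<ge> T" "t \<ge> 1" "T + real (n - m) = t + 1" using T m by (auto simp: t_def of_nat_diff)
    have eq: "A (Suc m) - A m = expect p m (\<lambda>x. step p (\<lambda>x. heat a t (real x)) x - heat a (t + 1) (real x)) 0"
      by (simp add: A_def expect_Suc_inner expect_diff t_def[symmetric] t(3))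
    have "\<bar>A (Suc m) - A m\<bar> \<le> expect p m (\<lambda>x. \<bar>step p (\<lambda>x. heat a t (real x)) x - heat a (t + 1) (real x)\<bar>) 0"
      unfolding eq by (rule expect_abs_le)
    also have "\<dots> \<le> expect p m (\<lambda>x. T powr (- a - 1) * (\<bar>drift_err x\<bar> + K / sqrt T)) 0"
    proof (rule expect_mono)
      fix x
      have "\<bar>step p (\<lambda>x. heat a t (real x)) x - heat a (t + 1) (real x)\<bar> \<le> t powr (- a - 1) * (\<bar>drift_err x\<bar> + K / sqrt t)"
        unfolding K_def by (rule heat_step[OF \<delta> t(2)])
      also have "\<dots> \<le> T powr (- a - 1) * (\<bar>drift_err x\<bar> + K / sqrt T)"
        using t T \<delta>(2) by (intro mult_mono powr_mono2' add_mono divide_left_mono) (auto simp: K_def)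
      finally show "\<bar>step p (\<lambda>x. heat a t (real x)) x - heat a (t + 1) (real x)\<bar> \<le> T powr (- a - 1) * (\<bar>drift_err x\<bar> + K / sqrt T)" .
    qed
    also have "\<dots> = T powr (- a - 1) * (expect p m (\<lambda>x. \<bar>drift_err x\<bar>) 0 + K / sqrt T)"
      by (simp add: expect_cmult expect_add)
    finally show ?thesis .
  qed
  have eq: "A n - A 0 = (\<Sum>m<n. A (Suc m) - A m)" by (simp add: sum_lessThan_telescope)
  have "\<bar>A n - A 0\<bar> \<le> (\<Sum>m<n. \<bar>A (Suc m) - A m\<bar>)" unfolding eq by (rule sum_abs)
  also have "\<dots> \<le> (\<Sum>m<n. T powr (- a - 1) * (expect p m (\<lambda>x. \<bar>drift_err x\<bar>) 0 + K / sqrt T))"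
    by (intro sum_mono diff) simp
  also have "\<dots> = T powr (- a - 1) * ((\<Sum>m<n. expect p m (\<lambda>x. \<bar>drift_err x\<bar>) 0) + real n * (K / sqrt T))"
    by (simp add: sum.distrib flip: sum_distrib_left)
  finally have main: "\<bar>A n - A 0\<bar> \<le> \<dots>" .
  define S where "S = (\<Sum>m<n. expect p m (\<lambda>x. \<bar>drift_err x\<bar>) 0)"
  have A_n: "A n = T powr (-a) * expect p n (\<lambda>x. exp (- (real x)\<^sup>2 / (2 * (s * real n)))) 0"
    by (simp add: A_def heat_def expect_cmult T_def)
  have A_0: "A 0 = T powr (-a) * (s / (1 + s)) powr a"
  proof -
    have "T + real n = T * ((1 + s) / s)" using s by (simp add: T_def field_simps)
    then have "A 0 = (T * ((1 + s) / s)) powr (- a)" by (simp add: A_def heat_def)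
    also have "\<dots> = T powr (-a) * ((1 + s) / s) powr (- a)" by (rule powr_mult)
    also have "((1 + s) / s) powr (- a) = (s / (1 + s)) powr a"
      using s by (simp add: powr_divide powr_minus field_simps)
    finally show ?thesis .
  qed
  have "T powr (-a) * \<bar>expect p n (\<lambda>x. exp (- (real x)\<^sup>2 / (2 * (s * real n)))) 0 - (s / (1 + s)) powr a\<bar> = \<bar>A n - A 0\<bar>"
    unfolding A_n A_0 by (simp add: abs_mult flip: right_diff_distrib)
  also have "\<dots> \<le> T powr (-a) * (1 / T * (S + real n * (K / sqrt T)))"
    using main T by (simp add: S_def powr_diff)
  finally have "\<bar>expect p n (\<lambda>x. exp (- (real x)\<^sup>2 / (2 * (s * real n)))) 0 - (s / (1 + s)) powr a\<bar>
      \<le> 1 / T * (S + real n * (K / sqrt T))"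
    using T by (simp only: mult_le_cancel_left_pos powr_gt_zero)
  also have "1 / T * (S + real n * (K / sqrt T)) = 1 / s * (S / real n + K / sqrt T)"
    using n s by (simp add: T_def field_simps)
  finally show ?thesis by (simp only: S_def K_def T_def)
qed

text \<open>The limit is the Laplace transform (1 + 1/s)^(-a) of the Gamma law of shape a. For a = 0
  it is 1, the transform of the point mass at 0, which is the case \<delta> = 1.\<close>

lemma laplace_limit:
  assumes null: null_recurrent_or_transient and \<delta>: "a = (1 - \<delta>) / 2" "a \<ge> 0" and s: "s > 0"
  shows "(\<lambda>n. expect p n (\<lambda>x. exp (- (real x)\<^sup>2 / (2 * (s * real n)))) 0) \<longlonglongrightarrow> (s / (1 + s)) powr a"
proof -
  have "(\<lambda>n. expect p n (\<lambda>x. exp (- (real x)\<^sup>2 / (2 * (s * real n)))) 0 - (s / (1 + s)) powr a) \<longlonglongrightarrow> 0"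
  proof (rule Lim_null_comparison)
    obtain N :: nat where N: "1 / s < real N" using reals_Archimedean2 by blast
    have "s * real n \<ge> 1" if "n \<ge> N" for n
    proof -
      have "1 < s * real N" using N s by (simp add: field_simps)
      also have "\<dots> \<le> s * real n" using that s by simp
      finally show ?thesis by simp
    qed
    then show "eventually (\<lambda>n. norm (expect p n (\<lambda>x. exp (- (real x)\<^sup>2 / (2 * (s * real n)))) 0 - (s / (1 + s)) powr a)
       \<le> 1 / s * ((\<Sum>m<n. expect p m (\<lambda>x. \<bar>drift_err x\<bar>) 0) / real n + (a\<^sup>2 + a + 6) / sqrt (s * real n))) sequentially"
      unfolding real_norm_def
      by (intro eventually_sequentiallyI[of "max N 1"] expect_gauss_diff_le \<delta> s) auto
    have 1: "(\<lambda>n. (\<Sum>m<n. expect p m (\<lambda>x. \<bar>drift_err x\<bar>) 0) / real n) \<longlonglongrightarrow> 0"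
      by (intro cesaro_zero expect_tendsto_0 null drift_err_tendsto)
    have 2: "(\<lambda>n. (a\<^sup>2 + a + 6) / sqrt (s * real n)) \<longlonglongrightarrow> 0"
      using s by (intro tendsto_divide_0[OF tendsto_const] filterlim_at_top_imp_at_infinity
          filterlim_compose[OF sqrt_at_top] filterlim_tendsto_pos_mult_at_top[OF tendsto_const]
          filterlim_real_sequentially)
    show "(\<lambda>n. 1 / s * ((\<Sum>m<n. expect p m (\<lambda>x. \<bar>drift_err x\<bar>) 0) / real n + (a\<^sup>2 + a + 6) / sqrt (s * real n))) \<longlonglongrightarrow> 0"
      using tendsto_mult_right_zero[OF tendsto_add_zero[OF 1 2]] by blast
  qed
  then show ?thesis by (simp add: LIM_zero_iff)
qed

end

section \<open>The Gamma law and its tail function\<close>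

definition gamma_density :: "real \<Rightarrow> real \<Rightarrow> real" where
  "gamma_density a u = u powr (a - 1) * exp (- u)"

lemma gamma_density_nonneg: "0 \<le> gamma_density a u"
  by (simp add: gamma_density_def)

lemma has_integral_gamma_density:
  "a > 0 \<Longrightarrow> (gamma_density a has_integral Gamma a) {0..}"
  using Gamma_integral_real[of a] by (simp add: gamma_density_def[abs_def] exp_minus divide_inverse)

lemma gamma_density_integrable_on:
  assumes "a > 0" "y \<ge> 0"
  shows "gamma_density a integrable_on {y..}" "gamma_density a integrable_on {y..z}"
proof -
  have "gamma_density a absolutely_integrable_on {0..}"
    using has_integral_gamma_density[OF assms(1)] gamma_density_nonneg
    by (intro nonnegative_absolutely_integrable_1) (auto simp: integrable_on_def)
  then have "gamma_density a absolutely_integrable_on {y..}" "gamma_density a absolutely_integrable_on {y..z}"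
    by (rule set_integrable_subset; use assms in auto)+
  then show "gamma_density a integrable_on {y..}" "gamma_density a integrable_on {y..z}"
    by (auto intro: set_lebesgue_integral_eq_integral(1))
qed

text \<open>Substitution of (1 + j) u for u. These are the moments of exp(-u), a variable with
  values in [0,1], which is the setting for polynomial approximation.\<close>

lemma has_integral_exp_gamma_density:
  assumes a: "a > 0"
  shows "((\<lambda>u. exp (- u) ^ j * gamma_density a u) has_integral Gamma a * (1 + real j) powr (- a)) {0..}"
proof -
  define c where "c = 1 + real j"
  have c: "c > 0" by (simp add: c_def)
  have img: "(\<lambda>u. c * u) ` {0..} = {0..}"
  proof (rule set_eqI, rule iffI)
    fix y assume "y \<in> {0::real..}"
    then have "y = c * (y / c)" "y / c \<in> {0..}" using c by auto
    then show "y \<in> (\<lambda>u. c * u) ` {0..}" by blast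
  qed (use c in auto)
  have "gamma_density a absolutely_integrable_on {0..}"
    using has_integral_gamma_density[OF a] gamma_density_nonneg
    by (intro nonnegative_absolutely_integrable_1) (auto simp: integrable_on_def)
  then have "gamma_density a absolutely_integrable_on (\<lambda>u. c * u) ` {0..} \<and>
     integral ((\<lambda>u. c * u) ` {0..}) (gamma_density a) = Gamma a"
    using has_integral_gamma_density[OF a] by (simp add: img integral_unique)
  then have "(\<lambda>u. \<bar>c\<bar> * gamma_density a (c * u)) absolutely_integrable_on {0..} \<and>
     integral {0..} (\<lambda>u. \<bar>c\<bar> * gamma_density a (c * u)) = Gamma a"
    by (subst has_absolute_integral_change_of_variables_1'[where g = "\<lambda>u. c * u"])
      (use c in \<open>auto intro!: derivative_eq_intros inj_onI\<close>)
  then have "((\<lambda>u. c * gamma_density a (c * u)) has_integral Gamma a) {0..}"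
    using c by (auto simp: has_integral_iff dest: set_lebesgue_integral_eq_integral(1))
  then have "((\<lambda>u. c powr (- a) * (c * gamma_density a (c * u))) has_integral c powr (- a) * Gamma a) {0..}"
    by (rule has_integral_mult_right)
  then show ?thesis
  proof (rule has_integral_eq[rotated, where f = "\<lambda>u. c powr (- a) * (c * gamma_density a (c * u))",
      THEN back_subst[of "\<lambda>x. (_ has_integral x) _"]])
    fix u :: real assume u: "u \<in> {0..}"
    have e: "exp (- u) ^ j * exp (- u) = exp (- (c * u))"
      unfolding exp_of_nat_mult[symmetric] exp_add[symmetric] by (simp add: c_def algebra_simps)
    have e2:      "c powr (- a) * (c * (c * u) powr (a - 1)) = u powr (a - 1)"
      using c u by (simp add: powr_mult powr_diff powr_minus field_simps)
    show "c powr (- a) * (c * gamma_density a (c * u)) = exp (- u) ^ j * gamma_density a u"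
    proof -
      have "c powr (- a) * (c * gamma_density a (c * u)) = c powr (- a) * (c * (c * u) powr (a - 1)) * exp (- (c * u))"
        by (simp add: gamma_density_def mult_ac)
      also have "\<dots> = u powr (a - 1) * (exp (- u) ^ j * exp (- u))" by (simp only: e e2)
      finally show ?thesis by (simp add: gamma_density_def mult_ac)
    qed
  qed (simp add: c_def mult.commute)
qed

lemma Gamma_up_eq: "Gamma_up a y = integral {y..} (gamma_density a) / Gamma a"
  by (simp add: Gamma_up_def gamma_density_def[abs_def])

lemma Gamma_up_0: "a > 0 \<Longrightarrow> Gamma_up a 0 = 1"
  using integral_unique[OF has_integral_gamma_density] by (simp add: Gamma_up_eq Gamma_eq_zero_iff nonpos_Ints_def)

lemma Gamma_up_nonneg: "a > 0 \<Longrightarrow> y \<ge> 0 \<Longrightarrow> 0 \<le> Gamma_up a y"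
  using Gamma_real_pos[of a] unfolding Gamma_up_eq
  by (intro divide_nonneg_pos integral_nonneg gamma_density_integrable_on) (auto simp: gamma_density_nonneg)

lemma Gamma_up_diff:
  assumes "a > 0" "0 \<le> y" "y \<le> z"
  shows "Gamma_up a y - Gamma_up a z = integral {y..z} (gamma_density a) / Gamma a"
proof -
  have "(gamma_density a has_integral (integral {y..z} (gamma_density a) + integral {z..} (gamma_density a))) ({y..z} \<union> {z..})"
  proof (rule has_integral_Un)
    have "{y..z} \<inter> {z..} = {z}" using assms by auto
    then show "negligible ({y..z} \<inter> {z..})" by simp
  qed (use gamma_density_integrable_on(2)[of a y z] gamma_density_integrable_on(1)[of a z] assms in \<open>auto intro: integrable_integral\<close>)
  moreover have "{y..z} \<union> {z..} = {y..}" using assms by auto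
  ultimately have "integral {y..} (gamma_density a) = integral {y..z} (gamma_density a) + integral {z..} (gamma_density a)"
    by (simp add: integral_unique)
  then show ?thesis by (simp add: Gamma_up_eq diff_divide_distrib[symmetric])
qed

lemma Gamma_up_antimono:
  assumes "a > 0" "0 \<le> y" "y \<le> z"
  shows "Gamma_up a z \<le> Gamma_up a y"
proof -
  have "0 \<le> integral {y..z} (gamma_density a) / Gamma a"
    using Gamma_real_pos[of a] assms
    by (intro divide_nonneg_pos integral_nonneg gamma_density_integrable_on) (auto simp: gamma_density_nonneg)
  then show ?thesis using Gamma_up_diff[OF assms] by simp
qed

lemma continuous_on_Gamma_up:
  assumes "a > 0"
  shows "continuous_on {0..b} (Gamma_up a)"
proof -
  have "continuous_on {0..b} (\<lambda>y. 1 - integral {0..y} (gamma_density a) / Gamma a)"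
    using Gamma_real_pos[OF assms] gamma_density_integrable_on(2)[OF assms, of 0 b]
    by (intro continuous_intros indefinite_integral_continuous_1) auto
  then show ?thesis
    using Gamma_up_diff[OF assms order_refl] Gamma_up_0[OF assms]
    by (subst continuous_on_cong[OF refl, where g = "\<lambda>y. 1 - integral {0..y} (gamma_density a) / Gamma a"])
      (auto simp: algebra_simps)
qed

text \<open>Markov's inequality; the Gamma law of shape a has mean a.\<close>

lemma Gamma_up_le:
  assumes a: "a > 0" and y: "y > 0"
  shows "Gamma_up a y \<le> a / y"
proof -
  have "y * integral {y..} (gamma_density a) = integral {y..} (\<lambda>u. y * gamma_density a u)" by simp
  also have "\<dots> \<le> integral {y..} (gamma_density (a + 1))"
  proof (rule integral_le)
    show "(\<lambda>u. y * gamma_density a u) integrable_on {y..}"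
      using gamma_density_integrable_on(1)[OF a, of y] y integrable_on_cmult_left[of "gamma_density a" "{y..}" y] by auto
    show "gamma_density (a + 1) integrable_on {y..}"
      using gamma_density_integrable_on(1)[of "a + 1" y] a y by auto
    fix u assume u: "u \<in> {y..}"
    have "y * gamma_density a u \<le> u * gamma_density a u"
      using u gamma_density_nonneg by (intro mult_right_mono) auto
    also have "\<dots> = gamma_density (a + 1) u"
      using u y by (simp add: gamma_density_def powr_diff)
    finally show "y * gamma_density a u \<le> gamma_density (a + 1) u" .
  qed
  also have "\<dots> \<le> integral {0..} (gamma_density (a + 1))"
    using a y by (intro integral_subset_le gamma_density_integrable_on) (auto simp: gamma_density_nonneg)
  also have "\<dots> = a * Gamma a"
    using integral_unique[OF has_integral_gamma_density[of "a + 1"]] a Gamma_plus1[of a] by (auto simp: nonpos_Ints_def)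
  finally show ?thesis using Gamma_real_pos[OF a] y by (simp add: Gamma_up_eq field_simps)
qed

text \<open>Quantile grid for Polya's argument: pointwise comparison at finitely many points suffices.\<close>
lemma Gamma_up_grid:
  assumes a: "a > 0" and N: "N \<ge> 1"
  obtains y where "y 0 = 0" "\<And>i. i < N \<Longrightarrow> Gamma_up a (y i) = 1 - real i / real N"
    "\<And>i. Suc i < N \<Longrightarrow> y i < y (Suc i)"
proof -
  have ex: "\<exists>y\<ge>0. Gamma_up a y = 1 - real i / real N" if "i < N" for i
  proof -
    define v where "v = 1 - real i / real N"
    have v: "v > 0" "v \<le> 1" using that by (auto simp: v_def field_simps)
    \<comment> \<open>Markov's inequality at a / v gives the right end of an interval on which the
      intermediate value theorem finds the quantile.\<close>
    have "Gamma_up a (a / v) \<le> a / (a / v)" using Gamma_up_le[OF a, of "a / v"] a v by simp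
    then have le: "Gamma_up a (a / v) \<le> v" using a by simp
    have "\<exists>x\<ge>0. x \<le> a / v \<and> Gamma_up a x = v"
      by (rule IVT2') (use le v a Gamma_up_0[OF a] continuous_on_Gamma_up[OF a] in auto)
    then show ?thesis by (auto simp: v_def)
  qed
  define y where "y = (\<lambda>i. if i = 0 then 0 else SOME y. y \<ge> 0 \<and> Gamma_up a y = 1 - real i / real N)"
  have y: "y i \<ge> 0 \<and> Gamma_up a (y i) = 1 - real i / real N" if "i < N" for i
    using someI_ex[OF ex[OF that]] Gamma_up_0[OF a] by (auto simp: y_def)
  have "y i < y (Suc i)" if "Suc i < N" for i
  proof (rule ccontr)
    assume "\<not> y i < y (Suc i)"
    then have "Gamma_up a (y i) \<le> Gamma_up a (y (Suc i))"
      using y[of i] y[of "Suc i"] that by (intro Gamma_up_antimono a) auto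
    then show False using y[of i] y[of "Suc i"] that N by (simp add: field_simps)
  qed
  then show ?thesis using that[of y] y by (auto simp: y_def)
qed

section \<open>From transforms to uniform convergence of the scaled tail\<close>

context bessel_walk
begin

definition scaled_tail :: "nat \<Rightarrow> real \<Rightarrow> real" where
  "scaled_tail n y = expect p n (\<lambda>x. if y < (real x)\<^sup>2 / (2 * real n) then 1 else 0) 0"

lemma scaled_tail_antimono: "y \<le> z \<Longrightarrow> scaled_tail n z \<le> scaled_tail n y"
  unfolding scaled_tail_def by (rule expect_mono) auto

lemma scaled_tail_nonneg: "0 \<le> scaled_tail n y"
  unfolding scaled_tail_def by (rule expect_nonneg) auto

lemma scaled_tail_le_1: "scaled_tail n y \<le> 1"
  unfolding scaled_tail_def using expect_mono[of 0 n _ "\<lambda>_. 1"] by simp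

lemma laplace_limit_power:
  assumes null: null_recurrent_or_transient and \<delta>: "a = (1 - \<delta>) / 2" "a \<ge> 0"
  shows "(\<lambda>n. expect p n (\<lambda>x. exp (- ((real x)\<^sup>2 / (2 * real n))) ^ j) 0) \<longlonglongrightarrow> (1 + real j) powr (- a)"
proof (cases "j = 0")
  case False
  have "exp (- ((real x)\<^sup>2 / (2 * real n))) ^ j = exp (- (real x)\<^sup>2 / (2 * (1 / real j * real n)))" for x n
    by (simp flip: exp_of_nat_mult add: mult.commute)
  moreover have "(1 / real j / (1 + 1 / real j)) powr a = (1 + real j) powr (- a)"
    using False by (simp add: powr_minus powr_divide field_simps)
  ultimately show ?thesis using laplace_limit[OF assms, of "1 / real j"] False by simp
qed simp

text \<open>In the variable t = exp(-u) the half-line u > y becomes t < exp(-y). The piecewise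
  linear f lies between the indicators belonging to z and y, and a polynomial within e/3 of f has
  expectations that converge. Two approximation errors and one limit use up e.\<close>

lemma scaled_tail_sandwich:
  assumes null: null_recurrent_or_transient and \<delta>: "a = (1 - \<delta>) / 2" "a > 0"
    and y: "0 \<le> y" "y < z" and e: "e > 0"
  shows "eventually (\<lambda>n. Gamma_up a z - e < scaled_tail n y) sequentially"
    "eventually (\<lambda>n. scaled_tail n z < Gamma_up a y + e) sequentially"
proof -
  have G: "Gamma a > 0" using \<delta>(2) by simp
  define f where "f = (\<lambda>t. max 0 (min 1 ((exp (- y) - t) / (exp (- y) - exp (- z)))))"
  have yz: "exp (- z) < exp (- y)" using y by simp
  have f01: "0 \<le> f t" "f t \<le> 1" for t by (auto simp: f_def)
  have f0: "f t = 0" if "exp (- y) \<le> t" for t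
  proof -
    have "(exp (- y) - t) / (exp (- y) - exp (- z)) \<le> 0"
      using that yz by (intro divide_nonpos_pos) auto
    then show ?thesis by (simp add: f_def)
  qed
  have f1: "f t = 1" if "t \<le> exp (- z)" for t using that yz by (simp add: f_def field_simps min_def)
  have "continuous_on {0..1} f" unfolding f_def using yz by (intro continuous_intros) auto
  then obtain g where g: "real_polynomial_function g" "\<And>t. t \<in> {0..1} \<Longrightarrow> \<bar>f t - g t\<bar> < e / 3"
    using Stone_Weierstrass_real_polynomial_function[of "{0..1::real}" f "e / 3"] e by auto
  have fg: "f t \<le> g t + e / 3" "g t \<le> f t + e / 3" if "t \<in> {0..1}" for t
    using g(2)[OF that] unfolding abs_less_iff by linarith+
  from g(1) obtain c N where gc: "g = (\<lambda>t. \<Sum>i\<le>N. c i * t ^ i)" using real_polynomial_function_iff_sum by blast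
  define I where "I = (\<Sum>i\<le>N. c i * (1 + real i) powr (- a))"
  have lim: "(\<lambda>n. expect p n (\<lambda>x. g (exp (- ((real x)\<^sup>2 / (2 * real n))))) 0) \<longlonglongrightarrow> I"
    unfolding gc I_def expect_sum expect_cmult
    by (intro tendsto_intros laplace_limit_power null \<delta>) (use \<delta> in auto)
  have int: "((\<lambda>u. g (exp (- u)) * gamma_density a u) has_integral I * Gamma a) {0..}"
    unfolding gc I_def sum_distrib_right
  proof (intro has_integral_sum finite_atMost)
    fix i
    show "((\<lambda>u. c i * exp (- u) ^ i * gamma_density a u) has_integral c i * (1 + real i) powr (- a) * Gamma a) {0..}"
      using has_integral_mult_right[OF has_integral_exp_gamma_density[OF \<delta>(2)], of "c i" i] by (simp add: mult_ac)
  qed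
  have int3: "((\<lambda>u. e / 3 * gamma_density a u) has_integral e / 3 * Gamma a) {0..}"
    by (intro has_integral_mult_right has_integral_gamma_density \<delta>)
  have u01: "u \<ge> 0 \<Longrightarrow> exp (- u) \<in> {0..1}" for u :: real by auto
  have tail: "((\<lambda>u. if u \<in> {b..} then gamma_density a u else 0) has_integral Gamma_up a b * Gamma a) {0..}"
    if "b \<ge> 0" for b
    using that G gamma_density_integrable_on(1)[OF \<delta>(2) that]
    by (subst has_integral_restrict) (auto simp: Gamma_up_eq intro: integrable_integral)
  have I1: "Gamma_up a z - e / 3 \<le> I"
  proof -
    have "Gamma_up a z * Gamma a \<le> I * Gamma a + e / 3 * Gamma a"
    proof (rule has_integral_le[OF tail has_integral_add[OF int int3]])
      fix u :: real assume u: "u \<in> {0..}"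
      have "(if u \<in> {z..} then 1 else 0) \<le> f (exp (- u))" using f1[of "exp (- u)"] f01 by auto
      also have "\<dots> \<le> g (exp (- u)) + e / 3" using fg[OF u01[of u]] u by simp
      finally have "(if u \<in> {z..} then 1 else 0) * gamma_density a u \<le> (g (exp (- u)) + e / 3) * gamma_density a u"
        by (rule mult_right_mono[OF _ gamma_density_nonneg])
      then show "(if u \<in> {z..} then gamma_density a u else 0) \<le> g (exp (- u)) * gamma_density a u + e / 3 * gamma_density a u"
        by (auto simp: algebra_simps split: if_splits)
    qed (use y in auto)
    then have "Gamma_up a z * Gamma a \<le> (I + e / 3) * Gamma a" by (simp add: algebra_simps)
    then show ?thesis using G by simp
  qed
  have I2: "I \<le> Gamma_up a y + e / 3"
  proof -
    have "I * Gamma a \<le> Gamma_up a y * Gamma a + e / 3 * Gamma a"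
    proof (rule has_integral_le[OF int has_integral_add[OF tail int3]])
      fix u :: real assume u: "u \<in> {0..}"
      have "g (exp (- u)) \<le> f (exp (- u)) + e / 3" using fg[OF u01[of u]] u by simp
      also have "f (exp (- u)) \<le> (if u \<in> {y..} then 1 else 0)" using f0[of "exp (- u)"] f01 by auto
      finally have "g (exp (- u)) * gamma_density a u \<le> ((if u \<in> {y..} then 1 else 0) + e / 3) * gamma_density a u"
        by (intro mult_right_mono gamma_density_nonneg) auto
      then show "g (exp (- u)) * gamma_density a u \<le> (if u \<in> {y..} then gamma_density a u else 0) + e / 3 * gamma_density a u"
        by (auto simp: algebra_simps split: if_splits)
    qed (use y in auto)
    then have "I * Gamma a \<le> (Gamma_up a y + e / 3) * Gamma a" by (simp add: algebra_simps)
    then show ?thesis using G by simp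
  qed
  have T1: "expect p n (\<lambda>x. g (exp (- ((real x)\<^sup>2 / (2 * real n))))) 0 - e / 3 \<le> scaled_tail n y" for n
  proof -
    have "expect p n (\<lambda>x. g (exp (- ((real x)\<^sup>2 / (2 * real n)))) - e / 3) 0 \<le> scaled_tail n y"
      unfolding scaled_tail_def
    proof (rule expect_mono)
      fix x
      show "g (exp (- ((real x)\<^sup>2 / (2 * real n)))) - e / 3 \<le> (if y < (real x)\<^sup>2 / (2 * real n) then 1 else 0)"
        using fg[OF u01[of "(real x)\<^sup>2 / (2 * real n)"]] f01[of "exp (- ((real x)\<^sup>2 / (2 * real n)))"]
          f0[of "exp (- ((real x)\<^sup>2 / (2 * real n)))"] by auto
    qed
    then show ?thesis by (simp add: expect_diff)
  qed
  have T2: "scaled_tail n z \<le> expect p n (\<lambda>x. g (exp (- ((real x)\<^sup>2 / (2 * real n))))) 0 + e / 3" for n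
  proof -
    have "scaled_tail n z \<le> expect p n (\<lambda>x. g (exp (- ((real x)\<^sup>2 / (2 * real n)))) + e / 3) 0"
      unfolding scaled_tail_def
    proof (rule expect_mono)
      fix x
      show "(if z < (real x)\<^sup>2 / (2 * real n) then 1 else 0) \<le> g (exp (- ((real x)\<^sup>2 / (2 * real n)))) + e / 3"
        using fg[OF u01[of "(real x)\<^sup>2 / (2 * real n)"]] f01[of "exp (- ((real x)\<^sup>2 / (2 * real n)))"]
          f1[of "exp (- ((real x)\<^sup>2 / (2 * real n)))"] by auto
    qed
    then show ?thesis by (simp add: expect_add)
  qed
  have "eventually (\<lambda>n. I - e / 3 < expect p n (\<lambda>x. g (exp (- ((real x)\<^sup>2 / (2 * real n))))) 0) sequentially"
    using order_tendstoD(1)[OF lim, of "I - e / 3"] e by simp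
  then show "eventually (\<lambda>n. Gamma_up a z - e < scaled_tail n y) sequentially"
  proof eventually_elim
    case (elim n)
    then show ?case using T1[of n] I1 by linarith
  qed
  have "eventually (\<lambda>n. expect p n (\<lambda>x. g (exp (- ((real x)\<^sup>2 / (2 * real n))))) 0 < I + e / 3) sequentially"
    using order_tendstoD(2)[OF lim, of "I + e / 3"] e by simp
  then show "eventually (\<lambda>n. scaled_tail n z < Gamma_up a y + e) sequentially"
  proof eventually_elim
    case (elim n)
    then show ?case using T2[of n] I2 by linarith
  qed
qed

theorem scaled_tail_uniform:
  assumes null: null_recurrent_or_transient and \<delta>: "a = (1 - \<delta>) / 2" "a > 0" and e: "e > 0"
  shows "eventually (\<lambda>n. \<forall>y\<ge>0. \<bar>scaled_tail n y - Gamma_up a y\<bar> \<le> e) sequentially"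
proof -
  \<comment> \<open>Consecutive quantiles then differ by less than e/4. The sandwich costs one grid
    cell and e/4, and a point between grid points costs one more cell.\<close>
  obtain N where N: "1 / (e / 4) < real N" using reals_Archimedean2 by blast
  have N1: "N \<ge> 1" "1 / real N < e / 4"
  proof -
    have "0 < real N" using N e by (smt (verit) divide_pos_pos)
    then show "N \<ge> 1" "1 / real N < e / 4" using N e by (simp_all add: field_simps)
  qed
  obtain y where y: "y 0 = 0" "\<And>i. i < N \<Longrightarrow> Gamma_up a (y i) = 1 - real i / real N"
    "\<And>i. Suc i < N \<Longrightarrow> y i < y (Suc i)"
    using Gamma_up_grid[OF \<delta>(2) N1(1)] by blast
  have y0: "y i \<ge> 0" if "i < N" for i
    using that
  proof (induction i)
    case (Suc i)
    then show ?case using y(3)[of i] by linarith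
  qed (use y(1) in simp)
  have "eventually (\<lambda>n. \<forall>i\<in>{i. Suc i < N}. Gamma_up a (y (Suc i)) - e / 4 < scaled_tail n (y i)
      \<and> scaled_tail n (y (Suc i)) < Gamma_up a (y i) + e / 4) sequentially"
  proof (rule eventually_ball_finite)
    have "{i. Suc i < N} \<subseteq> {..<N}" by auto
    then show "finite {i. Suc i < N}" by (rule finite_subset) simp
    show "\<forall>i\<in>{i. Suc i < N}. eventually (\<lambda>n. Gamma_up a (y (Suc i)) - e / 4 < scaled_tail n (y i)
      \<and> scaled_tail n (y (Suc i)) < Gamma_up a (y i) + e / 4) sequentially"
      using scaled_tail_sandwich[OF null \<delta>] y(3) y0 e
      by (auto intro!: eventually_conj)
  qed
  then show ?thesis
  proof eventually_elim
    case (elim n)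
    \<comment> \<open>The last grid point has no successor to compare with, but there
      \<open>Gamma_up\<close> is only 1/N. Symmetrically, the upper bound at the first grid point
      holds because \<open>Gamma_up\<close> is 1 at 0.\<close>
    have low: "Gamma_up a (y i) - e / 2 \<le> scaled_tail n (y i)" if "i < N" for i
    proof (cases "Suc i < N")
      case True
      then have "Gamma_up a (y (Suc i)) - e / 4 < scaled_tail n (y i)" using elim by auto
      then show ?thesis using y(2)[of i] y(2)[of "Suc i"] True N1 by (simp add: add_divide_distrib)
    next
      case False
      then have "Suc i = N" using that by simp
      then have "Gamma_up a (y i) = 1 / real N" using y(2)[of i] that N1 by (auto simp: field_simps)
      then show ?thesis using N1 scaled_tail_nonneg[of n "y i"] e by simp
    qed
    have up: "scaled_tail n (y i) \<le> Gamma_up a (y i) + e / 2" if "i < N" for i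
    proof (cases i)
      case 0
      then show ?thesis using y(1) Gamma_up_0[OF \<delta>(2)] scaled_tail_le_1[of n "y i"] e by simp
    next
      case (Suc j)
      then have "scaled_tail n (y i) < Gamma_up a (y j) + e / 4" using elim that by auto
      then show ?thesis using y(2)[of i] y(2)[of j] that Suc N1 by (simp add: add_divide_distrib)
    qed
    show ?case
    proof (intro allI impI)
      fix z :: real assume z: "0 \<le> z"
      define i where "i = Max {i. i < N \<and> y i \<le> z}"
      have fin: "finite {i. i < N \<and> y i \<le> z}" by simp
      have ne: "0 \<in> {i. i < N \<and> y i \<le> z}" using N1 y(1) z by auto
      have i: "i < N" "y i \<le> z" using Max_in[OF fin] ne unfolding i_def by blast+
      have imax: "j \<le> i" if "j < N" "y j \<le> z" for j using Max_ge[OF fin, of j] that by (simp add: i_def)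
      have "scaled_tail n z \<le> scaled_tail n (y i)" by (rule scaled_tail_antimono) fact
      then have u1: "scaled_tail n z \<le> Gamma_up a (y i) + e / 2" using up[OF i(1)] by linarith
      have u2: "Gamma_up a z \<le> Gamma_up a (y i)" using i y0 \<delta> by (intro Gamma_up_antimono) auto
      show "\<bar>scaled_tail n z - Gamma_up a z\<bar> \<le> e"
      proof (cases "Suc i < N")
        case True
        then have "z < y (Suc i)" using imax[of "Suc i"] by force
        then have "scaled_tail n (y (Suc i)) \<le> scaled_tail n z" "Gamma_up a (y (Suc i)) \<le> Gamma_up a z"
          using \<delta> z by (auto intro!: scaled_tail_antimono Gamma_up_antimono)
        moreover have "Gamma_up a (y i) \<le> Gamma_up a (y (Suc i)) + e / 4"
          using y(2)[of i] y(2)[of "Suc i"] True N1 by (simp add: add_divide_distrib)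
        ultimately show ?thesis using low[OF True] u1 u2 e by linarith
      next
        case False
        then have "Suc i = N" using i by simp
        then have "Gamma_up a (y i) = 1 / real N" using y(2)[of i] i N1 by (auto simp: field_simps)
        then show ?thesis using u1 u2 N1 scaled_tail_nonneg[of n z] Gamma_up_nonneg[OF \<delta>(2) z] e by linarith
      qed
    qed
  qed
qed

text \<open>Here a = 0, so E exp(-X_n^2/(2n)) tends to 1, and Markov's inequality for 1 -
  exp(-X_n^2/(2n)) gives the claim.\<close>

lemma scaled_tail_degenerate:
  assumes null: null_recurrent_or_transient and \<delta>: "\<delta> = 1" and y: "y > 0"
  shows "(\<lambda>n. scaled_tail n y) \<longlonglongrightarrow> 0"
proof (rule tendsto_sandwich[where f = "\<lambda>_. 0"])
  let ?E = "\<lambda>n. expect p n (\<lambda>x. exp (- ((real x)\<^sup>2 / (2 * real n)))) 0"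
  have "(\<lambda>n. expect p n (\<lambda>x. exp (- ((real x)\<^sup>2 / (2 * real n))) ^ 1) 0) \<longlonglongrightarrow> (1 + real 1) powr (- 0)"
    by (rule laplace_limit_power[OF null]) (use \<delta> in auto)
  then have "?E \<longlonglongrightarrow> 1" by simp
  then have "(\<lambda>n. (1 - ?E n) / (1 - exp (- y))) \<longlonglongrightarrow> (1 - 1) / (1 - exp (- y))"
    using y by (intro tendsto_intros) auto
  then show "(\<lambda>n. (1 - ?E n) / (1 - exp (- y))) \<longlonglongrightarrow> 0" by simp
  have "(1 - exp (- y)) * scaled_tail n y \<le> 1 - ?E n" for n
  proof -
    have "(1 - exp (- y)) * scaled_tail n y \<le> expect p n (\<lambda>x. 1 - exp (- ((real x)\<^sup>2 / (2 * real n)))) 0"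
      unfolding scaled_tail_def expect_cmult[symmetric] by (rule expect_mono) (use y in auto)
    then show ?thesis by (simp add: expect_diff)
  qed
  then show "eventually (\<lambda>n. scaled_tail n y \<le> (1 - ?E n) / (1 - exp (- y))) sequentially"
    using y by (intro always_eventually allI) (simp add: pos_le_divide_eq mult.commute)
  show "eventually (\<lambda>n. 0 \<le> scaled_tail n y) sequentially" by (simp add: scaled_tail_nonneg)
qed simp

end

subsection \<open>Renewal theory for slowly varying return probabilities\<close>

declare walk_prob.simps(2) [simp del] first_hit.simps(2) [simp del] hit.simps(2) [simp del]

text \<open>Karamata's theorem for decreasing slowly varying sequences, by repeated halving of n.
  The range m <= 4 i instead of 2 i absorbs the rounding in n div 2.\<close>

lemma karamata_average:
  fixes U :: "nat \<Rightarrow> real"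
  assumes anti: "\<And>i j. i \<le> j \<Longrightarrow> U j \<le> U i" and pos: "\<And>i. 0 < U i"
    and sv: "\<And>\<theta>. \<theta> > 0 \<Longrightarrow> \<exists>i0. \<forall>i\<ge>i0. \<forall>m\<le>4 * i. U i \<le> (1 + \<theta>) * U m"
  shows "(\<lambda>n. (\<Sum>i<n. U i) / (real n * U n)) \<longlonglongrightarrow> 1"
proof -
  \<comment> \<open>Halving n costs a factor of at most 7/5 < sqrt 2, so U n decays at most like
    1/sqrt n. Hence n U n grows without bound and makes the additive constant of the next bound
    negligible.\<close>
  have growth: "filterlim (\<lambda>n. real n * U n) at_top sequentially"
  proof -
    obtain i1 where i1: "\<forall>i\<ge>i1. \<forall>m\<le>4 * i. U i \<le> (1 + 2/5) * U m" using sv[of "2/5"] by auto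
    define i0 where "i0 = max i1 1"
    define c where "c = U (2 * i0)"
    have c: "c > 0" by (simp add: c_def pos)
    have *: "c \<le> U n * sqrt (real n)" if "n \<ge> i0" for n
      using that
    proof (induction n rule: less_induct)
      case (less n)
      show ?case
      proof (cases "n < 2 * i0")
        case True
        have "c * 1 \<le> U n * sqrt (real n)"
          using True less.prems anti[of n "2 * i0"] pos[of n]
          by (intro mult_mono) (auto simp: c_def i0_def)
        then show ?thesis by simp
      next
        case False
        define m where "m = n div 2"
        have m: "m \<ge> i0" "m < n" "2 * m \<le> n" "n \<le> 4 * m" using False by (auto simp: m_def i0_def)
        have Um: "U m \<le> 7/5 * U n" using i1 m by (auto simp: i0_def)
        have "7/5 \<le> sqrt (2::real)" by (rule real_le_rsqrt) (simp add: power2_eq_square)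
        then have "7/5 * sqrt (real m) \<le> sqrt 2 * sqrt (real m)" by (intro mult_right_mono) auto
        also have "\<dots> = sqrt (real (2 * m))" by (simp add: real_sqrt_mult)
        also have "\<dots> \<le> sqrt (real n)" using m by simp
        finally have sq: "7/5 * sqrt (real m) \<le> sqrt (real n)" .
        have "c \<le> U m * sqrt (real m)" using less.IH m by blast
        also have "\<dots> \<le> (7/5 * U n) * sqrt (real m)" using Um by (intro mult_right_mono) auto
        also have "\<dots> = U n * (7/5 * sqrt (real m))" by simp
        also have "\<dots> \<le> U n * sqrt (real n)" using sq pos[of n] by (intro mult_left_mono) auto
        finally show ?thesis .
      qed
    qed
    have "filterlim (\<lambda>n. c * sqrt (real n)) at_top sequentially"
      by (intro filterlim_tendsto_pos_mult_at_top[OF tendsto_const c] filterlim_compose[OF sqrt_at_top]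
          filterlim_real_sequentially)
    then show ?thesis
    proof (rule filterlim_at_top_mono)
      show "eventually (\<lambda>n. c * sqrt (real n) \<le> real n * U n) sequentially"
      proof (rule eventually_sequentiallyI[of i0])
        fix n assume "n \<ge> i0"
        then have "c * sqrt (real n) \<le> (U n * sqrt (real n)) * sqrt (real n)"
          using * by (intro mult_right_mono) auto
        then show "c * sqrt (real n) \<le> real n * U n"
          by (metis abs_of_nat mult.assoc mult.commute real_sqrt_mult_self)
      qed
    qed
  qed
  \<comment> \<open>The factor 1 + 4\<theta> reproduces itself: halving turns it into (1 +
    2\<theta>)(1 + \<theta>), which is at most 1 + 4\<theta> when 2\<theta> <= 1.\<close>
  have bound: "\<exists>D i0. \<forall>n\<ge>i0. (\<Sum>i<n. U i) \<le> (1 + 4 * \<theta>) * (real n * U n) + D" if \<theta>: "0 < \<theta>" "2 * \<theta> \<le> 1" for \<theta>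
  proof -
    obtain i1 where i1: "\<forall>i\<ge>i1. \<forall>m\<le>4 * i. U i \<le> (1 + \<theta>) * U m" using sv[OF \<theta>(1)] by auto
    define i0 where "i0 = max i1 1"
    define D where "D = (\<Sum>i<2 * i0. U i)"
    have "(\<Sum>i<n. U i) \<le> (1 + 4 * \<theta>) * (real n * U n) + D" if "n \<ge> i0" for n
      using that
    proof (induction n rule: less_induct)
      case (less n)
      show ?case
      proof (cases "n < 2 * i0")
        case True
        then have "(\<Sum>i<n. U i) \<le> D" unfolding D_def by (intro sum_mono2) (auto intro: less_imp_le pos)
        moreover have "0 \<le> (1 + 4 * \<theta>) * (real n * U n)" using \<theta> pos[of n] by (intro mult_nonneg_nonneg) auto
        ultimately show ?thesis by linarith
      next
        case False
        define m where "m = n div 2"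
        have m: "m \<ge> i0" "m < n" "2 * m \<le> n" "n \<le> 4 * m" using False by (auto simp: m_def i0_def)
        have Um: "U m \<le> (1 + \<theta>) * U n" using i1 m by (auto simp: i0_def)
        have "(\<Sum>i<n. U i) = (\<Sum>i<m. U i) + (\<Sum>i\<in>{m..<n}. U i)"
          using m by (simp add: lessThan_atLeast0 sum.atLeastLessThan_concat)
        also have "(\<Sum>i\<in>{m..<n}. U i) \<le> (\<Sum>i\<in>{m..<n}. U m)" by (intro sum_mono anti) auto
        also have "\<dots> = (real n - real m) * U m" using m by (simp add: of_nat_diff)
        also have "(\<Sum>i<m. U i) \<le> (1 + 4 * \<theta>) * (real m * U m) + D" using less.IH m by blast
        also have "(1 + 4 * \<theta>) * (real m * U m) + D + (real n - real m) * U m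
            = (real n + 2 * \<theta> * (2 * real m)) * U m + D" by (simp add: algebra_simps)
        also have "(real n + 2 * \<theta> * (2 * real m)) * U m \<le> (real n + 2 * \<theta> * real n) * U m"
          using m \<theta> pos[of m] by (intro mult_right_mono add_left_mono mult_left_mono) auto
        also have "\<dots> \<le> (real n + 2 * \<theta> * real n) * ((1 + \<theta>) * U n)"
          using Um \<theta> by (intro mult_left_mono) auto
        also have "\<dots> = (1 + 2 * \<theta>) * (1 + \<theta>) * (real n * U n)" by (simp add: algebra_simps)
        also have "\<dots> \<le> (1 + 4 * \<theta>) * (real n * U n)"
        proof (rule mult_right_mono)
          have "\<theta> * (2 * \<theta>) \<le> \<theta> * 1" using \<theta> by (intro mult_left_mono) auto
          then show "(1 + 2 * \<theta>) * (1 + \<theta>) \<le> 1 + 4 * \<theta>" by (simp add: algebra_simps)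
        qed (use pos[of n] in simp)
        finally show ?thesis by simp
      qed
    qed
    then show ?thesis by blast
  qed
  show ?thesis
  proof (rule order_tendstoI)
    fix l :: real assume "l < 1"
    show "eventually (\<lambda>n. l < (\<Sum>i<n. U i) / (real n * U n)) sequentially"
    proof (rule eventually_sequentiallyI[of 1])
      fix n :: nat assume "n \<ge> 1"
      have "(\<Sum>i<n. U n) \<le> (\<Sum>i<n. U i)" by (intro sum_mono anti) auto
      then have "1 \<le> (\<Sum>i<n. U i) / (real n * U n)" using pos[of n] \<open>n \<ge> 1\<close> by simp
      then show "l < (\<Sum>i<n. U i) / (real n * U n)" using \<open>l < 1\<close> by linarith
    qed
  next
    fix u :: real assume u: "1 < u"
    define \<theta> where "\<theta> = min (1/2) ((u - 1) / 8)"
    have "\<theta> \<le> 1/2" "\<theta> \<le> (u - 1) / 8" unfolding \<theta>_def by (rule min.cobounded1, rule min.cobounded2)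
    then have \<theta>: "2 * \<theta> \<le> 1" "1 + 4 * \<theta> < u" using u by - (linarith, argo)
    have \<theta>0: "0 < \<theta>" using u by (simp add: \<theta>_def)
    obtain D i0 where D: "\<forall>n\<ge>i0. (\<Sum>i<n. U i) \<le> (1 + 4 * \<theta>) * (real n * U n) + D" using bound[OF \<theta>0 \<theta>(1)] by blast
    have "eventually (\<lambda>n. D / (u - (1 + 4 * \<theta>)) < real n * U n) sequentially"
      using growth unfolding filterlim_at_top_dense by blast
    moreover have "eventually (\<lambda>n. n \<ge> max i0 1) sequentially" by (rule eventually_ge_at_top)
    ultimately show "eventually (\<lambda>n. (\<Sum>i<n. U i) / (real n * U n) < u) sequentially"
    proof eventually_elim
      case (elim n)
      have "D < (u - (1 + 4 * \<theta>)) * (real n * U n)" using elim \<theta> by (simp add: field_simps)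
      then have "(\<Sum>i<n. U i) < u * (real n * U n)" using D elim by (fastforce simp: algebra_simps)
      then show ?case using pos[of n] elim by (simp add: pos_divide_less_eq)
    qed
  qed
qed

lemma sum_even_terms:
  fixes g :: "nat \<Rightarrow> real"
  assumes "\<And>m. odd m \<Longrightarrow> g m = 0"
  shows "(\<Sum>m\<le>2 * n. g m) = (\<Sum>j\<le>n. g (2 * j))"
  by (induction n) (use assms in auto)

text \<open>Exactly one renewal is the last one up to time n; the i-th summand is the probability
  that it happens at time i.\<close>

lemma renewal_tail_sum:
  fixes U F :: "nat \<Rightarrow> real"
  assumes "U 0 = 1" "F 0 = 0" "\<And>n. U (Suc n) = (\<Sum>j\<le>Suc n. F j * U (Suc n - j))"
  shows "(\<Sum>i\<le>n. U i * (1 - (\<Sum>j\<le>n - i. F j))) = 1"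
proof (induction n)
  case 0
  then show ?case using assms by simp
next
  case (Suc n)
  have "(\<Sum>i\<le>Suc n. U i * (1 - (\<Sum>j\<le>Suc n - i. F j)))
    = (\<Sum>i\<le>n. U i * (1 - (\<Sum>j\<le>n - i. F j)) - U i * F (Suc n - i)) + U (Suc n)"
  proof -
    have "(\<Sum>i\<le>n. U i * (1 - (\<Sum>j\<le>Suc n - i. F j)))
      = (\<Sum>i\<le>n. U i * (1 - (\<Sum>j\<le>n - i. F j)) - U i * F (Suc n - i))"
      by (rule sum.cong) (auto simp: Suc_diff_le algebra_simps)
    then show ?thesis using assms(2) by simp
  qed
  also have "\<dots> = 1 - (\<Sum>i\<le>n. U i * F (Suc n - i)) + U (Suc n)"
    using Suc.IH by (simp add: sum_subtractf)
  also have "(\<Sum>i\<le>n. U i * F (Suc n - i)) = (\<Sum>i\<le>Suc n. U i * F (Suc n - i))"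
    using assms(2) by simp
  also have "\<dots> = (\<Sum>j\<le>Suc n. F j * U (Suc n - j))"
    by (rule sum.reindex_bij_witness[of _ "\<lambda>i. Suc n - i" "\<lambda>i. Suc n - i"]) auto
  finally show ?case by (simp only: assms(3)[symmetric])
qed

section \<open>Return times to 0 and their truncated means\<close>

context walk
begin

text \<open>Returns happen at even times only, so from here on time is counted in pairs of steps and
  the renewal sequence is aperiodic.\<close>

abbreviation U :: "nat \<Rightarrow> real" where "U i \<equiv> ret (2 * i) 0"
abbreviation F :: "nat \<Rightarrow> real" where "F j \<equiv> first_hit p (2 * j) 0"
definition no_return :: "nat \<Rightarrow> real" where "no_return n = 1 - (\<Sum>j\<le>n. F j)"
text \<open>As a sum of tails this is the expectation of min(tau_0 / 2, n + 1).\<close>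

definition mean_trunc :: "nat \<Rightarrow> real" where "mean_trunc n = (\<Sum>j\<le>n. no_return j)"

lemma F_nonneg: "0 \<le> F j" by (rule first_hit_nonneg)

lemma U_renewal: "U (Suc n) = (\<Sum>j\<le>Suc n. F j * U (Suc n - j))"
proof -
  have "U (Suc n) = (\<Sum>m\<le>2 * Suc n. first_hit p m 0 * ret (2 * Suc n - m) 0)"
    using ret_renewal[of "Suc (2 * n)"] by (simp del: sum.atMost_Suc)
  also have "\<dots> = (\<Sum>j\<le>Suc n. F j * ret (2 * Suc n - 2 * j) 0)"
    by (rule sum_even_terms) (simp add: first_hit_odd)
  finally show ?thesis by (simp only: diff_mult_distrib2)
qed

lemma hit_le_1: "hit p n k \<le> 1"
proof (induction n arbitrary: k)
  case (Suc n)
  show ?case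
  proof (cases "k = 0")
    case False
    then show ?thesis using convex_comb_le[of k] Suc.IH by (simp add: hit.simps)
  qed (simp add: hit.simps)
qed simp

lemma no_return_eq: "no_return (Suc n) = 1 - hit p (Suc (2 * n)) 1"
proof -
  have "(\<Sum>j\<le>Suc n. F j) = (\<Sum>m\<le>2 * Suc n. first_hit p m 0)"
    by (rule sum_even_terms[symmetric]) (simp add: first_hit_odd)
  also have "\<dots> = (\<Sum>m\<le>Suc (2 * n). first_hit p (Suc m) 0)"
    using sum.atMost_Suc_shift[of "\<lambda>m. first_hit p m 0" "Suc (2 * n)"] by simp
  also have "\<dots> = hit p (Suc (2 * n)) 1"
    using sum_first_hit[of 1 "Suc (2 * n)"] by (simp only: first_hit_Suc_0)
  finally show ?thesis by (simp only: no_return_def)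
qed

lemma no_return_0: "no_return 0 = 1" by (simp add: no_return_def)

lemma no_return_nonneg: "0 \<le> no_return n"
  using hit_le_1 by (cases n) (auto simp: no_return_eq no_return_0)

lemma no_return_antimono: "i \<le> j \<Longrightarrow> no_return j \<le> no_return i"
  unfolding no_return_def by (intro diff_left_mono sum_mono2) (auto simp: F_nonneg)

lemma mean_trunc_mono: "i \<le> j \<Longrightarrow> mean_trunc i \<le> mean_trunc j"
  unfolding mean_trunc_def by (intro sum_mono2) (auto simp: no_return_nonneg)

lemma mean_trunc_ge_1: "1 \<le> mean_trunc n"
  using mean_trunc_mono[of 0 n] by (simp add: mean_trunc_def no_return_0)

lemma U_no_return_sum: "(\<Sum>i\<le>n. U i * no_return (n - i)) = 1"
  unfolding no_return_def
proof (rule renewal_tail_sum)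
  fix n show "U (Suc n) = (\<Sum>j\<le>Suc n. F j * U (Suc n - j))" by (rule U_renewal)
qed simp_all

lemma U_pos: "0 < U n"
proof (induction n)
  case (Suc n)
  have "F 1 * U n \<le> (\<Sum>j\<le>Suc n. F j * U (Suc n - j))"
    using member_le_sum[of 1 "{..Suc n}" "\<lambda>j. F j * U (Suc n - j)"] F_nonneg ret_nonneg by simp
  moreover have "F 1 = 1 - p 1" by (simp add: numeral_2_eq_2 first_hit.simps)
  then have "0 < F 1 * U n" using Suc p_less[of 1] by (intro mult_pos_pos) auto
  ultimately show ?case unfolding U_renewal by linarith
qed simp

text \<open>In the last-renewal identity each \<open>U i\<close> is replaced by the smaller
  \<open>U n\<close>. Together with \<open>U_sum_mean_trunc_ge\<close> this pins down the product
  asymptotically once the averages of U are comparable with U itself.\<close>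

lemma U_mean_trunc_le: "U n * mean_trunc n \<le> 1"
proof -
  have "U n * mean_trunc n = (\<Sum>i\<le>n. U n * no_return i)" by (simp add: mean_trunc_def sum_distrib_left)
  also have "\<dots> = (\<Sum>i\<le>n. U n * no_return (n - i))"
    by (rule sum.reindex_bij_witness[of _ "\<lambda>i. n - i" "\<lambda>i. n - i"]) auto
  also have "\<dots> \<le> (\<Sum>i\<le>n. U i * no_return (n - i))"
    by (intro sum_mono mult_right_mono ret_even_antimono no_return_nonneg) auto
  finally show ?thesis using U_no_return_sum by simp
qed

text \<open>Sum the last-renewal identity over all times up to n; for fixed i the tails that occur
  form an initial segment of \<open>mean_trunc n\<close>.\<close>

lemma U_sum_mean_trunc_ge: "real (Suc n) \<le> (\<Sum>i<Suc n. U i) * mean_trunc n"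
proof -
  have "real (Suc n) = (\<Sum>m\<le>n. \<Sum>i\<le>m. U i * no_return (m - i))"
    by (simp only: U_no_return_sum) simp
  also have "\<dots> = (\<Sum>m\<le>n. \<Sum>i\<le>n. U i * (if i \<le> m then no_return (m - i) else 0))"
    by (rule sum.cong[OF refl]) (rule sum.mono_neutral_cong_left, auto)
  also have "\<dots> = (\<Sum>i\<le>n. U i * (\<Sum>m\<le>n. if i \<le> m then no_return (m - i) else 0))"
    by (subst sum.swap) (simp add: sum_distrib_left)
  also have "\<dots> \<le> (\<Sum>i\<le>n. U i * mean_trunc n)"
  proof (intro sum_mono mult_left_mono ret_nonneg)
    fix i
    have "(\<Sum>m\<le>n. if i \<le> m then no_return (m - i) else 0) = (\<Sum>m\<in>{i..n}. no_return (m - i))"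
      by (rule sum.mono_neutral_cong_right) auto
    also have "\<dots> = (\<Sum>m\<in>(\<lambda>m. m - i) ` {i..n}. no_return m)"
      by (subst sum.reindex) (auto simp: inj_on_def)
    also have "\<dots> \<le> mean_trunc n"
      unfolding mean_trunc_def by (intro sum_mono2) (auto simp: no_return_nonneg)
    finally show "(\<Sum>m\<le>n. if i \<le> m then no_return (m - i) else 0) \<le> mean_trunc n" .
  qed
  also have "\<dots> = (\<Sum>i<Suc n. U i) * mean_trunc n" by (simp add: lessThan_Suc_atMost sum_distrib_right)
  finally show ?thesis .
qed

lemma mu0_eq_sum: "mu0 p n = (\<Sum>l\<le>n. real l * first_hit p l 0)"
  unfolding mu0_def by (rule sum.mono_neutral_left) auto

text \<open>Summation by parts: the mean restricted to {T <= n} is E min(T, n+1) - (n+1) P(T > n)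
  for T = tau_0 / 2. The factor 2 converts pairs of steps into steps.\<close>

lemma mu0_even: "mu0 p (2 * n) = 2 * (mean_trunc n - (real n + 1) * no_return n)"
proof -
  have "mu0 p (2 * n) = (\<Sum>j\<le>n. 2 * real j * F j)"
    unfolding mu0_eq_sum by (subst sum_even_terms) (auto simp: first_hit_odd)
  also have "\<dots> = 2 * (mean_trunc n - (real n + 1) * no_return n)"
  proof (induction n)
    case 0
    then show ?case by (simp add: mean_trunc_def no_return_0)
  next
    case (Suc n)
    have "F (Suc n) = no_return n - no_return (Suc n)" by (simp add: no_return_def)
    then have *: "(\<Sum>j\<le>Suc n. 2 * real j * F j)
      = (\<Sum>j\<le>n. 2 * real j * F j) + 2 * real (Suc n) * (no_return n - no_return (Suc n))"
      by (simp only: sum.atMost_Suc)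
    show ?case unfolding * Suc.IH by (simp add: mean_trunc_def algebra_simps)
  qed
  finally show ?thesis .
qed

lemma mu0_div2: "mu0 p n = mu0 p (2 * (n div 2))"
proof (cases "even n")
  case False
  then obtain m where "n = Suc (2 * m)" by (auto elim: oddE)
  then show ?thesis unfolding mu0_eq_sum by (simp add: first_hit_odd del: first_hit.simps)
qed simp

lemma mu0_mono: "m \<le> n \<Longrightarrow> mu0 p m \<le> mu0 p n"
  unfolding mu0_eq_sum by (intro sum_mono2) (auto simp: first_hit_nonneg)

lemma mu0_2_pos: "0 < mu0 p 2"
  using p_less[of 1] by (simp add: mu0_eq_sum numeral_2_eq_2 first_hit.simps)

text \<open>Slow variation is tested along doublings only; monotonicity of U extends it to all
  bounded ratios.\<close>

definition ret_sv :: bool where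
  "ret_sv \<longleftrightarrow> (\<lambda>n. U (2 * n) / U n) \<longlonglongrightarrow> 1"

lemma ret_sv_uniform:
  assumes ret_sv "\<theta> > 0"
  shows "\<exists>i0. \<forall>i\<ge>i0. \<forall>m\<le>4 * i. U i \<le> (1 + \<theta>) * U m"
proof -
  \<comment> \<open>Two doublings cover the ratio 4, so each may cost the factor sqrt(1 +
    \<theta>).\<close>
  define r where "r = 1 / sqrt (1 + \<theta>)"
  have r: "0 < r" "r < 1" "1 / r * (1 / r) = 1 + \<theta>" using assms(2) by (auto simp: r_def)
  have "eventually (\<lambda>n. r < U (2 * n) / U n) sequentially"
    using assms(1) r unfolding ret_sv_def by (auto dest: order_tendstoD(1))
  then obtain i0 where i0: "\<And>n. n \<ge> i0 \<Longrightarrow> r < U (2 * n) / U n" by (auto simp: eventually_sequentially)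
  have *: "U n \<le> 1 / r * U (2 * n)" if "n \<ge> i0" for n
    using i0[OF that] r U_pos[of n] by (simp add: field_simps)
  have "U i \<le> (1 + \<theta>) * U m" if "i \<ge> i0" "m \<le> 4 * i" for i m
  proof -
    have "U i \<le> 1 / r * U (2 * i)" using * that by simp
    also have "\<dots> \<le> 1 / r * (1 / r * U (2 * (2 * i)))"
      using *[of "2 * i"] that r by (intro mult_left_mono) auto
    also have "\<dots> = (1 + \<theta>) * U (2 * (2 * i))" by (simp only: mult.assoc[symmetric, of "1 / r" "1 / r"] r(3))
    also have "U (2 * (2 * i)) = U (4 * i)" by simp
    also have "(1 + \<theta>) * U (4 * i) \<le> (1 + \<theta>) * U m" using that assms(2) by (intro mult_left_mono ret_even_antimono) auto
    finally show ?thesis .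
  qed
  then show ?thesis by blast
qed

lemma ret_sv_ratio:
  assumes ret_sv and f: "\<And>n. f n \<le> g n" "\<And>n. g n \<le> 4 * f n" and lim: "filterlim f at_top sequentially"
  shows "(\<lambda>n. U (f n) / U (g n)) \<longlonglongrightarrow> 1"
proof (rule order_tendstoI)
  fix l :: real assume "l < 1"
  have "1 \<le> U (f n) / U (g n)" for n using ret_even_antimono[OF f(1)] U_pos by simp
  then show "eventually (\<lambda>n. l < U (f n) / U (g n)) sequentially" 
    using \<open>l < 1\<close> by (intro always_eventually allI) (rule less_le_trans)
next
  fix u :: real assume "1 < u"
  then obtain i0 where i0: "\<forall>i\<ge>i0. \<forall>m\<le>4 * i. U i \<le> (1 + (u - 1) / 2) * U m"
    using ret_sv_uniform[OF assms(1), of "(u - 1) / 2"] by auto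
  have "eventually (\<lambda>n. f n \<ge> i0) sequentially" using lim by (simp add: filterlim_at_top)
  then show "eventually (\<lambda>n. U (f n) / U (g n) < u) sequentially"
  proof eventually_elim
    case (elim n)
    have "U (f n) \<le> (1 + (u - 1) / 2) * U (g n)" using i0 elim f by blast
    also have "\<dots> < u * U (g n)" using U_pos \<open>1 < u\<close> by (intro mult_strict_right_mono) (auto simp: field_simps)
    finally show ?case using U_pos by (simp add: pos_divide_less_eq)
  qed
qed

lemma U_cancel: "U i * x / (U i / U j) = U j * x"
  using U_pos[of i] by simp

lemma filterlim_div2: "filterlim (\<lambda>n::nat. n div 2) at_top sequentially"
  unfolding filterlim_at_top
proof
  fix Z :: nat
  show "eventually (\<lambda>n. Z \<le> n div 2) sequentially"
    by (rule eventually_sequentiallyI[of "2 * Z"]) linarith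
qed

lemma U_average:
  assumes ret_sv
  shows "(\<lambda>n. (\<Sum>i<n. U i) / (real n * U n)) \<longlonglongrightarrow> 1"
  by (rule karamata_average) (use ret_even_antimono U_pos ret_sv_uniform[OF assms] in auto)

lemma U_mean_trunc:
  assumes ret_sv
  shows "(\<lambda>n. U n * mean_trunc n) \<longlonglongrightarrow> 1"
proof (rule tendsto_sandwich[OF _ _ _ tendsto_const])
  have pos: "0 < (\<Sum>i<Suc n. U i)" for n using U_pos by (intro sum_pos) auto
  show "(\<lambda>n. inverse ((\<Sum>i<Suc n. U i) / (real (Suc n) * U (Suc n)))) \<longlonglongrightarrow> 1"
    using tendsto_inverse[OF LIMSEQ_Suc[OF U_average[OF assms]]] by simp
  show "eventually (\<lambda>n. inverse ((\<Sum>i<Suc n. U i) / (real (Suc n) * U (Suc n))) \<le> U n * mean_trunc n) sequentially"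
  proof (intro always_eventually allI)
    fix n
    have "inverse ((\<Sum>i<Suc n. U i) / (real (Suc n) * U (Suc n))) = U (Suc n) * (real (Suc n) / (\<Sum>i<Suc n. U i))"
      by (simp only: inverse_divide times_divide_eq_right mult.commute)
    also have "\<dots> \<le> U (Suc n) * mean_trunc n"
      using U_sum_mean_trunc_ge[of n] pos[of n]
      by (intro mult_left_mono ret_nonneg) (simp only: pos_divide_le_eq mult.commute)
    also have "\<dots> \<le> U n * mean_trunc n"
      using mean_trunc_ge_1[of n] by (intro mult_right_mono ret_even_antimono) auto
    finally show "inverse ((\<Sum>i<Suc n. U i) / (real (Suc n) * U (Suc n))) \<le> U n * mean_trunc n" .
  qed
  show "eventually (\<lambda>n. U n * mean_trunc n \<le> 1) sequentially" using U_mean_trunc_le by simp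
qed

text \<open>Since \<open>no_return\<close> decreases, (n+1) \<open>no_return n\<close> is at most
  four times the sum of its values over the upper half of the range, which is a difference of two
  truncated means. By slow variation both are asymptotic to 1/U n, so the difference is
  negligible.\<close>

lemma U_no_return:
  assumes ret_sv
  shows "(\<lambda>n. U n * ((real n + 1) * no_return n)) \<longlonglongrightarrow> 0"
proof (rule tendsto_sandwich[OF _ _ tendsto_const])
  have 1: "(\<lambda>n. U (n div 2) * mean_trunc (n div 2)) \<longlonglongrightarrow> 1"
    using filterlim_compose[OF U_mean_trunc[OF assms] filterlim_div2] .
  \<comment> \<open>The shift by 2 makes g n <= 4 f n true for every n; unshifted it fails at n = 1,
    where n div 2 = 0.\<close>
  have "(\<lambda>n. U ((n + 2) div 2) / U (n + 2)) \<longlonglongrightarrow> 1"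
    by (rule ret_sv_ratio[OF assms]) (auto intro: filterlim_at_top_mono[OF filterlim_div2])
  then have "(\<lambda>n. U (n div 2) / U n) \<longlonglongrightarrow> 1"
    by (rule LIMSEQ_offset[of "\<lambda>n. U (n div 2) / U n" 2])
  from tendsto_divide[OF 1 this] have 2: "(\<lambda>n. U n * mean_trunc (n div 2)) \<longlonglongrightarrow> 1"
    by (simp only: U_cancel div_by_1 one_neq_zero not_False_eq_True)
  have 3: "(\<lambda>n. 4 * (U n * mean_trunc n - U n * mean_trunc (n div 2))) \<longlonglongrightarrow> 0"
    by (rule tendsto_mult_right_zero) (use tendsto_diff[OF U_mean_trunc[OF assms] 2] in simp)
  then show "(\<lambda>n. 4 * (U n * mean_trunc n - U n * mean_trunc (n div 2))) \<longlonglongrightarrow> 0" .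
  show "eventually (\<lambda>n. U n * ((real n + 1) * no_return n) \<le> 4 * (U n * mean_trunc n - U n * mean_trunc (n div 2))) sequentially"
  proof (rule eventually_sequentiallyI[of 1])
    fix n :: nat assume "n \<ge> 1"
    have "(\<Sum>j\<in>{n div 2<..n}. no_return n) \<le> (\<Sum>j\<in>{n div 2<..n}. no_return j)"
      by (intro sum_mono no_return_antimono) auto
    also have "\<dots> = mean_trunc n - mean_trunc (n div 2)"
    proof -
      have "{..n} = {..n div 2} \<union> {n div 2<..n}" by auto
      then have "mean_trunc n = mean_trunc (n div 2) + (\<Sum>j\<in>{n div 2<..n}. no_return j)"
        unfolding mean_trunc_def by (simp add: sum.union_disjoint disjoint_iff)
      then show ?thesis by simp
    qed
    finally have a: "real (n - n div 2) * no_return n \<le> mean_trunc n - mean_trunc (n div 2)" by simp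
    have "n + 1 \<le> 4 * (n - n div 2)" using \<open>n \<ge> 1\<close> by linarith
    then have "real (n + 1) \<le> real (4 * (n - n div 2))" by (simp only: of_nat_le_iff)
    from mult_right_mono[OF this no_return_nonneg[of n]]
    have "(real n + 1) * no_return n \<le> 4 * (real (n - n div 2) * no_return n)"
      by (simp only: of_nat_add of_nat_mult of_nat_1 of_nat_numeral mult.assoc)
    also have "\<dots> \<le> 4 * (mean_trunc n - mean_trunc (n div 2))" using a by simp
    finally have "U n * ((real n + 1) * no_return n) \<le> U n * (4 * (mean_trunc n - mean_trunc (n div 2)))"
      by (rule mult_left_mono[OF _ ret_nonneg])
    then show "U n * ((real n + 1) * no_return n) \<le> 4 * (U n * mean_trunc n - U n * mean_trunc (n div 2))"
      by (simp add: algebra_simps)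
  qed
  show "eventually (\<lambda>n. 0 \<le> U n * ((real n + 1) * no_return n)) sequentially"
    using ret_nonneg no_return_nonneg by (intro always_eventually allI mult_nonneg_nonneg) auto
qed

abbreviation origin_ret :: "nat \<Rightarrow> real" where
  "origin_ret n \<equiv> ret (if even n then n else n + 1) 0"

lemma origin_ret_eq: "origin_ret n = U ((n + 1) div 2)"
proof -
  have "(if even n then n else n + 1) = 2 * ((n + 1) div 2)" by auto
  then show ?thesis by (simp only:)
qed

text \<open>\<open>mu0\<close> differs from twice \<open>mean_trunc\<close> by a term that
  \<open>U_no_return\<close> makes negligible. The limit 2 is the period of the chain.\<close>

lemma origin_ret_mu0:
  assumes ret_sv
  shows "(\<lambda>n. origin_ret n * mu0 p n) \<longlonglongrightarrow> 2"
proof -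
  have "(\<lambda>n. 2 * (U n * mean_trunc n - U n * ((real n + 1) * no_return n))) \<longlonglongrightarrow> 2 * (1 - 0)"
    by (intro tendsto_intros U_mean_trunc U_no_return assms)
  then have "(\<lambda>n. U n * mu0 p (2 * n)) \<longlonglongrightarrow> 2"
    unfolding mu0_even by (simp add: right_diff_distrib mult.left_commute)
  from filterlim_compose[OF this filterlim_div2]
  have 1: "(\<lambda>n. U (n div 2) * mu0 p n) \<longlonglongrightarrow> 2" by (simp only: mu0_div2[symmetric])
  have "(\<lambda>n. U ((n + 2) div 2) / U ((n + 3) div 2)) \<longlonglongrightarrow> 1"
    by (rule ret_sv_ratio[OF assms]) (auto intro: filterlim_at_top_mono[OF filterlim_div2])
  moreover have "n + 3 = n + 2 + 1" for n :: nat by simp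
  ultimately have "(\<lambda>n. U (n div 2) / U ((n + 1) div 2)) \<longlonglongrightarrow> 1"
    by (intro LIMSEQ_offset[of "\<lambda>n. U (n div 2) / U ((n + 1) div 2)" 2]) (simp only:)
  from tendsto_divide[OF 1 this] show ?thesis
    by (simp only: origin_ret_eq U_cancel div_by_1 one_neq_zero not_False_eq_True)
qed

end

subsection \<open>Hitting probabilities of 0\<close>

lemma gamma_density_bounds:
  assumes a: "a > 0" and y: "0 < y" and r: "1 \<le> r" and u: "u \<in> {y..r * y}"
  shows "r powr (- \<bar>a - 1\<bar>) * exp (- (r - 1) * y) * gamma_density a y \<le> gamma_density a u"
    and "gamma_density a u \<le> r powr \<bar>a - 1\<bar> * gamma_density a y"
proof -
  have v: "1 \<le> u / y" "u / y \<le> r" and u0: "u > 0" using u y by (auto simp: field_simps)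
  have "u powr (a - 1) = ((u / y) * y) powr (a - 1)" using y by simp
  also have "\<dots> = (u / y) powr (a - 1) * y powr (a - 1)" by (rule powr_mult)
  finally have eq: "gamma_density a u = (u / y) powr (a - 1) * exp (- (u - y)) * gamma_density a y"
    by (simp add: gamma_density_def exp_diff exp_minus field_simps)
  have lo: "r powr (- \<bar>a - 1\<bar>) \<le> (u / y) powr (a - 1)"
  proof -
    have "r powr (- \<bar>a - 1\<bar>) \<le> (u / y) powr (- \<bar>a - 1\<bar>)" using v by (intro powr_mono2') auto
    also have "\<dots> \<le> (u / y) powr (a - 1)" using v by (intro powr_mono) auto
    finally show ?thesis .
  qed
  have hi: "(u / y) powr (a - 1) \<le> r powr \<bar>a - 1\<bar>"
  proof -
    have "(u / y) powr (a - 1) \<le> (u / y) powr \<bar>a - 1\<bar>" using v by (intro powr_mono) auto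
    also have "\<dots> \<le> r powr \<bar>a - 1\<bar>" using v by (intro powr_mono2) auto
    finally show ?thesis .
  qed
  have "exp (- (r - 1) * y) \<le> exp (- (u - y))" using u by (simp add: algebra_simps)
  then show "r powr (- \<bar>a - 1\<bar>) * exp (- (r - 1) * y) * gamma_density a y \<le> gamma_density a u"
    unfolding eq using lo by (intro mult_right_mono mult_mono gamma_density_nonneg) auto
  have "exp (- (u - y)) \<le> 1" using u by simp
  then have "(u / y) powr (a - 1) * exp (- (u - y)) \<le> r powr \<bar>a - 1\<bar> * 1"
    using hi by (intro mult_mono) auto
  then show "gamma_density a u \<le> r powr \<bar>a - 1\<bar> * gamma_density a y"
    unfolding eq by (intro mult_right_mono gamma_density_nonneg) simp
qed

text \<open>The mass of a window [y, r y] relative to its logarithmic density y^a exp(-y) /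
  Gamma(a). All correction factors tend to 1 as r tends to 1, and the modulus of a - 1 covers both
  signs of the exponent.\<close>

lemma Gamma_up_increment:
  assumes a: "a > 0" and y: "0 < y" and r: "1 \<le> r"
  shows "(r - 1) * r powr (- \<bar>a - 1\<bar>) * exp (- (r - 1) * y) * (y powr a * exp (- y) / Gamma a) \<le> Gamma_up a y - Gamma_up a (r * y)"
    and "Gamma_up a y - Gamma_up a (r * y) \<le> (r - 1) * r powr \<bar>a - 1\<bar> * (y powr a * exp (- y) / Gamma a)"
proof -
  have G: "Gamma a > 0" using a by simp
  have ry: "y \<le> r * y" using r y by simp
  have eq: "Gamma_up a y - Gamma_up a (r * y) = integral {y..r * y} (gamma_density a) / Gamma a"
    by (rule Gamma_up_diff) (use a y ry in auto)
  have yy: "y powr a * exp (- y) = y * gamma_density a y" using y by (simp add: gamma_density_def powr_diff)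
  have int: "gamma_density a integrable_on {y..r * y}"
    by (rule gamma_density_integrable_on(2)) (use a y in auto)
  define m where "m = r powr (- \<bar>a - 1\<bar>) * exp (- (r - 1) * y) * gamma_density a y"
  have "integral {y..r * y} (\<lambda>u. m) \<le> integral {y..r * y} (gamma_density a)"
    by (rule integral_le) (use int gamma_density_bounds(1)[OF a y r, folded m_def] in auto)
  then have "(r * y - y) * m \<le> integral {y..r * y} (gamma_density a)" using ry by simp
  then have "(r * y - y) * m / Gamma a \<le> integral {y..r * y} (gamma_density a) / Gamma a"
    using G by (intro divide_right_mono) auto
  then show "(r - 1) * r powr (- \<bar>a - 1\<bar>) * exp (- (r - 1) * y) * (y powr a * exp (- y) / Gamma a) \<le> Gamma_up a y - Gamma_up a (r * y)"
    unfolding eq yy m_def by (simp add: algebra_simps diff_divide_distrib)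
  define M where "M = r powr \<bar>a - 1\<bar> * gamma_density a y"
  have "integral {y..r * y} (gamma_density a) \<le> integral {y..r * y} (\<lambda>u. M)"
    by (rule integral_le) (use int gamma_density_bounds(2)[OF a y r, folded M_def] in auto)
  then have "integral {y..r * y} (gamma_density a) \<le> (r * y - y) * M" using ry by simp
  then have "integral {y..r * y} (gamma_density a) / Gamma a \<le> (r * y - y) * M / Gamma a"
    using G by (intro divide_right_mono) auto
  then show "Gamma_up a y - Gamma_up a (r * y) \<le> (r - 1) * r powr \<bar>a - 1\<bar> * (y powr a * exp (- y) / Gamma a)"
    unfolding eq yy M_def by (simp add: algebra_simps diff_divide_distrib)
qed

lemma Gamma_up_pos:
  assumes "a > 0" "y \<ge> 0"
  shows "0 < Gamma_up a y"
proof -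
  define z where "z = max y 1"
  have z: "z > 0" "y \<le> z" by (auto simp: z_def)
  have "0 < (2 - 1) * 2 powr (- \<bar>a - 1\<bar>) * exp (- (2 - 1) * z) * (z powr a * exp (- z) / Gamma a)"
    using assms z by simp
  also have "\<dots> \<le> Gamma_up a z - Gamma_up a (2 * z)" by (rule Gamma_up_increment) (use assms z in auto)
  also have "\<dots> \<le> Gamma_up a z" using Gamma_up_nonneg[of a "2 * z"] assms z by simp
  also have "\<dots> \<le> Gamma_up a y" by (rule Gamma_up_antimono) (use assms z in auto)
  finally show ?thesis .
qed

lemma bessel_walk_dual: "bessel_walk p \<delta> \<Longrightarrow> bessel_walk (\<lambda>x. 1 - p x) (- \<delta>)"
proof -
  assume "bessel_walk p \<delta>"
  then interpret bessel_walk p \<delta> .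
  have "(\<lambda>x. real x * (2 * (1 - p x) - 1)) = (\<lambda>x. - (real x * (2 * p x - 1)))"
    by (auto simp: algebra_simps)
  then have "(\<lambda>x. real x * (2 * (1 - p x) - 1)) \<longlonglongrightarrow> - (- \<delta>) / 2"
    using tendsto_minus[OF drift] by simp
  then show ?thesis using walk_dual[OF walk_axioms]
    by (simp add: bessel_walk_def bessel_walk_axioms_def)
qed

lemma nat_less_iff_sq: "real k < real x \<longleftrightarrow> (real k)\<^sup>2 < (real x)\<^sup>2"
  using power2_less_imp_less[of "real k" "real x"] power_strict_mono[of "real k" "real x" 2] by auto

context bessel_walk
begin

definition \<kappa> :: real where "\<kappa> = (1 + \<delta>) / 2"

text \<open>The dual walk has drift parameter -\<delta> < 1, so its return probabilities vanish and
  its limit shape is (1 + \<delta>)/2 = \<kappa>. Duality evaluates it at time n + 1, whence the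
  denominator.\<close>

lemma hit_law:
  assumes \<delta>: "\<delta> > -1" and e: "e > 0"
  shows "eventually (\<lambda>n. \<forall>k. even (n + k) \<longrightarrow> \<bar>hit p n k - Gamma_up \<kappa> ((real k)\<^sup>2 / (2 * (real n + 1)))\<bar> \<le> e) sequentially"
proof -
  interpret d: bessel_walk "\<lambda>x. 1 - p x" "- \<delta>" by (rule bessel_walk_dual[OF bessel_walk_axioms])
  have "eventually (\<lambda>n. \<forall>y\<ge>0. \<bar>d.scaled_tail n y - Gamma_up \<kappa> y\<bar> \<le> e) sequentially"
    by (rule d.scaled_tail_uniform) (use \<delta> e d.ret_tendsto_0 in \<open>auto simp: \<kappa>_def\<close>)
  then have "eventually (\<lambda>n. \<forall>y\<ge>0. \<bar>d.scaled_tail (Suc n) y - Gamma_up \<kappa> y\<bar> \<le> e) sequentially"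
    by (rule iffD2[OF eventually_sequentially_Suc])
  then show ?thesis
  proof eventually_elim
    case (elim n)
    show ?case
    proof (intro allI impI)
      fix k assume "even (n + k)"
      then have "hit p n k = tail_prob (\<lambda>x. 1 - p x) (Suc n) (real k)"
        by (rule hit_eq_dual_tail[OF walk_axioms])
      also have "\<dots> = d.scaled_tail (Suc n) ((real k)\<^sup>2 / (2 * (real n + 1)))"
        unfolding d.scaled_tail_def by (simp add: nat_less_iff_sq add.commute divide_less_cancel del: of_nat_less_iff)
      finally show "\<bar>hit p n k - Gamma_up \<kappa> ((real k)\<^sup>2 / (2 * (real n + 1)))\<bar> \<le> e"
        using elim by simp
    qed
  qed
qed

text \<open>The first quantile y 1, at which \<open>Gamma_up\<close> has dropped by only 1/N, gives
  a whole range of k; \<theta> is shared between 1/N and the error of the limit law.\<close>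

lemma hit_near_0:
  assumes \<delta>: "\<delta> > -1" and \<theta>: "\<theta> > 0"
  obtains \<eta> where "\<eta> > 0"
    "eventually (\<lambda>n. \<forall>k. even (n + k) \<and> (real k)\<^sup>2 \<le> \<eta> * real n \<longrightarrow> 1 - \<theta> \<le> hit p n k) sequentially"
proof -
  have \<kappa>: "\<kappa> > 0" using \<delta> by (simp add: \<kappa>_def)
  obtain N0 where "2 / \<theta> < real N0" using reals_Archimedean2 by blast
  define N where "N = max N0 2"
  have "2 / \<theta> < real N" using \<open>2 / \<theta> < real N0\<close> by (simp add: N_def)
  then have N: "N \<ge> 2" "1 / real N < \<theta> / 2" using \<theta> by (auto simp: N_def field_simps)
  obtain y where y: "y 0 = 0" "\<And>i. i < N \<Longrightarrow> Gamma_up \<kappa> (y i) = 1 - real i / real N"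
    "\<And>i. Suc i < N \<Longrightarrow> y i < y (Suc i)"
    using Gamma_up_grid[OF \<kappa>, of N] N by auto
  have y1: "y 1 > 0" "Gamma_up \<kappa> (y 1) = 1 - 1 / real N" using y(3)[of 0] y(1,2) N by auto
  have "eventually (\<lambda>n. \<forall>k. even (n + k) \<and> (real k)\<^sup>2 \<le> (2 * y 1) * real n \<longrightarrow> 1 - \<theta> \<le> hit p n k) sequentially"
    using hit_law[OF \<delta> half_gt_zero[OF \<theta>]]
  proof eventually_elim
    case (elim n)
    show ?case
    proof (intro allI impI, elim conjE)
      fix k assume k: "even (n + k)" "(real k)\<^sup>2 \<le> (2 * y 1) * real n"
      have "(real k)\<^sup>2 / (2 * (real n + 1)) \<le> y 1"
        using k(2) y1(1) by (simp add: field_simps)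
      then have "Gamma_up \<kappa> (y 1) \<le> Gamma_up \<kappa> ((real k)\<^sup>2 / (2 * (real n + 1)))"
        by (intro Gamma_up_antimono \<kappa>) auto
      moreover have "\<bar>hit p n k - Gamma_up \<kappa> ((real k)\<^sup>2 / (2 * (real n + 1)))\<bar> \<le> \<theta> / 2"
        using elim k by blast
      ultimately show "1 - \<theta> \<le> hit p n k" using y1 N by argo
    qed
  qed
  then show ?thesis using that[of "2 * y 1"] y1 by simp
qed

lemma U_limit:
  obtains l where "l \<ge> 0" "U \<longlonglongrightarrow> l" "\<And>n. l \<le> U n"
proof -
  have "decseq U" unfolding decseq_def using ret_even_antimono by blast
  then obtain l where l: "U \<longlonglongrightarrow> l" "\<forall>n. l \<le> U n"
    using decseq_convergent[of U 0] ret_nonneg by metis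
  moreover have "l \<ge> 0" by (rule LIMSEQ_le_const[OF l(1)]) (use ret_nonneg in auto)
  ultimately show ?thesis using that by blast
qed

lemma ret_svI_positive:
  assumes "U \<longlonglongrightarrow> l" "l > 0"
  shows ret_sv
proof -
  have "(\<lambda>n. U (2 * n)) \<longlonglongrightarrow> l"
    using LIMSEQ_subseq_LIMSEQ[OF assms(1), of "\<lambda>n. 2 * n"] by (simp add: strict_mono_def o_def)
  from tendsto_divide[OF this assms(1)] show ?thesis using assms(2) by (simp add: ret_sv_def)
qed

lemma mu0_tendsto_E0tau:
  assumes "E0tau p < \<infinity>"
  shows "mu0 p \<longlonglongrightarrow> enn2real (E0tau p)" "0 < enn2real (E0tau p)" "mu0 p n \<le> enn2real (E0tau p)"
proof -
  define a where "a = (\<lambda>l. real l * first_hit p l 0)"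
  have a: "0 \<le> a l" for l by (simp add: a_def first_hit_nonneg)
  have "(\<Sum>l. ennreal (a l)) \<noteq> top" using assms by (simp add: E0tau_def a_def)
  then have sm: "summable a" using summable_suminf_not_top[of a] a by blast
  have "E0tau p = ennreal (suminf a)"
    unfolding E0tau_def a_def[symmetric] using suminf_ennreal2[OF a sm] by (simp add: a_def)
  then have E: "enn2real (E0tau p) = suminf a" using suminf_nonneg[OF sm a] by simp
  have mu: "mu0 p n = (\<Sum>l\<le>n. a l)" for n by (simp add: mu0_eq_sum a_def)
  show "mu0 p \<longlonglongrightarrow> enn2real (E0tau p)"
    unfolding E using summable_LIMSEQ'[OF sm] by (simp add: mu[abs_def])
  show le: "mu0 p n \<le> enn2real (E0tau p)" for n
    unfolding E mu by (rule sum_le_suminf[OF sm]) (use a in auto)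
  show "0 < enn2real (E0tau p)" using le[of 2] mu0_2_pos by linarith
qed

lemma no_return_tendsto_0:
  assumes "\<delta> > -1"
  shows "no_return \<longlonglongrightarrow> 0"
proof (rule LIMSEQ_I)
  fix e :: real assume e: "0 < e"
  obtain \<eta> where \<eta>: "\<eta> > 0"
    "eventually (\<lambda>n. \<forall>k. even (n + k) \<and> (real k)\<^sup>2 \<le> \<eta> * real n \<longrightarrow> 1 - e / 2 \<le> hit p n k) sequentially"
    using hit_near_0[OF assms, of "e / 2"] e by auto
  then obtain N where N: "\<And>n k. n \<ge> N \<Longrightarrow> even (n + k) \<Longrightarrow> (real k)\<^sup>2 \<le> \<eta> * real n \<Longrightarrow> 1 - e / 2 \<le> hit p n k"
    by (auto simp: eventually_sequentially)
  obtain M :: nat where M: "1 / \<eta> < real M" using reals_Archimedean2 by blast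
  define m where "m = max N M"
  have "1 \<le> \<eta> * real M" using M \<eta>(1) by (simp add: field_simps)
  also have "\<dots> \<le> \<eta> * real (Suc (2 * m))" using \<eta>(1) by (intro mult_left_mono) (auto simp: m_def)
  finally have "1 - e / 2 \<le> hit p (Suc (2 * m)) 1" by (intro N) (auto simp: m_def)
  then have "no_return (Suc m) \<le> e / 2" by (simp add: no_return_eq)
  then have "norm (no_return n - 0) < e" if "n \<ge> Suc m" for n
    using no_return_antimono[OF that] no_return_nonneg[of n] e by simp
  then show "\<exists>no. \<forall>n\<ge>no. norm (no_return n - 0) < e" by blast
qed

text \<open>An elementary replacement for the renewal theorem: bounded \<open>mean_trunc\<close>
  keeps the averages of U above 1/B, so the decreasing sequence U has a positive limit and the
  ratios tend to 1.\<close>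

lemma ret_sv_finite_mean:
  assumes \<delta>: "\<delta> > -1" and fin: "E0tau p < \<infinity>"
  shows ret_sv
proof -
  define E where "E = enn2real (E0tau p)"
  have mu: "mu0 p n \<le> E" for n using mu0_tendsto_E0tau(3)[OF fin] by (simp add: E_def)
  have "E > 0" using mu0_tendsto_E0tau(2)[OF fin] by (simp add: E_def)
  \<comment> \<open>Markov's inequality for tau_0 / 2. It is proved on {n < tau_0/2 <= N}; letting N
    grow uses recurrence, since \<open>F\<close> does not count paths that never return.\<close>
  have T: "real n * no_return n \<le> E" for n
  proof (rule LIMSEQ_le_const)
    show "(\<lambda>N. E + real n * no_return N) \<longlonglongrightarrow> E"
      using tendsto_add[OF tendsto_const tendsto_mult_right_zero[OF no_return_tendsto_0[OF \<delta>]]] by simp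
    have "real n * no_return n \<le> E + real n * no_return N" if "N \<ge> n" for N
    proof -
      have "{..N} = {..n} \<union> {n<..N}" using that by auto
      then have "no_return n - no_return N = (\<Sum>j\<in>{n<..N}. F j)"
        unfolding no_return_def by (simp add: sum.union_disjoint disjoint_iff)
      then have "real n * (no_return n - no_return N) = (\<Sum>j\<in>{n<..N}. real n * F j)"
        by (simp add: sum_distrib_left)
      also have "\<dots> \<le> (\<Sum>j\<in>{n<..N}. real (2 * j) * F j)"
        by (intro sum_mono mult_right_mono F_nonneg) auto
      also have "\<dots> \<le> (\<Sum>j\<le>N. real (2 * j) * F j)"
        by (intro sum_mono2) (auto simp: F_nonneg)
      also have "\<dots> = mu0 p (2 * N)"
        unfolding mu0_eq_sum by (rule sum_even_terms[symmetric]) (simp add: first_hit_odd)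
      also have "\<dots> \<le> E" by (rule mu)
      finally show ?thesis by (simp add: algebra_simps)
    qed
    then show "\<exists>N0. \<forall>N\<ge>N0. real n * no_return n \<le> E + real n * no_return N" by blast
  qed
  define B where "B = 2 * E + 1"
  have M: "mean_trunc n \<le> B" for n
  proof -
    have "mean_trunc n = mu0 p (2 * n) / 2 + real n * no_return n + no_return n"
      using mu0_even[of n] by (simp add: algebra_simps)
    also have "\<dots> \<le> E / 2 + E + 1"
      using mu[of "2 * n"] T[of n] no_return_antimono[of 0 n] no_return_0 by simp
    finally show ?thesis using \<open>E > 0\<close> by (simp add: B_def)
  qed
  have B: "B > 0" using \<open>E > 0\<close> by (simp add: B_def)
  obtain l where l: "l \<ge> 0" "U \<longlonglongrightarrow> l" "\<And>n. l \<le> U n" by (rule U_limit) blast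
  have "(\<lambda>n. (\<Sum>i<n. U i - l) / real n) \<longlonglongrightarrow> 0"
    by (rule cesaro_zero) (use l(2) LIM_zero in blast)
  moreover have "1 / B - l \<le> (\<Sum>i<n. U i - l) / real n" if n: "n \<ge> 1" for n
  proof -
    obtain m where m: "n = Suc m" using n by (cases n) auto
    have "real n \<le> (\<Sum>i<n. U i) * mean_trunc m" using U_sum_mean_trunc_ge[of m] m by simp
    also have "\<dots> \<le> (\<Sum>i<n. U i) * B" by (intro mult_left_mono M sum_nonneg ret_nonneg)
    finally have "1 / B \<le> (\<Sum>i<n. U i) / real n" using B n by (simp add: field_simps)
    moreover have "(\<Sum>i<n. U i - l) / real n = (\<Sum>i<n. U i) / real n - l"
      using n by (simp add: sum_subtractf diff_divide_distrib)
    ultimately show ?thesis by simp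
  qed
  ultimately have "1 / B - l \<le> 0"
    by (intro LIMSEQ_le_const[of "\<lambda>n. (\<Sum>i<n. U i - l) / real n"]) blast+
  moreover have "1 / B > 0" using B by simp
  ultimately have "l > 0" by linarith
  then show ?thesis by (rule ret_svI_positive[OF l(2)])
qed

text \<open>If U stayed above l > 0, \<open>U_mean_trunc_le\<close> would bound the truncated means
  by 1/l and hence the mean of tau_0.\<close>

lemma null_infinite_mean:
  assumes inf: "E0tau p = \<infinity>"
  shows null_recurrent_or_transient
proof -
  obtain l where l: "l \<ge> 0" "U \<longlonglongrightarrow> l" "\<And>n. l \<le> U n" by (rule U_limit) blast
  have "\<not> l > 0"
  proof
    assume "l > 0"
    define a where "a = (\<lambda>l. real l * first_hit p l 0)"
    have a: "0 \<le> a j" for j by (simp add: a_def first_hit_nonneg)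
    have "(\<Sum>j<n. a j) \<le> 2 / l" for n
    proof -
      have "(\<Sum>j<n. a j) \<le> (\<Sum>j\<le>2 * n. a j)" by (rule sum_mono2) (use a in auto)
      also have "\<dots> = mu0 p (2 * n)" by (simp add: mu0_eq_sum a_def)
      also have "\<dots> \<le> 2 * mean_trunc n" using mu0_even[of n] no_return_nonneg[of n] by simp
      also have "\<dots> \<le> 2 / l"
      proof -
        have "l * mean_trunc n \<le> U n * mean_trunc n"
          using l(3) mean_trunc_ge_1[of n] by (intro mult_right_mono) auto
        then have "l * mean_trunc n \<le> 1" using U_mean_trunc_le[of n] by linarith
        then show ?thesis using \<open>l > 0\<close> by (simp add: field_simps)
      qed
      finally show ?thesis .
    qed
    then have "summable a" by (intro summableI_nonneg_bounded[OF a])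
    then have "E0tau p = ennreal (suminf a)"
      unfolding E0tau_def a_def[symmetric] using suminf_ennreal2[OF a] by (simp add: a_def)
    then show False using inf by simp
  qed
  then show ?thesis using l by simp
qed

text \<open>In the critical null recurrent case $X_n/\sqrt n\to0$, so the total mass of the reversible
  measure on $[0,\varepsilon\sqrt n]$ determines \<^term>\<open>U\<close>, whatever $\varepsilon$ is.\<close>
lemma ret_sv_critical:
  assumes \<delta>: "\<delta> = 1" and null: null_recurrent_or_transient
  shows ret_sv
  unfolding ret_sv_def
proof (rule order_tendstoI)
  fix u :: real assume "1 < u"
  have "U (2 * n) / U n \<le> 1" for n using ret_even_antimono[of n "2 * n"] U_pos[of n] by simp
  then show "eventually (\<lambda>n. U (2 * n) / U n < u) sequentially"
    using \<open>1 < u\<close> by (intro always_eventually allI) (rule le_less_trans)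
next
  fix l :: real assume l: "l < 1"
  define \<theta> where "\<theta> = min ((1 - l) / 4) (1 / 2)"
  have \<theta>: "\<theta> > 0" "\<theta> \<le> 1 / 2" "\<theta> \<le> (1 - l) / 4"
    using l by (simp_all add: \<theta>_def del: le_divide_eq_numeral1)
  have "2 * \<theta> \<le> (1 - l) / 2" using \<theta>(3) by argo
  moreover have "(1 - \<theta>) * (1 - \<theta>) = 1 - 2 * \<theta> + \<theta> * \<theta>" by (simp add: algebra_simps)
  moreover have "0 \<le> \<theta> * \<theta>" by simp
  ultimately have l2: "l < (1 - \<theta>) * (1 - \<theta>)" using l by argo
  obtain \<eta> where \<eta>: "\<eta> > 0"
    "eventually (\<lambda>n. \<forall>k. even (n + k) \<and> (real k)\<^sup>2 \<le> \<eta> * real n \<longrightarrow> 1 - \<theta> \<le> hit p n k) sequentially"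
    using hit_near_0[of \<theta>] \<theta>(1) \<delta> by auto
  have sub: "filterlim (\<lambda>n::nat. m * n) sequentially sequentially" if "m > 0" for m :: nat
    using that by (intro filterlim_subseq) (auto simp: strict_mono_def)
  have e1: "eventually (\<lambda>n. \<forall>k. even (2 * n + k) \<and> (real k)\<^sup>2 \<le> \<eta> * real (2 * n) \<longrightarrow> 1 - \<theta> \<le> hit p (2 * n) k) sequentially"
    using eventually_compose_filterlim[OF \<eta>(2) sub[of 2]] by simp
  \<comment> \<open>At time 4 n the scaled square is x^2/(8 n), so the threshold \<eta>/8 means x^2
    = \<eta> n.\<close>
  have "(\<lambda>n. scaled_tail n (\<eta> / 8)) \<longlonglongrightarrow> 0"
    by (rule scaled_tail_degenerate[OF null \<delta>]) (use \<eta> in simp)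
  then have "eventually (\<lambda>n. scaled_tail n (\<eta> / 8) < \<theta>) sequentially" using \<theta>(1) by (rule order_tendstoD(2))
  then have e2: "eventually (\<lambda>n. scaled_tail (4 * n) (\<eta> / 8) < \<theta>) sequentially"
    using eventually_compose_filterlim[OF _ sub[of 4]] by simp
  show "eventually (\<lambda>n. l < U (2 * n) / U n) sequentially"
    using e1 e2 eventually_gt_at_top[of 0]
  proof eventually_elim
    case (elim n)
    \<comment> \<open>The same set is used at two times. At time 2 n the return probability on A is
      at least (1 - \<theta>) U n, so P (1 - \<theta>) U n <= 1. At time 4 n almost all mass lies in
      A and the return probability there is at most U (2 n), so 1 - \<theta> <= P U (2 n).
      Eliminating P compares U (2 n) with U n.\<close>
    define A where "A = {k. even k \<and> (real k)\<^sup>2 \<le> \<eta> * real n}"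
    have "A \<subseteq> {..nat \<lceil>\<eta> * real n\<rceil> + 1}"
    proof
      fix k assume k: "k \<in> A"
      have "real k \<le> (real k)\<^sup>2" by (cases k) (auto simp: power2_eq_square)
      also have "\<dots> \<le> \<eta> * real n" using k by (simp add: A_def)
      finally have "real k \<le> \<eta> * real n" .
      then show "k \<in> {..nat \<lceil>\<eta> * real n\<rceil> + 1}" by (simp add: le_nat_iff) linarith
    qed
    then have fin: "finite A" by (rule finite_subset) simp
    define P where "P = (\<Sum>k\<in>A. rev_meas p k)"
    have "P * ((1 - \<theta>) * U n) \<le> (\<Sum>k\<in>A. rev_meas p k * ret (2 * n) k)"
      unfolding P_def sum_distrib_right
    proof (intro sum_mono mult_left_mono)
      fix k assume k: "k \<in> A"
      have "(real k)\<^sup>2 \<le> \<eta> * real (2 * n)" using k \<eta>(1) by (auto simp: A_def elim!: order_trans)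
      then have "1 - \<theta> \<le> hit p (2 * n) k" using elim(1) k by (auto simp: A_def)
      then have "(1 - \<theta>) * U n \<le> hit p (2 * n) k * U n" by (intro mult_right_mono ret_nonneg)
      also have "\<dots> \<le> ret (2 * n) k" using ret_ge_hit[of "2 * n" k] k by (simp add: A_def)
      finally show "(1 - \<theta>) * U n \<le> ret (2 * n) k" .
    qed (simp add: less_imp_le rev_meas_pos)
    also have "\<dots> \<le> expect p (2 * n) (\<lambda>x. if x \<in> A then 1 else 0) 0" by (rule rev_meas_sum_ret_le[OF fin])
    also have "\<dots> \<le> expect p (2 * n) (\<lambda>x. 1) 0" by (rule expect_mono) simp
    finally have 1: "P * ((1 - \<theta>) * U n) \<le> 1" by simp
    have "1 - \<theta> \<le> 1 - scaled_tail (4 * n) (\<eta> / 8)" using elim(2) by simp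
    also have "\<dots> = expect p (4 * n) (\<lambda>x. 1 - (if \<eta> / 8 < (real x)\<^sup>2 / (2 * real (4 * n)) then 1 else 0)) 0"
      by (simp only: scaled_tail_def expect_diff expect_const)
    also have "\<dots> \<le> expect p (4 * n) (\<lambda>x. if x \<in> A then 1 else 0) 0"
    proof (rule expect_mono)
      fix x assume "even (x + 0 + 4 * n)"
      then show "1 - (if \<eta> / 8 < (real x)\<^sup>2 / (2 * real (4 * n)) then 1 else 0) \<le> (if x \<in> A then 1 else (0::real))"
        using elim(3) by (auto simp: A_def field_simps)
    qed
    also have "\<dots> = (\<Sum>k\<in>{k\<in>A. even (4 * n + k)}. rev_meas p k * ret (4 * n) k)"
      by (rule expect_ind_eq_sum[OF fin])
    also have "\<dots> \<le> (\<Sum>k\<in>A. rev_meas p k * ret (4 * n) k)"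
      using fin rev_meas_pos ret_nonneg by (intro sum_mono2) (auto intro!: mult_nonneg_nonneg simp: less_imp_le)
    also have "\<dots> \<le> (\<Sum>k\<in>A. rev_meas p k * U (2 * n))"
    proof (intro sum_mono mult_left_mono)
      fix k assume "k \<in> A"
      then show "ret (4 * n) k \<le> U (2 * n)" using ret_le_origin[of "4 * n" k] by (simp add: A_def)
    qed (simp add: less_imp_le rev_meas_pos)
    also have "\<dots> = P * U (2 * n)" by (simp add: P_def sum_distrib_right)
    finally have 2: "1 - \<theta> \<le> P * U (2 * n)" .
    have "0 < P * U (2 * n)" using 2 \<theta>(2) by linarith
    then have "0 < P" using U_pos[of "2 * n"] by (rule zero_less_mult_pos2)
    have "P * ((1 - \<theta>) * (1 - \<theta>) * U n) = (1 - \<theta>) * (P * ((1 - \<theta>) * U n))" by (simp add: mult_ac)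
    also have "\<dots> \<le> (1 - \<theta>) * 1" using 1 \<theta>(2) by (intro mult_left_mono) auto
    also have "\<dots> \<le> P * U (2 * n)" using 2 by simp
    finally have "(1 - \<theta>) * (1 - \<theta>) * U n \<le> U (2 * n)" using \<open>0 < P\<close> by simp
    then have "(1 - \<theta>) * (1 - \<theta>) \<le> U (2 * n) / U n" using U_pos[of n] by (simp add: pos_le_divide_eq)
    then show ?case using l2 by linarith
  qed
qed

text \<open>The averaging window will be a small fraction of n, so U has to be compared at times
  whose ratio is bounded but arbitrarily large.\<close>

lemma ret_sv_any_factor:
  assumes ret_sv
  shows "\<theta> > 0 \<Longrightarrow> \<exists>i0. \<forall>i\<ge>i0. \<forall>m\<le>4 ^ r * i. U i \<le> (1 + \<theta>) * U m"
proof (induction r arbitrary: \<theta>)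
  case 0
  have "U i \<le> (1 + \<theta>) * U m" if "m \<le> i" for i m
  proof -
    have "U i \<le> 1 * U m" using ret_even_antimono[OF that] by simp
    also have "\<dots> \<le> (1 + \<theta>) * U m" using 0 by (intro mult_right_mono ret_nonneg) auto
    finally show ?thesis .
  qed
  then show ?case by auto
next
  case (Suc r)
  define s where "s = sqrt (1 + \<theta>) - 1"
  have s: "s > 0" "(1 + s) * (1 + s) = 1 + \<theta>" using Suc.prems by (auto simp: s_def)
  obtain i1 where i1: "\<forall>i\<ge>i1. \<forall>m\<le>4 ^ r * i. U i \<le> (1 + s) * U m" using Suc.IH[OF s(1)] by blast
  obtain i2 where i2: "\<forall>i\<ge>i2. \<forall>m\<le>4 * i. U i \<le> (1 + s) * U m" using ret_sv_uniform[OF assms s(1)] by blast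
  have "U i \<le> (1 + \<theta>) * U m" if i: "i \<ge> max i1 i2" and m: "m \<le> 4 ^ Suc r * i" for i m
  proof -
    have "U i \<le> (1 + s) * U (4 * i)" using i by (intro i2[rule_format]) auto
    also have "U (4 * i) \<le> (1 + s) * U m"
      by (intro i1[rule_format]) (use i m in \<open>auto simp: mult.assoc mult.left_commute\<close>)
    then have "(1 + s) * U (4 * i) \<le> (1 + s) * ((1 + s) * U m)" using s(1) by (intro mult_left_mono) auto
    also have "\<dots> = (1 + \<theta>) * U m" by (simp only: mult.assoc[symmetric] s(2))
    finally show ?thesis .
  qed
  then show ?case by blast
qed

end

subsection \<open>The profile of the return probabilities\<close>

lemma even_int_diff_iff: "even (int n - int k) \<longleftrightarrow> even (n + k)"
  by presburger

lemma sqrt_scale_iff: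
  assumes "c > 0"
  shows "sqrt (real n * c) \<le> real k \<longleftrightarrow> c * real n \<le> (real k)\<^sup>2"
    and "real k \<le> sqrt (real n / c) \<longleftrightarrow> (real k)\<^sup>2 \<le> real n / c"
    and "sqrt (real n / c) < real k \<longleftrightarrow> real n / c < (real k)\<^sup>2"
proof -
  show "sqrt (real n * c) \<le> real k \<longleftrightarrow> c * real n \<le> (real k)\<^sup>2"
    using real_le_lsqrt[of "real k" "real n * c"] sqrt_le_D[of "real n * c" "real k"] by (auto simp: mult.commute)
  show *: "real k \<le> sqrt (real n / c) \<longleftrightarrow> (real k)\<^sup>2 \<le> real n / c"
    using power_mono[of "real k" "sqrt (real n / c)" 2] assms by (auto intro: real_le_rsqrt)
  show "sqrt (real n / c) < real k \<longleftrightarrow> real n / c < (real k)\<^sup>2"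
    using * by (simp only: not_le[symmetric])
qed

text \<open>Uniform continuity on [0, b], stated for a relative change of the argument. Only a
  decrease of the argument has to be limited, because an increase lowers
  \<open>Gamma_up\<close>.\<close>

lemma Gamma_up_perturb:
  assumes a: "a > 0" and b: "b > 0" and e: "e > 0"
  obtains \<tau> where "0 < \<tau>" "\<tau> < 1"
    "\<And>y z. 0 \<le> y \<Longrightarrow> y \<le> b \<Longrightarrow> (1 - \<tau>) * y \<le> z \<Longrightarrow> Gamma_up a z \<le> Gamma_up a y + e"
proof -
  have "uniformly_continuous_on {0..b} (Gamma_up a)"
    by (rule compact_uniformly_continuous[OF continuous_on_Gamma_up[OF a]]) simp
  then obtain d where d: "d > 0"
    "\<And>x y. x \<in> {0..b} \<Longrightarrow> y \<in> {0..b} \<Longrightarrow> dist y x < d \<Longrightarrow> dist (Gamma_up a y) (Gamma_up a x) < e"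
    using e unfolding uniformly_continuous_on_def by metis
  define \<tau> where "\<tau> = min (1/2) (d / (2 * b))"
  have \<tau>: "0 < \<tau>" "\<tau> < 1" using d b by (auto simp: \<tau>_def)
  have \<tau>b: "\<tau> * b < d"
  proof -
    have "\<tau> * b \<le> d / (2 * b) * b" using b unfolding \<tau>_def by (intro mult_right_mono) auto
    also have "\<dots> < d" using b d by simp
    finally show ?thesis .
  qed
  have "Gamma_up a z \<le> Gamma_up a y + e" if y: "0 \<le> y" "y \<le> b" "(1 - \<tau>) * y \<le> z" for y z
  proof -
    define w where "w = (1 - \<tau>) * y"
    have w: "0 \<le> w" "w \<le> b" using y \<tau> mult_right_mono[of "1 - \<tau>" 1 y] by (auto simp: w_def)
    have "dist w y = \<tau> * y" using y \<tau> by (simp add: dist_real_def w_def algebra_simps abs_mult)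
    also have "\<dots> \<le> \<tau> * b" using y \<tau> by (intro mult_left_mono) auto
    also note \<tau>b
    finally have "dist (Gamma_up a w) (Gamma_up a y) < e" using d(2)[of y w] y w by auto
    moreover have "Gamma_up a z \<le> Gamma_up a w" using w y by (intro Gamma_up_antimono a) (auto simp: w_def)
    ultimately show ?thesis by (simp add: dist_real_def)
  qed
  then show ?thesis using that \<tau> by blast
qed

lemma eventually_ge_real: "eventually (\<lambda>n. (K::real) \<le> real n) sequentially"
  using filterlim_real_sequentially by (simp add: filterlim_at_top)

context bessel_walk
begin

text \<open>For k far below sqrt n the hitting probability of 0 is close to 1, so
  \<open>ret_ge_hit\<close> and \<open>ret_le_origin\<close> enclose \<open>ret n k\<close>
  tightly.\<close>

lemma ret_near_origin:
  assumes \<delta>: "\<delta> > -1" and \<theta>: "\<theta> > 0"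
  obtains c0 where "c0 > 0" "\<And>c. c < c0 \<Longrightarrow> eventually (\<lambda>n. \<forall>k. real k < sqrt (c * real n) \<and> even (int n - int k) \<longrightarrow>
    (1 - \<theta>) * origin_ret n \<le> ret n k \<and> ret n k \<le> (1 + \<theta>) * origin_ret n) sequentially"
proof -
  obtain \<eta> where \<eta>: "\<eta> > 0"
    "eventually (\<lambda>n. \<forall>k. even (n + k) \<and> (real k)\<^sup>2 \<le> \<eta> * real n \<longrightarrow> 1 - \<theta> \<le> hit p n k) sequentially"
    using hit_near_0[OF assms] by blast
  have "eventually (\<lambda>n. \<forall>k. real k < sqrt (c * real n) \<and> even (int n - int k) \<longrightarrow>
    (1 - \<theta>) * origin_ret n \<le> ret n k \<and> ret n k \<le> (1 + \<theta>) * origin_ret n) sequentially" if c: "c < \<eta>" for c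
    using \<eta>(2)
  proof eventually_elim
    case (elim n)
    show ?case
    proof (intro allI impI, elim conjE)
      fix k assume k0: "real k < sqrt (c * real n)" "even (int n - int k)"
      then have k: "real k < sqrt (c * real n)" "even (n + k)" by (simp_all only: even_int_diff_iff)
      \<comment> \<open>Nothing is assumed about the sign of c: the existence of an admissible k
        already forces c n to be positive.\<close>
      have "0 < sqrt (c * real n)" using k by (meson le_less_trans of_nat_0_le_iff)
      then have pos: "0 < c * real n" by (simp del: of_nat_0_less_iff)
      have "(real k)\<^sup>2 \<le> (sqrt (c * real n))\<^sup>2" using k by (intro power_mono) auto
      also have "\<dots> = c * real n" using pos by (intro real_sqrt_pow2) simp
      also have "\<dots> \<le> \<eta> * real n" using c by (intro mult_right_mono) auto
      finally have "1 - \<theta> \<le> hit p n k" using elim k by blast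
      then have "(1 - \<theta>) * origin_ret n \<le> hit p n k * origin_ret n" by (rule mult_right_mono[OF _ ret_nonneg])
      also have "\<dots> \<le> ret n k" by (rule ret_ge_hit[OF k(2)])
      finally have 1: "(1 - \<theta>) * origin_ret n \<le> ret n k" .
      have "ret n k \<le> 1 * origin_ret n" using ret_le_origin[OF k(2)] by simp
      also have "\<dots> \<le> (1 + \<theta>) * origin_ret n" using \<theta> by (intro mult_right_mono ret_nonneg) simp
      finally show "(1 - \<theta>) * origin_ret n \<le> ret n k \<and> ret n k \<le> (1 + \<theta>) * origin_ret n" using 1 by blast
    qed
  qed
  then show ?thesis using that \<eta>(1) by blast
qed

lemma ret_profile_lower:
  assumes \<delta>: "\<delta> > -1" and c: "c > 0" and \<theta>: "\<theta> > 0"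
  shows "eventually (\<lambda>n. \<forall>k. (real k)\<^sup>2 \<le> real n / c \<and> even (n + k) \<longrightarrow>
    (1 - \<theta>) * Gamma_up \<kappa> ((real k)\<^sup>2 / (2 * real n)) * origin_ret n \<le> ret n k) sequentially"
proof -
  have \<kappa>: "\<kappa> > 0" using \<delta> by (simp add: \<kappa>_def)
  \<comment> \<open>The least value of \<open>Gamma_up\<close> on the range of k considered; an
    absolute error \<theta> g in the hitting law is thus a relative error \<theta>.\<close>
  define g where "g = Gamma_up \<kappa> (1 / (2 * c))"
  have g: "g > 0" unfolding g_def by (rule Gamma_up_pos[OF \<kappa>]) (use c in simp)
  have "\<theta> * g > 0" using \<theta> g by simp
  from hit_law[OF \<delta> this] eventually_gt_at_top[of 0] show ?thesis
  proof eventually_elim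
    case (elim n)
    show ?case
    proof (intro allI impI, elim conjE)
      fix k assume k: "(real k)\<^sup>2 \<le> real n / c" "even (n + k)"
      define y where "y = (real k)\<^sup>2 / (2 * real n)"
      have y: "0 \<le> y" "y \<le> 1 / (2 * c)" using k c elim by (auto simp: y_def field_simps)
      have gy: "g \<le> Gamma_up \<kappa> y" unfolding g_def by (rule Gamma_up_antimono[OF \<kappa> y])
      have "Gamma_up \<kappa> y \<le> Gamma_up \<kappa> ((real k)\<^sup>2 / (2 * (real n + 1)))"
        unfolding y_def using elim by (intro Gamma_up_antimono \<kappa> divide_left_mono) auto
      moreover have "\<bar>hit p n k - Gamma_up \<kappa> ((real k)\<^sup>2 / (2 * (real n + 1)))\<bar> \<le> \<theta> * g" using elim k by blast
      moreover have "\<theta> * g \<le> \<theta> * Gamma_up \<kappa> y" using gy \<theta> by (intro mult_left_mono) auto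
      ultimately have "(1 - \<theta>) * Gamma_up \<kappa> y \<le> hit p n k" by (simp add: algebra_simps)
      then have "(1 - \<theta>) * Gamma_up \<kappa> y * origin_ret n \<le> hit p n k * origin_ret n" by (rule mult_right_mono[OF _ ret_nonneg])
      also have "\<dots> \<le> ret n k" by (rule ret_ge_hit[OF k(2)])
      finally show "(1 - \<theta>) * Gamma_up \<kappa> ((real k)\<^sup>2 / (2 * real n)) * origin_ret n \<le> ret n k" by (simp only: y_def)
    qed
  qed
qed

lemma U_sum_le:
  assumes sv: ret_sv and \<eta>: "\<eta> > 0" and e: "e > 0"
  shows "\<exists>J0. \<forall>J\<ge>J0. \<forall>n. \<eta> * real n \<le> real J \<longrightarrow> (\<Sum>i<J. U i) \<le> (1 + e) * (1 + e) * real J * origin_ret n"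
proof -
  obtain r where r: "1 / \<eta> < 4 ^ r" using real_arch_pow[of 4 "1 / \<eta>"] by auto
  obtain i0 where i0: "\<forall>i\<ge>i0. \<forall>m\<le>4 ^ r * i. U i \<le> (1 + e) * U m" using ret_sv_any_factor[OF sv e] by blast
  have "eventually (\<lambda>n. (\<Sum>i<n. U i) / (real n * U n) < 1 + e) sequentially"
    by (rule order_tendstoD(2)[OF U_average[OF sv]]) (use e in simp)
  then obtain J1 where J1: "\<And>n. n \<ge> J1 \<Longrightarrow> (\<Sum>i<n. U i) / (real n * U n) < 1 + e"
    by (auto simp: eventually_sequentially)
  have "(\<Sum>i<J. U i) \<le> (1 + e) * (1 + e) * real J * origin_ret n"
    if J: "J \<ge> max (max J1 i0) 1" and n: "\<eta> * real n \<le> real J" for J n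
  proof -
    have "real n \<le> 1 / \<eta> * real J" using n \<eta> by (simp add: field_simps)
    also have "\<dots> \<le> 4 ^ r * real J" using r by (intro mult_right_mono) auto
    also have "\<dots> = real (4 ^ r * J)" by simp
    finally have "n \<le> 4 ^ r * J" by (simp only: of_nat_le_iff)
    moreover have "1 \<le> 4 ^ r * J" using J by (simp add: Suc_leI)
    ultimately have "(n + 1) div 2 \<le> 4 ^ r * J" by linarith
    then have UJ: "U J \<le> (1 + e) * U ((n + 1) div 2)" using J by (intro i0[rule_format]) auto
    have "(\<Sum>i<J. U i) \<le> (1 + e) * (real J * U J)"
      using J1[of J] J U_pos[of J] by (simp add: pos_divide_less_eq less_imp_le)
    also have "\<dots> \<le> (1 + e) * (real J * ((1 + e) * U ((n + 1) div 2)))"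
      using UJ e by (intro mult_left_mono) auto
    also have "\<dots> = (1 + e) * (1 + e) * real J * origin_ret n" by (simp only: origin_ret_eq mult_ac)
    finally show ?thesis .
  qed
  then show ?thesis by blast
qed

text \<open>\<open>ret_le_average\<close> is applied with k' = k - 2 d, d of order \<zeta> sqrt n,
  and a time window J of order \<eta> n. The shift d must be small enough to leave the Gamma profile
  unchanged, and \<eta> small against \<zeta>^2 so that the walk from k' rarely passes k during the
  window.\<close>

lemma ret_profile_upper:
  assumes \<delta>: "\<delta> > -1" and sv: ret_sv and c: "c > 0" and \<theta>: "\<theta> > 0"
  shows "eventually (\<lambda>n. \<forall>k. c * real n \<le> (real k)\<^sup>2 \<and> (real k)\<^sup>2 \<le> real n / c \<and> even (n + k) \<longrightarrow>
    ret n k \<le> (1 + \<theta>) * Gamma_up \<kappa> ((real k)\<^sup>2 / (2 * real n)) * origin_ret n) sequentially"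
proof -
  have \<kappa>: "\<kappa> > 0" using \<delta> by (simp add: \<kappa>_def)
  obtain C where "bounded_drift_walk p C" by (rule bounded_drift)
  then interpret bounded_drift_walk p C .
  define b where "b = 1 / (2 * c)"
  have b: "b > 0" using c by (simp add: b_def)
  define g where "g = Gamma_up \<kappa> b"
  have g: "g > 0" unfolding g_def by (rule Gamma_up_pos[OF \<kappa>]) (use b in simp)
  \<comment> \<open>Three factors 1 + e arise from the hitting law, the average of U and its slow
    variation, and one factor 1 - e from the walks passing k. For e <= 1/4 the cube is at most 1 + 4
    e, and e (5 + \<theta>) <= \<theta> does the rest.\<close>
  define e where "e = min (1 / 4) (\<theta> / (5 + \<theta>))"
  have e: "0 < e" "e \<le> 1 / 4" using \<theta> unfolding e_def by (simp, intro min.cobounded1)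
  have e\<theta>: "(1 + e) * (1 + e) * (1 + e) \<le> (1 + \<theta>) * (1 - e)"
  proof -
    have "e \<le> \<theta> / (5 + \<theta>)" unfolding e_def by (rule min.cobounded2)
    then have 1: "e * (5 + \<theta>) \<le> \<theta>" using \<theta> by (simp add: pos_le_divide_eq)
    have ee: "e * e \<le> e * (1 / 4)" using e by (intro mult_left_mono) auto
    then have "e * e \<le> 1 / 4" using e by linarith
    then have "e * (e * e) \<le> e * (1 / 4)" using e by (intro mult_left_mono) auto
    moreover note ee
    moreover have "(1 + e) * (1 + e) * (1 + e) = 1 + 3 * e + 3 * (e * e) + e * (e * e)" by (simp add: algebra_simps)
    ultimately have "(1 + e) * (1 + e) * (1 + e) \<le> 1 + 4 * e" by argo
    also have "\<dots> \<le> (1 + \<theta>) * (1 - e)" using 1 by (simp add: algebra_simps)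
    finally show ?thesis .
  qed
  define \<epsilon> where "\<epsilon> = e * g / 2"
  have \<epsilon>: "\<epsilon> > 0" using e g by (simp add: \<epsilon>_def)
  obtain \<tau> where \<tau>: "0 < \<tau>" "\<tau> < 1"
    "\<And>y z. 0 \<le> y \<Longrightarrow> y \<le> b \<Longrightarrow> (1 - \<tau>) * y \<le> z \<Longrightarrow> Gamma_up \<kappa> z \<le> Gamma_up \<kappa> y + \<epsilon>"
    using Gamma_up_perturb[OF \<kappa> b \<epsilon>] by blast
  \<comment> \<open>Rounding up at most doubles d, so 2 d <= 4 \<zeta> sqrt n = (\<tau>/4) sqrt(c n)
    <= (\<tau>/4) k.\<close>
  define \<zeta> where "\<zeta> = sqrt c * \<tau> / 16"
  have \<zeta>: "\<zeta> > 0" using c \<tau> by (simp add: \<zeta>_def)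
  \<comment> \<open>The first entry bounds the probability of passing k by e. The second gives 2 J +
    1 <= 5 (\<tau>/20) n, so the final time exceeds n by at most the factor 1 + \<tau>/4.\<close>
  define \<eta> where "\<eta> = min (e * \<zeta>\<^sup>2 / (1 + 2 * C)) (\<tau> / 20)"
  have C1: "1 + 2 * C > 0" using C_nonneg by simp
  have \<eta>: "\<eta> > 0" "\<eta> \<le> \<tau> / 20" "\<eta> * (1 + 2 * C) \<le> e * \<zeta>\<^sup>2"
  proof -
    show "\<eta> > 0" using e \<zeta> C1 \<tau> by (simp add: \<eta>_def)
    show "\<eta> \<le> \<tau> / 20" unfolding \<eta>_def by (rule min.cobounded2)
    have "\<eta> \<le> e * \<zeta>\<^sup>2 / (1 + 2 * C)" unfolding \<eta>_def by (rule min.cobounded1)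
    then show "\<eta> * (1 + 2 * C) \<le> e * \<zeta>\<^sup>2" using C1 by (simp add: pos_le_divide_eq)
  qed
  obtain N0 where N0: "\<And>n k. n \<ge> N0 \<Longrightarrow> even (n + k) \<Longrightarrow> \<bar>hit p n k - Gamma_up \<kappa> ((real k)\<^sup>2 / (2 * (real n + 1)))\<bar> \<le> \<epsilon>"
    using hit_law[OF \<delta> \<epsilon>] by (auto simp: eventually_sequentially)
  obtain J0 where J0: "\<And>J n. J \<ge> J0 \<Longrightarrow> \<eta> * real n \<le> real J \<Longrightarrow> (\<Sum>i<J. U i) \<le> (1 + e) * (1 + e) * real J * origin_ret n"
    using U_sum_le[OF sv \<eta>(1) e(1)] by blast
  show ?thesis
    using eventually_ge_real[of "1 / \<eta>"] eventually_ge_real[of "1 / \<zeta>\<^sup>2"] eventually_ge_real[of "20 / \<tau>"]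
      eventually_ge_real[of "real J0 / \<eta>"] eventually_ge_at_top[of N0] eventually_gt_at_top[of 0]
  proof eventually_elim
    case (elim n)
    define J where "J = nat \<lceil>\<eta> * real n\<rceil>"
    define d where "d = nat \<lceil>\<zeta> * sqrt (real n)\<rceil>"
    have n: "real n > 0" "sqrt (real n) > 0" using elim by auto
    have \<eta>n: "\<eta> * real n \<ge> 1" using elim(1) \<eta>(1) by (simp add: field_simps)
    have J: "\<eta> * real n \<le> real J" "real J \<le> 2 * (\<eta> * real n)"
      using \<eta>n unfolding J_def by linarith+
    have JJ0: "J \<ge> J0"
    proof -
      have "real J0 \<le> \<eta> * real n" using elim(4) \<eta>(1) by (simp add: field_simps)
      then have "real J0 \<le> real J" using J by linarith
      then show ?thesis by simp
    qed
    have "1 / \<zeta> \<le> sqrt (real n)"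
      using real_sqrt_le_mono[OF elim(2)] \<zeta> by (simp add: real_sqrt_divide)
    then have "\<zeta> * sqrt (real n) \<ge> 1" using \<zeta> by (simp add: field_simps)
    then have d: "\<zeta> * sqrt (real n) \<le> real d" "real d \<le> 2 * (\<zeta> * sqrt (real n))"
      unfolding d_def by linarith+
    show ?case
    proof (intro allI impI, elim conjE)
      fix k assume k: "c * real n \<le> (real k)\<^sup>2" "(real k)\<^sup>2 \<le> real n / c" "even (n + k)"
      define y where "y = (real k)\<^sup>2 / (2 * real n)"
      have y: "0 \<le> y" "y \<le> b" using k(2) c n by (auto simp: y_def b_def field_simps)
      have "sqrt (c * real n) \<le> sqrt ((real k)\<^sup>2)" using k(1) by (rule real_sqrt_le_mono)
      then have kc: "sqrt c * sqrt (real n) \<le> real k" by (simp add: real_sqrt_mult)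
      have "2 * real d \<le> \<tau> / 4 * (sqrt c * sqrt (real n))" using d(2) by (simp add: \<zeta>_def)
      also have "\<dots> \<le> \<tau> / 4 * real k" using kc \<tau> by (intro mult_left_mono) auto
      finally have dk: "2 * real d \<le> \<tau> / 4 * real k" .
      have "0 < sqrt c * sqrt (real n)" using c n by simp
      then have k0: "real k > 0" using kc by linarith
      have "2 * real d < real k"
      proof -
        have "\<tau> / 4 * real k < 1 * real k" using k0 \<tau> by (intro mult_strict_right_mono) auto
        then show ?thesis using dk by linarith
      qed
      then have dk2: "2 * d < k" by linarith
      define k' where "k' = k - 2 * d"
      have rk': "real k' = real k - 2 * real d" using dk2 by (simp add: k'_def of_nat_diff)
      have "0 < real d" using d(1) \<zeta> n by (smt (verit) mult_pos_pos)
      then have k': "k' < k" "even (k' + k)" "even (n + 2 * J + k')"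
        using dk2 k(3) by (auto simp: k'_def)
      have small: "2 * real J * (1 + 2 * C) / (real k - real k')\<^sup>2 \<le> e"
      proof -
        have "2 * real J * (1 + 2 * C) \<le> 2 * (2 * (\<eta> * real n)) * (1 + 2 * C)"
          using J C1 by (intro mult_right_mono) auto
        also have "\<dots> = 4 * real n * (\<eta> * (1 + 2 * C))" by (simp add: algebra_simps)
        also have "\<dots> \<le> 4 * real n * (e * \<zeta>\<^sup>2)" using \<eta>(3) n by (intro mult_left_mono) auto
        also have "\<dots> = e * (2 * (\<zeta> * sqrt (real n)))\<^sup>2" using n by (simp add: power_mult_distrib)
        also have "\<dots> \<le> e * (2 * real d)\<^sup>2"
          using d(1) e \<zeta> n by (intro mult_left_mono power_mono) auto
        also have "2 * real d = real k - real k'" using rk' by simp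
        finally show ?thesis using \<open>0 < real d\<close> rk' by (simp add: pos_divide_le_eq)
      qed
      define N where "N = n + 2 * J"
      have N: "real N + 1 \<le> real n * (1 + \<tau> / 4)"
      proof -
        have "real J \<le> 2 * (\<tau> / 20 * real n)" using J(2) \<eta>(2) n mult_right_mono[OF \<eta>(2), of "real n"] by linarith
        moreover have "1 \<le> \<tau> / 20 * real n" using elim(3) \<tau> by (simp add: field_simps)
        ultimately have "2 * real J + 1 \<le> 5 * (\<tau> / 20 * real n)" by linarith
        then show ?thesis by (simp add: N_def algebra_simps)
      qed
      have "(1 - \<tau>) * y \<le> (real k')\<^sup>2 / (2 * (real N + 1))"
      proof -
        \<comment> \<open>Lowering k by the factor 1 - \<tau>/4 and lengthening time by 1 + \<tau>/4
          reduces the argument of \<open>Gamma_up\<close> by no more than the factor 1 -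
          \<tau>.\<close>
        have "(1 - \<tau>) * (1 + \<tau> / 4) \<le> (1 - \<tau> / 4)\<^sup>2"
          using \<tau> by (simp add: power2_eq_square algebra_simps)
        then have "(1 - \<tau>) * (1 + \<tau> / 4) * (real k)\<^sup>2 \<le> (1 - \<tau> / 4)\<^sup>2 * (real k)\<^sup>2"
          by (rule mult_right_mono) simp
        also have "\<dots> = ((1 - \<tau> / 4) * real k)\<^sup>2" by (simp add: power_mult_distrib)
        also have "\<dots> \<le> (real k')\<^sup>2"
          using dk rk' \<tau> by (intro power_mono mult_nonneg_nonneg) (auto simp: algebra_simps)
        finally have 1: "(1 - \<tau>) * (1 + \<tau> / 4) * (real k)\<^sup>2 \<le> (real k')\<^sup>2" .
        have "(1 - \<tau>) * y = (1 - \<tau>) * (1 + \<tau> / 4) * (real k)\<^sup>2 / (2 * (real n * (1 + \<tau> / 4)))"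
        proof -
          define q where "q = 1 + \<tau> / 4"
          have "q > 0" using \<tau> by (simp add: q_def)
          then show ?thesis unfolding q_def[symmetric] using n by (simp add: y_def field_simps)
        qed
        also have "\<dots> \<le> (real k')\<^sup>2 / (2 * (real n * (1 + \<tau> / 4)))"
          using 1 n \<tau> by (intro divide_right_mono) auto
        also have "\<dots> \<le> (real k')\<^sup>2 / (2 * (real N + 1))"
          using N n \<tau> by (intro divide_left_mono) auto
        finally show ?thesis .
      qed
      then have "Gamma_up \<kappa> ((real k')\<^sup>2 / (2 * (real N + 1))) \<le> Gamma_up \<kappa> y + \<epsilon>"
        by (rule \<tau>(3)[OF y])
      moreover have "\<bar>hit p N k' - Gamma_up \<kappa> ((real k')\<^sup>2 / (2 * (real N + 1)))\<bar> \<le> \<epsilon>"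
        using elim(5) k'(3) by (intro N0) (auto simp: N_def)
      ultimately have h: "hit p N k' \<le> Gamma_up \<kappa> y + 2 * \<epsilon>" by linarith
      have "g \<le> Gamma_up \<kappa> y" unfolding g_def by (rule Gamma_up_antimono[OF \<kappa> y])
      then have "2 * \<epsilon> \<le> e * Gamma_up \<kappa> y" using e by (simp add: \<epsilon>_def)
      with h have h2: "hit p N k' \<le> (1 + e) * Gamma_up \<kappa> y" by (simp add: algebra_simps)
      have Gy: "0 \<le> Gamma_up \<kappa> y" by (rule Gamma_up_nonneg[OF \<kappa> y(1)])
      have "ret n k * (real J * (1 - e)) \<le> ret n k * (real J * (1 - 2 * real J * (1 + 2 * C) / (real k - real k')\<^sup>2))"
        using small by (intro mult_left_mono ret_nonneg) auto
      also have "\<dots> \<le> hit p N k' * (\<Sum>i<J. U i)"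
        unfolding N_def by (rule ret_le_average[OF k'(1,2) k(3)])
      also have "\<dots> \<le> ((1 + e) * Gamma_up \<kappa> y) * ((1 + e) * (1 + e) * real J * origin_ret n)"
        using h2 J0[OF JJ0 J(1)] e Gy by (intro mult_mono sum_nonneg ret_nonneg) auto
      also have "\<dots> = ((1 + e) * (1 + e) * (1 + e)) * (real J * (Gamma_up \<kappa> y * origin_ret n))"
        by (simp only: mult_ac)
      also have "\<dots> \<le> ((1 + \<theta>) * (1 - e)) * (real J * (Gamma_up \<kappa> y * origin_ret n))"
        by (intro mult_right_mono e\<theta> mult_nonneg_nonneg Gy ret_nonneg) auto
      also have "\<dots> = ((1 + \<theta>) * Gamma_up \<kappa> y * origin_ret n) * (real J * (1 - e))"
        by (simp only: mult_ac)
      finally have *: "ret n k * (real J * (1 - e)) \<le> ((1 + \<theta>) * Gamma_up \<kappa> y * origin_ret n) * (real J * (1 - e))" .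
      have "0 < real J" using J(1) \<eta>n by linarith
      then have "0 < real J * (1 - e)" using e by simp
      with * have "ret n k \<le> (1 + \<theta>) * Gamma_up \<kappa> y * origin_ret n" by (rule mult_right_le_imp_le)
      then show "ret n k \<le> (1 + \<theta>) * Gamma_up \<kappa> ((real k)\<^sup>2 / (2 * real n)) * origin_ret n" by (simp only: y_def)
    qed
  qed
qed

lemma hit_gaussian_tail:
  assumes "even (n + k)" "bounded_drift_walk p C"
  shows "hit p n k \<le> exp ((1 + 2 * C) / 2) * exp (- (real k)\<^sup>2 / (4 * (real n + 1)))"
proof -
  interpret b: bounded_drift_walk p C by fact
  interpret d: bounded_drift_walk "\<lambda>x. 1 - p x" C
  proof (unfold_locales)
    fix x :: nat
    show "1 \<le> x \<Longrightarrow> 0 < 1 - p x" "1 \<le> x \<Longrightarrow> 1 - p x < 1" using p_pos p_less by auto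
    have "real x * (2 * (1 - p x) - 1) = - (real x * (2 * p x - 1))" by (simp add: algebra_simps)
    then show "\<bar>real x * (2 * (1 - p x) - 1)\<bar> \<le> C" using b.drift_le[of x] by (simp only: abs_minus_cancel)
  qed
  show ?thesis
    unfolding hit_eq_dual_tail[OF walk_axioms assms(1)]
    using d.gaussian_tail[of "Suc n" "real k"] by (simp add: add.commute)
qed

text \<open>The same averaging, now with d proportional to k (about k/20) and J about n/8. The
  factor 3 covers 2 (6/5)^2, the 2 coming from a probability of at most 1/2 of passing k; since
  \<open>origin_ret\<close> times the mean tends to 2, it leaves room below the final 8.\<close>

lemma ret_tail:
  assumes sv: ret_sv
  shows "\<exists>c0>0. \<forall>c. 0 < c \<and> c < c0 \<longrightarrow> eventually (\<lambda>n. \<forall>k. real n / c < (real k)\<^sup>2 \<and> even (n + k) \<longrightarrow>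
    ret n k \<le> 3 * exp (- (real k)\<^sup>2 / (8 * real n)) * origin_ret n) sequentially"
proof -
  obtain C where Cw: "bounded_drift_walk p C" by (rule bounded_drift)
  then interpret bounded_drift_walk p C .
  have C1: "1 + 2 * C > 0" using C_nonneg by simp
  define K where "K = exp ((1 + 2 * C) / 2)"
  have K: "K > 0" by (simp add: K_def)
  \<comment> \<open>As k^2/n exceeds 1/c, the first entry makes the probability of passing k at most
    1/2, and the second lets a spare factor exp(-k^2/(100 n)) absorb K.\<close>
  define c0 where "c0 = min (1 / (200 * (1 + 2 * C))) (1 / (100 * K))"
  have c0: "c0 > 0" using C1 K by (simp add: c0_def)
  have "eventually (\<lambda>n. \<forall>k. real n / c < (real k)\<^sup>2 \<and> even (n + k) \<longrightarrow>
    ret n k \<le> 3 * exp (- (real k)\<^sup>2 / (8 * real n)) * origin_ret n) sequentially" if c: "0 < c" "c < c0" for c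
  proof -
    have c1: "c * (200 * (1 + 2 * C)) \<le> 1" "c * (100 * K) \<le> 1"
      using c C1 K by (simp_all add: c0_def field_simps)
    obtain J0 where J0: "\<And>J n. J \<ge> J0 \<Longrightarrow> 1 / 16 * real n \<le> real J \<Longrightarrow>
        (\<Sum>i<J. U i) \<le> (1 + 1/5) * (1 + 1/5) * real J * origin_ret n"
      using U_sum_le[OF sv, of "1 / 16" "1 / 5"] by auto
    show ?thesis
      using eventually_ge_at_top[of 20] eventually_ge_at_top[of "16 * J0"] eventually_ge_real[of "1600 * c"]
    proof eventually_elim
      case (elim n)
      define J where "J = n div 8"
      have J8: "8 * J \<le> n" "n \<le> 16 * J" using elim(1) by (auto simp: J_def)
      then have J: "real J \<le> real n / 8" "1 / 16 * real n \<le> real J" "J \<ge> J0" "J \<ge> 1"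
        using elim(1,2) by auto
      have n: "real n \<ge> 20" using elim(1) by simp
      show ?case
      proof (intro allI impI, elim conjE)
        fix k assume k: "real n / c < (real k)\<^sup>2" "even (n + k)"
        have nk: "real n < c * (real k)\<^sup>2" using k(1) c by (simp add: field_simps)
        have k40: "real k \<ge> 40"
        proof (rule power2_le_imp_le)
          have "1600 * c \<le> c * (real k)\<^sup>2" using elim(3) nk by linarith
          then show "(40::real)\<^sup>2 \<le> (real k)\<^sup>2" using c by (simp add: mult.commute)
        qed simp
        define d where "d = k div 20"
        have "20 * d \<le> k" "k < 20 * d + 20" by (auto simp: d_def)
        then have d: "real d \<le> real k / 20" "real k / 40 \<le> real d" using k40 by linarith+
        define k' where "k' = k - 2 * d"
        have rk': "real k' = real k - 2 * real d" using \<open>20 * d \<le> k\<close> by (simp add: k'_def of_nat_diff)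
        have d0: "d > 0" using d k40 by (intro gr0I) auto
        have k': "k' < k" "even (k' + k)" "even (n + 2 * J + k')"
          using d0 k(2) \<open>20 * d \<le> k\<close> by (auto simp: k'_def)
        have small: "2 * real J * (1 + 2 * C) / (real k - real k')\<^sup>2 \<le> 1 / 2"
        proof -
          have "2 * real J * (1 + 2 * C) \<le> 2 * (real n / 8) * (1 + 2 * C)"
            using J C1 by (intro mult_right_mono) auto
          also have "\<dots> \<le> (c * (real k)\<^sup>2) / 4 * (1 + 2 * C)"
            using nk C1 by (intro mult_right_mono) auto
          also have "\<dots> = (c * (200 * (1 + 2 * C))) * ((real k)\<^sup>2 / 800)" by simp
          also have "\<dots> \<le> 1 * ((real k)\<^sup>2 / 800)" using c1 by (intro mult_right_mono) auto
          also have "\<dots> = 1 / 2 * (2 * (real k / 40))\<^sup>2" by (simp add: power2_eq_square)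
          also have "\<dots> \<le> 1 / 2 * (2 * real d)\<^sup>2" using d by (intro mult_left_mono power_mono) auto
          also have "2 * real d = real k - real k'" using rk' by simp
          finally show ?thesis using d0 rk' by (simp add: pos_divide_le_eq)
        qed
        define N where "N = n + 2 * J"
        have N: "real N + 1 \<le> 13 / 10 * real n" using J(1) n by (simp add: N_def)
        \<comment> \<open>k' is at least 9k/10 and the time at most 13n/10; the rate 0.81/5.2 then
          exceeds 1/8 + 1/100.\<close>
        have ex: "- (real k')\<^sup>2 / (4 * (real N + 1)) \<le> - (real k)\<^sup>2 / (8 * real n) - (real k)\<^sup>2 / (100 * real n)"
        proof -
          have "(9 / 10 * real k)\<^sup>2 \<le> (real k')\<^sup>2" using rk' d by (intro power_mono) auto
          then have "81 / 100 * (real k)\<^sup>2 \<le> (real k')\<^sup>2" by (simp add: power2_eq_square)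
          then have "81 / 100 * (real k)\<^sup>2 / (4 * (13 / 10 * real n)) \<le> (real k')\<^sup>2 / (4 * (real N + 1))"
            using N n by (intro frac_le) auto
          moreover have "(real k)\<^sup>2 / (8 * real n) + (real k)\<^sup>2 / (100 * real n) \<le> 81 / 100 * (real k)\<^sup>2 / (4 * (13 / 10 * real n))"
            using n by (simp add: field_simps)
          ultimately show ?thesis by simp
        qed
        have Kexp: "K * exp (- ((real k)\<^sup>2 / (100 * real n))) \<le> 1"
        proof -
          have "100 * K * c \<le> 1" using c1 by (simp add: mult_ac)
          then have "K \<le> 1 / (100 * c)" using c by (simp add: field_simps)
          also have "\<dots> \<le> (real k)\<^sup>2 / (100 * real n)" using nk c n by (simp add: field_simps)
          also have "\<dots> \<le> exp ((real k)\<^sup>2 / (100 * real n))"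
            using exp_ge_add_one_self[of "(real k)\<^sup>2 / (100 * real n)"] by linarith
          finally show ?thesis by (simp add: exp_minus field_simps)
        qed
        have "hit p N k' \<le> K * exp (- (real k')\<^sup>2 / (4 * (real N + 1)))"
          unfolding K_def N_def by (rule hit_gaussian_tail[OF k'(3) Cw])
        also have "\<dots> \<le> K * exp (- (real k)\<^sup>2 / (8 * real n) - (real k)\<^sup>2 / (100 * real n))"
          using ex K by simp
        also have "\<dots> = exp (- (real k)\<^sup>2 / (8 * real n)) * (K * exp (- ((real k)\<^sup>2 / (100 * real n))))"
          unfolding diff_conv_add_uminus exp_add by (simp only: mult_ac)
        also have "\<dots> \<le> exp (- (real k)\<^sup>2 / (8 * real n)) * 1" using Kexp by (intro mult_left_mono) auto
        finally have h: "hit p N k' \<le> exp (- (real k)\<^sup>2 / (8 * real n))" by simp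
        have "ret n k * (real J * (1 / 2)) \<le> ret n k * (real J * (1 - 2 * real J * (1 + 2 * C) / (real k - real k')\<^sup>2))"
          using small by (intro mult_left_mono ret_nonneg) auto
        also have "\<dots> \<le> hit p N k' * (\<Sum>i<J. U i)"
          unfolding N_def by (rule ret_le_average[OF k'(1,2) k(2)])
        also have "\<dots> \<le> exp (- (real k)\<^sup>2 / (8 * real n)) * ((1 + 1/5) * (1 + 1/5) * real J * origin_ret n)"
          using h J0[OF J(3,2)] by (intro mult_mono sum_nonneg ret_nonneg) auto
        also have "\<dots> = (36/25 * exp (- (real k)\<^sup>2 / (8 * real n)) * origin_ret n) * real J"
          by simp
        also have "\<dots> \<le> (3/2 * exp (- (real k)\<^sup>2 / (8 * real n)) * origin_ret n) * real J"
          by (intro mult_right_mono ret_nonneg) auto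
        also have "\<dots> = (3 * exp (- (real k)\<^sup>2 / (8 * real n)) * origin_ret n) * (real J * (1 / 2))"
          by simp
        finally show "ret n k \<le> 3 * exp (- (real k)\<^sup>2 / (8 * real n)) * origin_ret n"
          by (rule mult_right_le_imp_le) (use J in auto)
      qed
    qed
  qed
  then show ?thesis using c0 by blast
qed

end

subsection \<open>The local limit theorem for $\delta<1$\<close>

lemma Lfun_of_nat: "Lfun p \<delta> (real x) = Lnat p \<delta> x"
  by (simp add: Lfun_def)

lemma Lnat_pos: "0 < Lnat p \<delta> x"
  by (simp add: Lnat_def)

lemma Lfun_bounds:
  assumes "t \<ge> 0"
    and "A \<le> Lnat p \<delta> (nat \<lfloor>t\<rfloor>)" "A \<le> Lnat p \<delta> (nat \<lfloor>t\<rfloor> + 1)"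
    and "Lnat p \<delta> (nat \<lfloor>t\<rfloor>) \<le> B" "Lnat p \<delta> (nat \<lfloor>t\<rfloor> + 1) \<le> B"
  shows "A \<le> Lfun p \<delta> t" "Lfun p \<delta> t \<le> B"
proof -
  define m where "m = nat \<lfloor>t\<rfloor>"
  define u where "u = t - real m"
  have u: "0 \<le> u" "u \<le> 1" using assms(1) unfolding u_def m_def by linarith+
  have eq: "Lfun p \<delta> t = (1 - u) * Lnat p \<delta> m + u * Lnat p \<delta> (m + 1)"
    by (simp add: Lfun_def Let_def u_def m_def algebra_simps)
  have "(1 - u) * A + u * A \<le> Lfun p \<delta> t"
    unfolding eq using u assms by (intro add_mono mult_left_mono) (auto simp: m_def)
  then show "A \<le> Lfun p \<delta> t" by (simp add: algebra_simps)
  have "Lfun p \<delta> t \<le> (1 - u) * B + u * B"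
    unfolding eq using u assms by (intro add_mono mult_left_mono) (auto simp: m_def)
  then show "Lfun p \<delta> t \<le> B" by (simp add: algebra_simps)
qed

context bessel_walk
begin

lemma Rterm_eq: "x \<ge> 1 \<Longrightarrow> Rterm p \<delta> x = 2 * drift_err x / real x"
  by (simp add: Rterm_def drift_err_def field_simps)

text \<open>L is slowly varying: between i and j <= \<rho> i the logarithm of L changes by at most
  \<rho> i terms, each of which is o(1/i).\<close>

lemma Lnat_ratio:
  assumes s: "s > 0" and \<rho>: "\<rho> > 0"
  shows "\<exists>x0. \<forall>i j. x0 \<le> i \<and> x0 \<le> j \<and> real j \<le> \<rho> * real i \<and> real i \<le> \<rho> * real j \<longrightarrow>
    Lnat p \<delta> j \<le> exp s * Lnat p \<delta> i"
proof -
  define \<eta> where "\<eta> = s / \<rho>"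
  have \<eta>: "\<eta> > 0" using s \<rho> by (simp add: \<eta>_def)
  obtain x1 where x1: "\<And>x. x \<ge> x1 \<Longrightarrow> \<bar>drift_err x\<bar> < \<eta> / 2"
    using LIMSEQ_D[OF drift_err_tendsto, of "\<eta> / 2"] \<eta> by auto
  define x0 where "x0 = max x1 1"
  have R: "\<bar>Rterm p \<delta> x\<bar> \<le> \<eta> / real x" if "x \<ge> x0" for x
    using x1[of x] that by (simp add: Rterm_eq x0_def abs_mult divide_right_mono)
  have main: "\<bar>(\<Sum>l=1..j. Rterm p \<delta> l) - (\<Sum>l=1..i. Rterm p \<delta> l)\<bar> \<le> s"
    if ij: "x0 \<le> i" "i \<le> j" "real j \<le> \<rho> * real i" for i j
  proof -
    have i: "real i > 0" using ij(1) by (simp add: x0_def)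
    have "{1..j} = {1..i} \<union> {i<..j}" using ij by (auto simp: x0_def)
    then have "(\<Sum>l=1..j. Rterm p \<delta> l) - (\<Sum>l=1..i. Rterm p \<delta> l) = (\<Sum>l\<in>{i<..j}. Rterm p \<delta> l)"
      by (simp add: sum.union_disjoint disjoint_iff)
    also have "\<bar>\<dots>\<bar> \<le> (\<Sum>l\<in>{i<..j}. \<bar>Rterm p \<delta> l\<bar>)" by (rule sum_abs)
    also have "\<dots> \<le> (\<Sum>l\<in>{i<..j}. \<eta> / real i)"
    proof (rule sum_mono)
      fix l assume l: "l \<in> {i<..j}"
      have "\<bar>Rterm p \<delta> l\<bar> \<le> \<eta> / real l" using R l ij by auto
      also have "\<dots> \<le> \<eta> / real i" using l i \<eta> by (intro divide_left_mono) auto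
      finally show "\<bar>Rterm p \<delta> l\<bar> \<le> \<eta> / real i" .
    qed
    also have "\<dots> = real (j - i) * (\<eta> / real i)" by simp
    also have "\<dots> \<le> (\<rho> * real i) * (\<eta> / real i)"
      using ij \<eta> i by (intro mult_right_mono) auto
    also have "\<dots> = s" using i \<rho> by (simp add: \<eta>_def)
    finally show ?thesis .
  qed
  have "Lnat p \<delta> j \<le> exp s * Lnat p \<delta> i"
    if "x0 \<le> i" "x0 \<le> j" "real j \<le> \<rho> * real i" "real i \<le> \<rho> * real j" for i j
  proof -
    have "(\<Sum>l=1..j. Rterm p \<delta> l) \<le> s + (\<Sum>l=1..i. Rterm p \<delta> l)"
      using main[of i j] main[of j i] that by (cases "i \<le> j") (auto simp: abs_le_iff)
    then show ?thesis unfolding Lnat_def exp_add[symmetric] by simp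
  qed
  then show ?thesis by blast
qed

lemma Lfun_sqrt_ratio:
  assumes s: "s > 0" and c: "0 < c" "c < 1"
  shows "eventually (\<lambda>n. \<forall>j. c * real n \<le> (real j)\<^sup>2 \<and> (real j)\<^sup>2 \<le> real n / c \<longrightarrow>
    exp (- s) * Lnat p \<delta> j \<le> Lfun p \<delta> (sqrt (real n)) \<and> Lfun p \<delta> (sqrt (real n)) \<le> exp s * Lnat p \<delta> j) sequentially"
proof -
  \<comment> \<open>The factor 1/sqrt c is the spread of j around sqrt n, and the 2 covers the
    replacement of sqrt n by the neighbouring integers used for interpolation.\<close>
  define \<rho> where "\<rho> = 2 / sqrt c"
  have sc: "0 < sqrt c" "sqrt c < 1" using c by auto
  have \<rho>: "\<rho> > 0" using sc by (simp add: \<rho>_def)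
  obtain x0 where x0: "\<And>i j. x0 \<le> i \<Longrightarrow> x0 \<le> j \<Longrightarrow> real j \<le> \<rho> * real i \<Longrightarrow> real i \<le> \<rho> * real j \<Longrightarrow>
    Lnat p \<delta> j \<le> exp s * Lnat p \<delta> i"
    using Lnat_ratio[OF s \<rho>] by blast
  show ?thesis
    using eventually_ge_real[of "4"] eventually_ge_real[of "(real x0 + 1)\<^sup>2 / c"]
  proof eventually_elim
    case (elim n)
    define t where "t = sqrt (real n)"
    have t: "t \<ge> 2" using real_sqrt_le_mono[OF elim(1)] by (simp add: t_def)
    have "(real x0 + 1)\<^sup>2 \<le> c * real n" using elim(2) c by (simp add: field_simps)
    then have "real x0 + 1 \<le> sqrt (c * real n)" by (intro real_le_rsqrt) simp
    then have tx: "real x0 + 1 \<le> sqrt c * t" by (simp add: real_sqrt_mult t_def)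
    have ct: "sqrt c * t \<le> 1 * t" using sc t by (intro mult_right_mono) auto
    show ?case
    proof (intro allI impI, elim conjE)
      fix j assume j: "c * real n \<le> (real j)\<^sup>2" "(real j)\<^sup>2 \<le> real n / c"
      have j1: "sqrt c * t \<le> real j"
        using real_sqrt_le_mono[OF j(1)] by (simp add: real_sqrt_mult t_def)
      have "real j \<le> t / sqrt c"
        using real_sqrt_le_mono[OF j(2)] by (simp add: real_sqrt_divide t_def)
      then have j2: "real j * sqrt c \<le> t" using sc by (simp add: pos_le_divide_eq)
      have near: "Lnat p \<delta> m \<le> exp s * Lnat p \<delta> j" "Lnat p \<delta> j \<le> exp s * Lnat p \<delta> m"
        if m: "t - 1 \<le> real m" "real m \<le> t + 1" for m
      proof -
        have m2: "t / 2 \<le> real m" "real m \<le> 2 * t" using m t by linarith+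
        have "x0 \<le> m" "x0 \<le> j" using tx ct m j1 by linarith+
        moreover have "real j \<le> \<rho> * real m"
        proof -
          have "real j \<le> t / sqrt c" by fact
          also have "\<dots> = \<rho> * (t / 2)" by (simp add: \<rho>_def)
          also have "\<dots> \<le> \<rho> * real m" using m2 \<rho> by (intro mult_left_mono) auto
          finally show ?thesis .
        qed
        moreover have "real m \<le> \<rho> * real j"
        proof -
          have "real m \<le> \<rho> * (sqrt c * t)" using m2 sc by (simp add: \<rho>_def)
          also have "\<dots> \<le> \<rho> * real j" using j1 \<rho> by (intro mult_left_mono) auto
          finally show ?thesis .
        qed
        ultimately show "Lnat p \<delta> m \<le> exp s * Lnat p \<delta> j" "Lnat p \<delta> j \<le> exp s * Lnat p \<delta> m"
          using x0 by auto
      qed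
      define m where "m = nat \<lfloor>t\<rfloor>"
      have m: "t - 1 \<le> real m" "real m \<le> t + 1" "t - 1 \<le> real (m + 1)" "real (m + 1) \<le> t + 1"
        using t unfolding m_def by linarith+
      have lo: "exp (- s) * Lnat p \<delta> j \<le> Lnat p \<delta> i" if "Lnat p \<delta> j \<le> exp s * Lnat p \<delta> i" for i
        using that by (simp add: exp_minus field_simps)
      show "exp (- s) * Lnat p \<delta> j \<le> Lfun p \<delta> (sqrt (real n)) \<and> Lfun p \<delta> (sqrt (real n)) \<le> exp s * Lnat p \<delta> j"
        unfolding t_def[symmetric] using t near[OF m(1,2)] near[OF m(3,4)] lo
        by (intro conjI Lfun_bounds[where A = "exp (- s) * Lnat p \<delta> j" and B = "exp s * Lnat p \<delta> j"])
          (auto simp: m_def)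
    qed
  qed
qed

end

locale bessel_walk_lam = bessel_walk +
  fixes K0 :: real
  assumes K0: "K0 > 0"
    and lam_asymp: "(\<lambda>x. lam p x) \<sim>[at_top] (\<lambda>x. K0 * real x powr \<delta> / Lnat p \<delta> x)"
begin

lemma p_tendsto: "p \<longlonglongrightarrow> 1 / 2"
proof -
  have "(\<lambda>x. (1 + (real x * (2 * p x - 1)) * (1 / real x)) / 2) \<longlonglongrightarrow> (1 + (- \<delta> / 2) * 0) / 2"
    by (intro tendsto_intros drift lim_1_over_n) simp
  then have "(\<lambda>x. (1 + (real x * (2 * p x - 1)) * (1 / real x)) / 2) \<longlonglongrightarrow> 1 / 2" by simp
  then show ?thesis
  proof (rule Lim_transform_eventually)
    show "eventually (\<lambda>x. (1 + (real x * (2 * p x - 1)) * (1 / real x)) / 2 = p x) sequentially"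
      by (rule eventually_sequentiallyI[of 1]) (simp add: field_simps)
  qed
qed

text \<open>The 2 in the denominator stems from p tending to 1/2 in 1/(p \<lambda>).\<close>

lemma rev_meas_asymp: "(\<lambda>x. rev_meas p x * (K0 * real x powr \<delta> / (2 * Lnat p \<delta> x))) \<longlonglongrightarrow> 1"
proof -
  have "(\<lambda>x. if lam p x = 0 \<and> K0 * real x powr \<delta> / Lnat p \<delta> x = 0 then 1 else lam p x / (K0 * real x powr \<delta> / Lnat p \<delta> x)) \<longlonglongrightarrow> 1"
    using lam_asymp by (simp add: asymp_equiv_def)
  then have "(\<lambda>x. lam p x / (K0 * real x powr \<delta> / Lnat p \<delta> x)) \<longlonglongrightarrow> 1"
    using less_imp_neq[OF lam_pos] by auto
  from tendsto_inverse[OF this]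
  have 1: "(\<lambda>x. inverse (lam p x / (K0 * real x powr \<delta> / Lnat p \<delta> x))) \<longlonglongrightarrow> 1" by simp
  have 2: "(\<lambda>x. 1 / (2 * p x)) \<longlonglongrightarrow> 1 / (2 * (1 / 2))"
    by (intro tendsto_intros p_tendsto) auto
  have "(\<lambda>x. inverse (lam p x / (K0 * real x powr \<delta> / Lnat p \<delta> x)) * (1 / (2 * p x))) \<longlonglongrightarrow> 1"
    using tendsto_mult[OF 1 2] by simp
  then show ?thesis
  proof (rule Lim_transform_eventually)
    show "eventually (\<lambda>x. inverse (lam p x / (K0 * real x powr \<delta> / Lnat p \<delta> x)) * (1 / (2 * p x))
      = rev_meas p x * (K0 * real x powr \<delta> / (2 * Lnat p \<delta> x))) sequentially"
      by (rule eventually_sequentiallyI[of 1]) (simp add: rev_meas_def field_simps)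
  qed
qed

text \<open>For x of order sqrt n the slowly varying L may be frozen at sqrt n; the reversible
  measure is then close to this constant times x^(-\<delta>).\<close>

definition mass_scale :: "nat \<Rightarrow> real" where
  "mass_scale n = 2 * Lfun p \<delta> (sqrt (real n)) / K0"

lemma rev_meas_scale:
  assumes s: "s > 0" and c: "0 < c" "c < 1"
  shows "eventually (\<lambda>n. 0 < mass_scale n \<and> (\<forall>j. c * real n \<le> (real j)\<^sup>2 \<and> (real j)\<^sup>2 \<le> real n / c \<longrightarrow>
    exp (- s) * (mass_scale n * real j powr (- \<delta>)) \<le> rev_meas p j \<and>
    rev_meas p j \<le> exp s * (mass_scale n * real j powr (- \<delta>)))) sequentially"
proof -
  have "eventually (\<lambda>x. rev_meas p x * (K0 * real x powr \<delta> / (2 * Lnat p \<delta> x)) < exp (s / 2)) sequentially"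
    by (rule order_tendstoD(2)[OF rev_meas_asymp]) (use s in simp)
  moreover have "eventually (\<lambda>x. exp (- (s / 2)) < rev_meas p x * (K0 * real x powr \<delta> / (2 * Lnat p \<delta> x))) sequentially"
    by (rule order_tendstoD(1)[OF rev_meas_asymp]) (use s in simp)
  ultimately have "eventually (\<lambda>x. rev_meas p x * (K0 * real x powr \<delta> / (2 * Lnat p \<delta> x)) < exp (s / 2)
      \<and> exp (- (s / 2)) < rev_meas p x * (K0 * real x powr \<delta> / (2 * Lnat p \<delta> x))) sequentially"
    by (rule eventually_conj)
  then obtain x0 where x0: "\<And>x. x \<ge> x0 \<Longrightarrow> rev_meas p x * (K0 * real x powr \<delta> / (2 * Lnat p \<delta> x)) < exp (s / 2)"
      "\<And>x. x \<ge> x0 \<Longrightarrow> exp (- (s / 2)) < rev_meas p x * (K0 * real x powr \<delta> / (2 * Lnat p \<delta> x))"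
    by (auto simp: eventually_sequentially)
  have "s / 2 > 0" using s by simp
  from Lfun_sqrt_ratio[OF this c] eventually_ge_real[of "(real x0 + 1)\<^sup>2 / c"] eventually_ge_real[of 1]
  show ?thesis
  proof eventually_elim
    case (elim n)
    have xn: "(real x0 + 1)\<^sup>2 \<le> c * real n" using elim(2) c by (simp add: field_simps)
    have pos: "0 < mass_scale n"
    proof -
      define t where "t = sqrt (real n)"
      have "0 < min (Lnat p \<delta> (nat \<lfloor>t\<rfloor>)) (Lnat p \<delta> (nat \<lfloor>t\<rfloor> + 1))" by (simp add: Lnat_pos)
      also have "\<dots> \<le> Lfun p \<delta> t"
        by (rule Lfun_bounds(1)[where B = "max (Lnat p \<delta> (nat \<lfloor>t\<rfloor>)) (Lnat p \<delta> (nat \<lfloor>t\<rfloor> + 1))"]) (auto simp: t_def)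
      finally show ?thesis using K0 by (simp add: mass_scale_def t_def)
    qed
    moreover have "exp (- s) * (mass_scale n * real j powr (- \<delta>)) \<le> rev_meas p j \<and>
      rev_meas p j \<le> exp s * (mass_scale n * real j powr (- \<delta>))"
      if j: "c * real n \<le> (real j)\<^sup>2" "(real j)\<^sup>2 \<le> real n / c" for j
    proof -
      have "(real x0 + 1)\<^sup>2 \<le> (real j)\<^sup>2" using xn j by linarith
      then have jx: "real x0 + 1 \<le> real j" by (rule power2_le_imp_le) simp
      then have jx0: "j \<ge> x0" and j0: "real j > 0" by auto
      define l where "l = Lnat p \<delta> j"
      define W where "W = real j powr \<delta>"
      define M where "M = Lfun p \<delta> (sqrt (real n))"
      have l: "l > 0" and W: "W > 0" using j0 by (simp_all add: l_def W_def Lnat_pos)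
      have A: "rev_meas p j \<le> exp (s / 2) * (2 * l / (K0 * W))" "exp (- (s / 2)) * (2 * l / (K0 * W)) \<le> rev_meas p j"
        using x0[OF jx0] l W K0 by (simp_all add: l_def[symmetric] W_def[symmetric] field_simps)
      have B: "exp (- (s / 2)) * l \<le> M" "M \<le> exp (s / 2) * l"
        using elim(1) j by (auto simp: l_def M_def)
      have B': "l \<le> exp (s / 2) * M" "exp (- (s / 2)) * M \<le> l"
        using B by (simp_all add: exp_minus field_simps)
      have e: "mass_scale n * real j powr (- \<delta>) = 2 * M / (K0 * W)"
        by (simp add: mass_scale_def M_def W_def powr_minus field_simps)
      have ee: "exp s = exp (s / 2) * exp (s / 2)" "exp (- s) = exp (- (s / 2)) * exp (- (s / 2))"
        by (simp_all flip: exp_add)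
      have "2 * l / (K0 * W) \<le> 2 * (exp (s / 2) * M) / (K0 * W)"
        using B' K0 W by (intro divide_right_mono mult_left_mono) auto
      then have "exp (s / 2) * (2 * l / (K0 * W)) \<le> exp (s / 2) * (2 * (exp (s / 2) * M) / (K0 * W))"
        by (intro mult_left_mono) auto
      also have "\<dots> = exp s * (2 * M / (K0 * W))" unfolding ee by simp
      finally have up: "rev_meas p j \<le> exp s * (2 * M / (K0 * W))" using A(1) by linarith
      have "2 * (exp (- (s / 2)) * M) / (K0 * W) \<le> 2 * l / (K0 * W)"
        using B' K0 W by (intro divide_right_mono mult_left_mono) auto
      then have "exp (- (s / 2)) * (2 * (exp (- (s / 2)) * M) / (K0 * W)) \<le> exp (- (s / 2)) * (2 * l / (K0 * W))"
        by (intro mult_left_mono) auto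
      moreover have "exp (- (s / 2)) * (2 * (exp (- (s / 2)) * M) / (K0 * W)) = exp (- s) * (2 * M / (K0 * W))"
        unfolding ee by simp
      ultimately show ?thesis unfolding e using up A(2) by linarith
    qed
    ultimately show ?case by blast
  qed
qed

end

context bessel_walk
begin

lemma scaled_tail_diff:
  assumes n: "n > 0" and xy: "0 \<le> x" "x \<le> y"
  shows "scaled_tail n (x\<^sup>2 / (2 * real n)) - scaled_tail n (y\<^sup>2 / (2 * real n))
    = expect p n (\<lambda>j. if x < real j \<and> real j \<le> y then 1 else 0) 0"
proof -
  have "scaled_tail n (x\<^sup>2 / (2 * real n)) - scaled_tail n (y\<^sup>2 / (2 * real n)) =
    expect p n (\<lambda>j. (if x\<^sup>2 / (2 * real n) < (real j)\<^sup>2 / (2 * real n) then 1 else 0)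
      - (if y\<^sup>2 / (2 * real n) < (real j)\<^sup>2 / (2 * real n) then 1 else 0)) 0"
    by (simp only: scaled_tail_def expect_diff)
  also have "\<dots> = expect p n (\<lambda>j. if x < real j \<and> real j \<le> y then 1 else 0) 0"
  proof (rule expect_cong)
    fix j
    have lt: "z\<^sup>2 / (2 * real n) < (real j)\<^sup>2 / (2 * real n) \<longleftrightarrow> z < real j" if "0 \<le> z" for z
    proof -
      have "z\<^sup>2 < (real j)\<^sup>2 \<longleftrightarrow> z < real j"
        using that power2_less_imp_less[of z "real j"] power_strict_mono[of z "real j" 2] by auto
      then show ?thesis using n by (simp add: divide_less_cancel)
    qed
    show "(if x\<^sup>2 / (2 * real n) < (real j)\<^sup>2 / (2 * real n) then 1 else 0)
      - (if y\<^sup>2 / (2 * real n) < (real j)\<^sup>2 / (2 * real n) then 1 else 0) = (if x < real j \<and> real j \<le> y then 1 else (0::real))"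
      using lt[of x] lt[of y] xy by auto
  qed
  finally show ?thesis .
qed

text \<open>\<^term>\<open>ret n\<close> decreases along a parity class, so its value at the end of a window is controlled
  by the mass of the window.\<close>
lemma window_lower:
  assumes \<rho>: "\<rho> > 1" and k: "k > 0" "even (n + k)" and n: "n > 0"
    and B: "\<And>j. real k \<le> real j \<Longrightarrow> real j \<le> \<rho> * real k \<Longrightarrow> rev_meas p j \<le> B"
  shows "scaled_tail n ((real k)\<^sup>2 / (2 * real n)) - scaled_tail n ((\<rho> * real k)\<^sup>2 / (2 * real n))
    \<le> ret n k * ((\<rho> - 1) * real k / 2 * B)"
proof -
  define A where "A = {j. real k < real j \<and> real j \<le> \<rho> * real k}"
  have "A \<subseteq> {..nat \<lceil>\<rho> * real k\<rceil>}" by (auto simp: A_def le_nat_iff) linarith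
  then have fin: "finite A" by (rule finite_subset) simp
  define A' where "A' = {j\<in>A. even (n + j)}"
  have fin': "finite A'" using fin by (simp add: A'_def)
  have B0: "0 \<le> B"
  proof -
    have "real k \<le> \<rho> * real k" using \<rho> by (simp add: mult_le_cancel_right1)
    then show ?thesis using B[of k] rev_meas_pos[of k] by linarith
  qed
  \<comment> \<open>Half the window length, because only states of the parity class of k carry mass
    at time n.\<close>
  have card: "real (card A') \<le> (\<rho> - 1) * real k / 2"
  proof -
    define m where "m = nat \<lfloor>(\<rho> - 1) * real k / 2\<rfloor>"
    have "A' \<subseteq> (\<lambda>i. k + 2 * i) ` {1..m}"
    proof
      fix j assume j: "j \<in> A'"
      then have "k < j" "even (j - k)" using k by (auto simp: A'_def A_def)
      then obtain i where i: "j - k = 2 * i" by (elim evenE)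
      have ji: "j = k + 2 * i" using i \<open>k < j\<close> by simp
      have "real i \<le> (\<rho> - 1) * real k / 2" using j by (simp add: A'_def A_def ji algebra_simps)
      then have "i \<le> m" unfolding m_def by (simp add: le_nat_floor)
      moreover have "i \<ge> 1" using ji \<open>k < j\<close> by simp
      ultimately show "j \<in> (\<lambda>i. k + 2 * i) ` {1..m}" using ji by auto
    qed
    then have "card A' \<le> card ((\<lambda>i. k + 2 * i) ` {1..m})" by (intro card_mono) auto
    also have "\<dots> \<le> card {1..m}" by (rule card_image_le) simp
    finally have "real (card A') \<le> real m" by simp
    also have "\<dots> \<le> (\<rho> - 1) * real k / 2" using \<rho> unfolding m_def by (intro of_nat_floor) auto
    finally show ?thesis .
  qed
  have "scaled_tail n ((real k)\<^sup>2 / (2 * real n)) - scaled_tail n ((\<rho> * real k)\<^sup>2 / (2 * real n))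
    = expect p n (\<lambda>j. if real k < real j \<and> real j \<le> \<rho> * real k then 1 else 0) 0"
    by (rule scaled_tail_diff[OF n]) (use \<rho> in \<open>simp_all add: mult_le_cancel_right1\<close>)
  also have "\<dots> = expect p n (\<lambda>j. if j \<in> A then 1 else 0) 0" by (simp add: A_def)
  also have "\<dots> = (\<Sum>j\<in>A'. rev_meas p j * ret n j)"
    unfolding A'_def by (rule expect_ind_eq_sum[OF fin])
  also have "\<dots> \<le> (\<Sum>j\<in>A'. B * ret n k)"
  proof (rule sum_mono)
    fix j assume j: "j \<in> A'"
    then have "k \<le> j" "even (j - k)" using k by (auto simp: A'_def A_def)
    then have "ret n j \<le> ret n k" by (rule ret_antimono)
    then show "rev_meas p j * ret n j \<le> B * ret n k"
      using j B0 by (intro mult_mono B ret_nonneg) (auto simp: A'_def A_def)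
  qed
  also have "\<dots> = real (card A') * (B * ret n k)" by simp
  also have "\<dots> \<le> (\<rho> - 1) * real k / 2 * (B * ret n k)"
    using card B0 by (intro mult_right_mono mult_nonneg_nonneg ret_nonneg) auto
  finally show ?thesis by (simp only: mult_ac)
qed

text \<open>The mirror image of \<open>window_lower\<close>: the window ends at k, and on it
  \<open>ret n\<close> is at least its value at k. The states k - 2 i with i below the rounded-up
  half length supply enough terms.\<close>

lemma window_upper:
  assumes \<rho>: "0 \<le> \<rho>" "\<rho> < 1" and k: "even (n + k)"
    and B: "0 \<le> B" "\<And>j. \<rho> * real k < real j \<Longrightarrow> j \<le> k \<Longrightarrow> B \<le> rev_meas p j"
  shows "ret n k * ((1 - \<rho>) * real k / 2 * B) \<le> expect p n (\<lambda>j. if \<rho> * real k < real j \<and> real j \<le> real k then 1 else 0) 0"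
proof -
  define A where "A = {j. \<rho> * real k < real j \<and> j \<le> k}"
  have "A \<subseteq> {..k}" by (auto simp: A_def)
  then have fin: "finite A" by (rule finite_subset) simp
  define m where "m = nat \<lceil>(1 - \<rho>) * real k / 2\<rceil>"
  have m: "(1 - \<rho>) * real k / 2 \<le> real m" unfolding m_def by (rule real_nat_ceiling_ge)
  have lt: "real i < (1 - \<rho>) * real k / 2" if "i < m" for i
    using that unfolding m_def by linarith
  have ik: "2 * i \<le> k \<and> k - 2 * i \<in> A" if "i < m" for i
  proof -
    have "2 * real i < (1 - \<rho>) * real k" using lt[OF that] by linarith
    also have "\<dots> \<le> 1 * real k" using \<rho> by (intro mult_right_mono) auto
    finally have "2 * i < k" by linarith
    moreover have "\<rho> * real k < real k - 2 * real i"
      using \<open>2 * real i < (1 - \<rho>) * real k\<close> by (simp add: algebra_simps)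
    ultimately show ?thesis by (simp add: A_def of_nat_diff)
  qed
  have "ret n k * ((1 - \<rho>) * real k / 2 * B) \<le> ret n k * (real m * B)"
    using m B by (intro mult_left_mono mult_right_mono ret_nonneg) auto
  also have "\<dots> = (\<Sum>i<m. B * ret n k)" by simp
  also have "\<dots> \<le> (\<Sum>i<m. rev_meas p (k - 2 * i) * ret n (k - 2 * i))"
  proof (rule sum_mono)
    fix i assume "i \<in> {..<m}"
    then have i: "2 * i \<le> k" "k - 2 * i \<in> A" using ik by auto
    have "ret n k \<le> ret n (k - 2 * i)" by (rule ret_antimono) (use i in auto)
    then show "B * ret n k \<le> rev_meas p (k - 2 * i) * ret n (k - 2 * i)"
      using i B by (intro mult_mono) (auto simp: A_def ret_nonneg less_imp_le rev_meas_pos)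
  qed
  also have "\<dots> = (\<Sum>j\<in>(\<lambda>i. k - 2 * i) ` {..<m}. rev_meas p j * ret n j)"
  proof (subst sum.reindex)
    show "inj_on (\<lambda>i. k - 2 * i) {..<m}"
    proof (rule inj_onI)
      fix i j assume "i \<in> {..<m}" "j \<in> {..<m}" "k - 2 * i = k - 2 * j"
      then show "i = j" using ik[of i] ik[of j] by auto
    qed
  qed simp
  also have "\<dots> \<le> (\<Sum>j\<in>A. rev_meas p j * ret n j)"
    by (rule sum_mono2) (use fin ik in \<open>auto simp: ret_nonneg less_imp_le rev_meas_pos\<close>)
  also have "\<dots> \<le> expect p n (\<lambda>j. if j \<in> A then 1 else 0) 0" by (rule rev_meas_sum_ret_le[OF fin])
  finally show ?thesis by (simp add: A_def)
qed

end

context bessel_walk_lam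
begin

definition local_density :: "nat \<Rightarrow> nat \<Rightarrow> real" where
  "local_density n k = 2 powr \<kappa> * K0 / Gamma (1 - \<kappa>) * real n powr (- (1 - \<kappa>)) / Lfun p \<delta> (sqrt (real n))
     * exp (- (real k)\<^sup>2 / (2 * real n))"

text \<open>The right-hand side is window mass over window measure. For k widened by a factor \<rho>
  near 1, y is widened by \<rho>^2, so the mass is about 2 (\<rho> - 1) y^a exp(-y)/Gamma(a); the
  window holds (\<rho> - 1) k/2 states of the right parity, each of measure
  \<open>mass_scale n\<close> times k^(-\<delta>). The quotient gives the 4.\<close>

lemma local_density_eq:
  assumes "n > 0" "k > 0" "0 < mass_scale n"
  defines "y \<equiv> (real k)\<^sup>2 / (2 * real n)" and "a \<equiv> 1 - \<kappa>"
  shows "local_density n k = 4 * (y powr a * exp (- y) / Gamma a) / (mass_scale n * real k powr (1 - \<delta>))"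
proof -
  have "(1 - \<delta>) = a + a" by (simp add: a_def \<kappa>_def field_simps)
  then have k2: "real k powr (1 - \<delta>) = (real k)\<^sup>2 powr a"
    by (simp only: powr_add powr_mult power2_eq_square)
  have "y powr a = (real k)\<^sup>2 powr a / (2 * real n) powr a"
    unfolding y_def by (rule powr_divide)
  also have "\<dots> = (real k)\<^sup>2 powr a * (2 powr (- a) * real n powr (- a))"
    by (simp add: powr_mult powr_minus field_simps)
  finally have ya: "y powr a = (real k)\<^sup>2 powr a * (2 powr (- a) * real n powr (- a))" .
  have "\<kappa> = 1 + (- a)" by (simp add: a_def)
  then have two: "2 powr \<kappa> = 2 * 2 powr (- a)" using powr_add[of 2 1 "- a"] by simp
  have L: "Lfun p \<delta> (sqrt (real n)) = mass_scale n * K0 / 2" using K0 by (simp add: mass_scale_def)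
  have kp: "(real k)\<^sup>2 powr a > 0" using assms by simp
  have "4 * (y powr a * exp (- y) / Gamma a) / (mass_scale n * real k powr (1 - \<delta>))
    = 4 * (2 powr (- a) * real n powr (- a)) * exp (- y) / Gamma a / mass_scale n"
    unfolding k2 ya using kp by simp
  also have "\<dots> = local_density n k"
    unfolding local_density_def two L a_def[symmetric] using K0 assms(3)
    by (simp add: y_def)
  finally show ?thesis by simp
qed

end

lemma powr_ratio_bounds:
  fixes x \<rho> d :: real
  assumes "\<rho> > 1" "1 / \<rho> \<le> x" "x \<le> \<rho>"
  shows "\<rho> powr (- \<bar>d\<bar>) \<le> x powr d" "x powr d \<le> \<rho> powr \<bar>d\<bar>"
proof -
  have x: "x > 0" using assms by (meson divide_pos_pos less_le_trans less_trans zero_less_one)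
  have "ln (1 / \<rho>) \<le> ln x" "ln x \<le> ln \<rho>" using assms x by (subst ln_le_cancel_iff; simp)+
  then have "\<bar>ln x\<bar> \<le> ln \<rho>" using assms by (simp add: ln_div abs_le_iff)
  then have "\<bar>d\<bar> * \<bar>ln x\<bar> \<le> \<bar>d\<bar> * ln \<rho>" by (intro mult_left_mono) auto
  then have "\<bar>d * ln x\<bar> \<le> \<bar>d\<bar> * ln \<rho>" by (simp add: abs_mult)
  then have "- (\<bar>d\<bar> * ln \<rho>) \<le> d * ln x" "d * ln x \<le> \<bar>d\<bar> * ln \<rho>" by (simp_all only: abs_le_iff minus_le_iff)
  then show "\<rho> powr (- \<bar>d\<bar>) \<le> x powr d" "x powr d \<le> \<rho> powr \<bar>d\<bar>"
    using assms x by (simp_all add: powr_def)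
qed

text \<open>Every distortion caused by a window of ratio \<rho> is continuous in \<rho> and equals 1
  at \<rho> = 1, so a sufficiently narrow window exists.\<close>

lemma window_ratio_exists:
  fixes \<alpha> \<beta> b \<theta> :: real
  assumes "\<theta> > 0"
  obtains \<rho> where "\<rho> > 1" "\<rho>\<^sup>2 \<le> 2"
    "1 - \<theta> \<le> (\<rho> + 1) / 2 * \<rho>\<^sup>2 powr (- \<alpha>) * exp (- (\<rho>\<^sup>2 - 1) * b) * \<rho> powr (- \<beta>)"
    "\<rho> * (\<rho> + 1) / 2 * \<rho>\<^sup>2 powr \<alpha> * exp ((\<rho>\<^sup>2 - 1) * b) * \<rho> powr \<beta> \<le> 1 + \<theta>"
proof -
  let ?l = "\<lambda>\<rho>::real. (\<rho> + 1) / 2 * \<rho>\<^sup>2 powr (- \<alpha>) * exp (- (\<rho>\<^sup>2 - 1) * b) * \<rho> powr (- \<beta>)"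
  let ?u = "\<lambda>\<rho>::real. \<rho> * (\<rho> + 1) / 2 * \<rho>\<^sup>2 powr \<alpha> * exp ((\<rho>\<^sup>2 - 1) * b) * \<rho> powr \<beta>"
  have "(?l \<longlongrightarrow> ?l 1) (at_right 1)" by (intro tendsto_intros) auto
  then have 1: "eventually (\<lambda>\<rho>. 1 - \<theta> < ?l \<rho>) (at_right 1)"
    by (rule order_tendstoD(1)) (use assms in simp)
  have "(?u \<longlongrightarrow> ?u 1) (at_right 1)" by (intro tendsto_intros) auto
  then have 2: "eventually (\<lambda>\<rho>. ?u \<rho> < 1 + \<theta>) (at_right 1)"
    by (rule order_tendstoD(2)) (use assms in simp)
  have "((\<lambda>\<rho>::real. \<rho>\<^sup>2) \<longlongrightarrow> 1\<^sup>2) (at_right 1)" by (intro tendsto_intros)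
  then have 3: "eventually (\<lambda>\<rho>::real. \<rho>\<^sup>2 < 2) (at_right 1)" by (rule order_tendstoD(2)) simp
  have 4: "eventually (\<lambda>\<rho>::real. 1 < \<rho>) (at_right 1)" by (rule eventually_at_right_less)
  from eventually_happens'[OF _ eventually_conj[OF eventually_conj[OF 1 2] eventually_conj[OF 3 4]]]
  obtain \<rho> where "1 - \<theta> < ?l \<rho>" "?u \<rho> < 1 + \<theta>" "\<rho>\<^sup>2 < 2" "1 < \<rho>" by auto
  then show ?thesis using that[of \<rho>] by simp
qed

context bessel_walk_lam
begin

text \<open>The window ratio \<rho> is fixed first, so the window keeps a positive limiting mass;
  afterwards the uniform error of the limit law is taken small against that mass. Errors \<theta>/3
  from the distortion and \<theta>/6 from the limit law leave \<theta>/4 for the reversible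
  measure.\<close>

lemma local_limit:
  assumes \<delta>: "\<delta> < 1" and c: "0 < c" "c < 1" and \<theta>: "0 < \<theta>" "\<theta> \<le> 1"
  shows "eventually (\<lambda>n. \<forall>k. c * real n \<le> (real k)\<^sup>2 \<and> (real k)\<^sup>2 \<le> real n / c \<and> even (n + k) \<longrightarrow>
    (1 - \<theta>) * local_density n k \<le> ret n k \<and> ret n k \<le> (1 + \<theta>) * local_density n k) sequentially"
proof -
  define a where "a = 1 - \<kappa>"
  have a: "a > 0" "a = (1 - \<delta>) / 2" using \<delta> by (simp_all add: a_def \<kappa>_def field_simps)
  define b where "b = 1 / (2 * c)"
  have b: "b > 0" using c by (simp add: b_def)
  have G: "Gamma a > 0" using a by simp
  have "\<theta> / 3 > 0" using \<theta> by simp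
  then obtain \<rho> where \<rho>: "\<rho> > 1" "\<rho>\<^sup>2 \<le> 2"
    and low: "1 - \<theta> / 3 \<le> (\<rho> + 1) / 2 * \<rho>\<^sup>2 powr (- \<bar>a - 1\<bar>) * exp (- (\<rho>\<^sup>2 - 1) * b) * \<rho> powr (- \<bar>\<delta>\<bar>)"
    and upp: "\<rho> * (\<rho> + 1) / 2 * \<rho>\<^sup>2 powr \<bar>a - 1\<bar> * exp ((\<rho>\<^sup>2 - 1) * b) * \<rho> powr \<bar>\<delta>\<bar> \<le> 1 + \<theta> / 3"
    by (rule window_ratio_exists)
  define r where "r = \<rho>\<^sup>2"
  define R where "R = \<rho> powr \<bar>\<delta>\<bar>"
  have r: "r > 1" "r \<le> 2" "r - 1 = (\<rho> - 1) * (\<rho> + 1)"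
    using \<rho> one_less_power[of \<rho> 2] by (simp_all add: r_def) (simp add: power2_eq_square algebra_simps)
  have R: "R \<ge> 1" "\<rho> powr (- \<bar>\<delta>\<bar>) = 1 / R" using \<rho> by (simp_all add: R_def powr_minus field_simps ge_one_powr_ge_zero)
  define Lw where "Lw = r powr (- \<bar>a - 1\<bar>) * exp (- (r - 1) * b)"
  define Up where "Up = r powr \<bar>a - 1\<bar> * exp ((r - 1) * b)"
  have low': "(1 - \<theta> / 3) * R \<le> (\<rho> + 1) / 2 * Lw"
    using low R by (simp add: Lw_def r_def[symmetric] field_simps)
  have upp': "\<rho> * (\<rho> + 1) / 2 * Up * R \<le> 1 + \<theta> / 3"
    using upp by (simp add: Up_def r_def[symmetric] R_def[symmetric] mult_ac)
  define D0 where "D0 = (c / 2) powr a * exp (- b) / Gamma a"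
  have D0: "D0 > 0" using c G by (simp add: D0_def)
  \<comment> \<open>\<open>D0\<close> bounds the density below over the whole range of k, and \<rho>
    - 1 is the order of the window mass; \<open>R\<close> and \<rho> compensate the distortion of
    the measure in the two one-sided windows.\<close>
  define \<epsilon> where "\<epsilon> = \<theta> / 6 * D0 * (\<rho> - 1) / (\<rho> * R)"
  have \<epsilon>: "\<epsilon> > 0" using \<theta> D0 \<rho> R by (simp add: \<epsilon>_def)
  have \<epsilon>': "\<epsilon> * (\<rho> * R) = \<theta> / 6 * D0 * (\<rho> - 1)" using \<rho> R by (simp add: \<epsilon>_def)
  define s where "s = ln (1 + \<theta> / 4)"
  have s: "s > 0" "exp s = 1 + \<theta> / 4" "exp (- s) = 1 / (1 + \<theta> / 4)"
    using \<theta> by (simp_all add: s_def exp_minus field_simps)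
  \<comment> \<open>The windows reach beyond the range of k by a factor \<rho> whose square is at
    most 2, so the measure is controlled on the range belonging to c/2.\<close>
  have "0 < c / 2" "c / 2 < 1" using c by auto
  from rev_meas_scale[OF s(1) this] scaled_tail_uniform[OF ret_tendsto_0[OF \<delta>] a(2,1) \<epsilon>] eventually_gt_at_top[of 0]
  show ?thesis
  proof eventually_elim
    case (elim n)
    define Q where "Q = mass_scale n"
    have Q: "Q > 0" using elim by (simp add: Q_def)
    have n: "n > 0" by fact
    show ?case
    proof (intro allI impI, elim conjE)
      fix k assume k: "c * real n \<le> (real k)\<^sup>2" "(real k)\<^sup>2 \<le> real n / c" "even (n + k)"
      have "0 < c * real n" using c n by simp
      then have "0 < (real k)\<^sup>2" using k(1) by linarith
      then have k0: "k > 0" by (cases k) auto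
      define y where "y = (real k)\<^sup>2 / (2 * real n)"
      have y: "c / 2 \<le> y" "y \<le> b" "y > 0"
        using k c n k0 by (simp_all add: y_def b_def field_simps)
      define D where "D = y powr a * exp (- y) / Gamma a"
      have D: "D0 \<le> D" unfolding D0_def D_def
        using y c a G by (intro divide_right_mono mult_mono powr_mono2) auto
      have D1: "D > 0" using D D0 by linarith
      define P where "P = real k powr (1 - \<delta>)"
      have P: "P > 0" "real k * real k powr (- \<delta>) = P"
        using k0 powr_add[of "real k" 1 "- \<delta>"] by (simp_all add: P_def)
      have LD: "local_density n k = 4 * D / (Q * P)"
        unfolding D_def Q_def P_def y_def a_def by (rule local_density_eq) (use n k0 Q in \<open>auto simp: Q_def\<close>)
      have st: "\<bar>scaled_tail n z - Gamma_up a z\<bar> \<le> \<epsilon>" if "z \<ge> 0" for z using elim that by blast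
      have meas: "exp (- s) * (Q * (real k powr (- \<delta>) / R)) \<le> rev_meas p j"
        "rev_meas p j \<le> exp s * (Q * (R * real k powr (- \<delta>)))"
        if j: "real k / \<rho> \<le> real j" "real j \<le> \<rho> * real k" for j
      proof -
        have j0: "real j > 0" using j(1) k0 \<rho> by (smt (verit) divide_pos_pos of_nat_0_less_iff)
        have "(real j)\<^sup>2 \<le> (\<rho> * real k)\<^sup>2" using j by (intro power_mono) auto
        also have "\<dots> \<le> 2 * (real k)\<^sup>2" using \<rho>(2) by (simp add: power_mult_distrib mult_right_mono)
        also have "\<dots> \<le> 2 * (real n / c)" using k(2) by (intro mult_left_mono) auto
        also have "\<dots> = real n / (c / 2)" by simp
        finally have j1: "(real j)\<^sup>2 \<le> real n / (c / 2)" .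
        have "(real k / \<rho>)\<^sup>2 \<le> (real j)\<^sup>2" using j \<rho> by (intro power_mono) auto
        moreover have "(real k)\<^sup>2 / 2 \<le> (real k / \<rho>)\<^sup>2"
          unfolding power_divide using \<rho> by (intro divide_left_mono) auto
        ultimately have j2: "c / 2 * real n \<le> (real j)\<^sup>2" using k(1) by simp
        have m: "exp (- s) * (Q * real j powr (- \<delta>)) \<le> rev_meas p j" "rev_meas p j \<le> exp s * (Q * real j powr (- \<delta>))"
          using elim(1) j1 j2 by (auto simp: Q_def)
        define x where "x = real j / real k"
        have x: "1 / \<rho> \<le> x" "x \<le> \<rho>" using j k0 \<rho> by (simp_all add: x_def field_simps)
        have jx: "real j powr (- \<delta>) = x powr (- \<delta>) * real k powr (- \<delta>)"
          using k0 by (simp add: x_def flip: powr_mult)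
        have xb: "1 / R \<le> x powr (- \<delta>)" "x powr (- \<delta>) \<le> R"
          using powr_ratio_bounds[OF \<rho>(1) x, of "- \<delta>"] R by (simp_all add: R_def)
        have "1 / R * real k powr (- \<delta>) \<le> real j powr (- \<delta>)" unfolding jx using xb by (intro mult_right_mono) auto
        then have "exp (- s) * (Q * (1 / R * real k powr (- \<delta>))) \<le> exp (- s) * (Q * real j powr (- \<delta>))"
          using Q by (intro mult_left_mono) auto
        then show "exp (- s) * (Q * (real k powr (- \<delta>) / R)) \<le> rev_meas p j" using m(1) by simp
        have "real j powr (- \<delta>) \<le> R * real k powr (- \<delta>)" unfolding jx using xb by (intro mult_right_mono) auto
        then have "exp s * (Q * real j powr (- \<delta>)) \<le> exp s * (Q * (R * real k powr (- \<delta>)))"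
          using Q by (intro mult_left_mono) auto
        then show "rev_meas p j \<le> exp s * (Q * (R * real k powr (- \<delta>)))" using m(2) by linarith
      qed
      have kr: "real k / \<rho> \<le> real k" "real k \<le> \<rho> * real k" using \<rho> k0 by (simp_all add: field_simps)
      have lower: "(1 - \<theta>) * local_density n k \<le> ret n k"
      proof -
        define X where "X = (\<rho> - 1) * real k / 2 * (exp s * (Q * (R * real k powr (- \<delta>))))"
        have X: "X = (\<rho> - 1) / 2 * (exp s * R) * (Q * P)" unfolding X_def P(2)[symmetric] by simp
        have X0: "X > 0" unfolding X using \<rho> R Q P by simp
        define S where "S = scaled_tail n y - scaled_tail n (r * y)"
        have ry: "(\<rho> * real k)\<^sup>2 / (2 * real n) = r * y" by (simp add: r_def y_def power_mult_distrib)
        have S: "S = scaled_tail n ((real k)\<^sup>2 / (2 * real n)) - scaled_tail n ((\<rho> * real k)\<^sup>2 / (2 * real n))"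
          unfolding S_def ry by (simp only: y_def)
        have S1: "S \<le> ret n k * X" unfolding S X_def
          by (rule window_lower[OF \<rho>(1) k0 k(3) n]) (use meas kr in \<open>auto intro: order_trans\<close>)
        have "(r - 1) * r powr (- \<bar>a - 1\<bar>) * exp (- (r - 1) * y) * D \<le> Gamma_up a y - Gamma_up a (r * y)"
          unfolding D_def by (rule Gamma_up_increment(1)) (use a y r in auto)
        moreover have "(r - 1) * Lw * D \<le> (r - 1) * r powr (- \<bar>a - 1\<bar>) * exp (- (r - 1) * y) * D"
        proof -
          have "exp (- (r - 1) * b) \<le> exp (- (r - 1) * y)" using r y by (simp add: mult_left_mono)
          then have "r powr (- \<bar>a - 1\<bar>) * exp (- (r - 1) * b) \<le> r powr (- \<bar>a - 1\<bar>) * exp (- (r - 1) * y)"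
            by (intro mult_left_mono) auto
          then have "(r - 1) * Lw \<le> (r - 1) * (r powr (- \<bar>a - 1\<bar>) * exp (- (r - 1) * y))"
            unfolding Lw_def using r by (intro mult_left_mono) auto
          then have "(r - 1) * Lw * D \<le> (r - 1) * (r powr (- \<bar>a - 1\<bar>) * exp (- (r - 1) * y)) * D"
            using D1 by (intro mult_right_mono) auto
          then show ?thesis by (simp only: mult.assoc)
        qed
        moreover have "Gamma_up a y - Gamma_up a (r * y) - 2 * \<epsilon> \<le> S"
          using st[of y] st[of "r * y"] y r unfolding S_def by auto
        ultimately have S2: "(r - 1) * Lw * D - 2 * \<epsilon> \<le> S" by linarith
        have "2 * \<epsilon> \<le> 2 * (\<rho> - 1) * D * R * (\<theta> / 6)"
        proof -
          have "\<epsilon> * 1 \<le> \<epsilon> * (\<rho> * R)" using \<epsilon> \<rho> R mult_mono[of 1 \<rho> 1 R] by (intro mult_left_mono) auto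
          also have "\<dots> = \<theta> / 6 * D0 * (\<rho> - 1)" by (rule \<epsilon>')
          also have "\<dots> \<le> \<theta> / 6 * D * (\<rho> - 1)" using D \<theta> \<rho> by (intro mult_right_mono mult_left_mono) auto
          also have "\<dots> * 1 \<le> \<theta> / 6 * D * (\<rho> - 1) * R" using R \<theta> D1 \<rho> by (intro mult_left_mono) auto
          finally show ?thesis by (simp add: algebra_simps)
        qed
        moreover have "2 * (\<rho> - 1) * D * ((1 - \<theta> / 3) * R) \<le> (r - 1) * Lw * D"
        proof -
          have "2 * (\<rho> - 1) * D * ((1 - \<theta> / 3) * R) \<le> 2 * (\<rho> - 1) * D * ((\<rho> + 1) / 2 * Lw)"
            using low' \<rho> D1 by (intro mult_left_mono) auto
          also have "\<dots> = (r - 1) * Lw * D" unfolding r(3) by simp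
          finally show ?thesis .
        qed
        ultimately have "2 * (\<rho> - 1) * D * ((1 - \<theta> / 3) * R) - 2 * (\<rho> - 1) * D * R * (\<theta> / 6) \<le> S"
          using S2 by linarith
        moreover have "2 * (\<rho> - 1) * D * ((1 - \<theta> / 3) * R) - 2 * (\<rho> - 1) * D * R * (\<theta> / 6)
            = (2 * (\<rho> - 1) * D * R) * (1 - \<theta> / 2)" by (simp add: algebra_simps)
        moreover have "(2 * (\<rho> - 1) * D * R) * (exp s * (1 - \<theta>)) \<le> (2 * (\<rho> - 1) * D * R) * (1 - \<theta> / 2)"
          using \<rho> D1 R \<theta> by (intro mult_left_mono) (auto simp: s(2) algebra_simps)
        moreover have "(1 - \<theta>) * local_density n k * X = (2 * (\<rho> - 1) * D * R) * (exp s * (1 - \<theta>))"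
          unfolding LD X using Q P by (simp add: field_simps)
        ultimately have "(1 - \<theta>) * local_density n k * X \<le> ret n k * X" using S1 by linarith
        then show ?thesis using X0 by (rule mult_right_le_imp_le)
      qed
      have upper: "ret n k \<le> (1 + \<theta>) * local_density n k"
      proof -
        define Y where "Y = (1 - 1 / \<rho>) * real k / 2 * (exp (- s) * (Q * (real k powr (- \<delta>) / R)))"
        have Y: "Y = (\<rho> - 1) / (2 * \<rho>) * (exp (- s) / R) * (Q * P)"
          unfolding Y_def P(2)[symmetric] using \<rho> R by (simp add: field_simps)
        have Y0: "Y > 0" unfolding Y using \<rho> R Q P by simp
        define S where "S = scaled_tail n (y / r) - scaled_tail n y"
        have yr: "(1 / \<rho> * real k)\<^sup>2 / (2 * real n) = y / r"
          by (simp add: r_def y_def power_mult_distrib power_divide)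
        have "ret n k * Y \<le> expect p n (\<lambda>j. if 1 / \<rho> * real k < real j \<and> real j \<le> real k then 1 else 0) 0"
          unfolding Y_def
        proof (rule window_upper[OF _ _ k(3)])
          show "0 \<le> exp (- s) * (Q * (real k powr (- \<delta>) / R))" using Q R by simp
          fix j assume "1 / \<rho> * real k < real j" "j \<le> k"
          then show "exp (- s) * (Q * (real k powr (- \<delta>) / R)) \<le> rev_meas p j"
            using kr by (intro meas(1)) auto
        qed (use \<rho> in auto)
        also have "\<dots> = scaled_tail n ((1 / \<rho> * real k)\<^sup>2 / (2 * real n)) - scaled_tail n ((real k)\<^sup>2 / (2 * real n))"
          by (rule scaled_tail_diff[symmetric, OF n]) (use kr \<rho> in auto)
        also have "\<dots> = S" by (simp only: yr S_def y_def)
        finally have S1: "ret n k * Y \<le> S" .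
        have rr: "r * (y / r) = y" using r by simp
        have "Gamma_up a (y / r) - Gamma_up a (r * (y / r)) \<le> (r - 1) * r powr \<bar>a - 1\<bar> * ((y / r) powr a * exp (- (y / r)) / Gamma a)"
          by (rule Gamma_up_increment(2)) (use a y r in auto)
        moreover have "(y / r) powr a * exp (- (y / r)) / Gamma a \<le> exp ((r - 1) * b) * D"
        proof -
          have "(y / r) powr a \<le> y powr a" using y r a by (intro powr_mono2) (auto simp: field_simps)
          moreover have "exp (- (y / r)) \<le> exp ((r - 1) * b) * exp (- y)"
          proof -
            have "1 - 1 / r \<le> r - 1"
            proof -
              have "0 \<le> (r - 1) * (r - 1) / r" using r(1) by simp
              also have "\<dots> = (r - 1) - (1 - 1 / r)" using r(1) by (simp add: field_simps)
              finally show ?thesis by simp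
            qed
            then have "(1 - 1 / r) * y \<le> (r - 1) * b" using y r b by (intro mult_mono) auto
            then have "- (y / r) \<le> (r - 1) * b + - y" by (simp add: algebra_simps)
            then show ?thesis unfolding exp_add[symmetric] by simp
          qed
          ultimately have "(y / r) powr a * exp (- (y / r)) \<le> y powr a * (exp ((r - 1) * b) * exp (- y))"
            by (intro mult_mono) auto
          then have "(y / r) powr a * exp (- (y / r)) / Gamma a \<le> y powr a * (exp ((r - 1) * b) * exp (- y)) / Gamma a"
            using G by (intro divide_right_mono) auto
          then show ?thesis by (simp add: D_def mult_ac)
        qed
        then have "(r - 1) * r powr \<bar>a - 1\<bar> * ((y / r) powr a * exp (- (y / r)) / Gamma a) \<le> (r - 1) * r powr \<bar>a - 1\<bar> * (exp ((r - 1) * b) * D)"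
          using r by (intro mult_left_mono) auto
        moreover have "(r - 1) * r powr \<bar>a - 1\<bar> * (exp ((r - 1) * b) * D) = (r - 1) * Up * D" by (simp only: Up_def mult.assoc)
        moreover have "S \<le> Gamma_up a (y / r) - Gamma_up a y + 2 * \<epsilon>"
          using st[of y] st[of "y / r"] y r unfolding S_def by auto
        ultimately have S2: "S \<le> (r - 1) * Up * D + 2 * \<epsilon>" unfolding rr by linarith
        define Z where "Z = 2 * (\<rho> - 1) / (\<rho> * R)"
        have Z0: "Z > 0" using \<rho> R by (simp add: Z_def)
        have "(r - 1) * Up * D = Z * ((\<rho> * (\<rho> + 1) / 2 * Up * R) * D)"
          using \<rho> R by (simp add: Z_def r(3) field_simps)
        also have "\<dots> \<le> Z * ((1 + \<theta> / 3) * D)" using Z0 upp' D1 by (intro mult_left_mono mult_right_mono) auto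
        finally have 1: "(r - 1) * Up * D \<le> Z * ((1 + \<theta> / 3) * D)" .
        have "2 * \<epsilon> = Z * (\<theta> / 6 * D0)" using \<rho> R by (simp add: Z_def \<epsilon>_def field_simps)
        also have "\<dots> \<le> Z * (\<theta> / 6 * D)" using Z0 D \<theta> by (intro mult_left_mono) auto
        finally have 2: "2 * \<epsilon> \<le> Z * (\<theta> / 6 * D)" .
        have "S \<le> Z * ((1 + \<theta> / 3) * D) + Z * (\<theta> / 6 * D)" using S2 1 2 by linarith
        also have "\<dots> = Z * D * (1 + \<theta> / 2)" by (simp add: algebra_simps)
        also have "\<dots> \<le> Z * D * ((1 + \<theta>) * exp (- s))"
        proof (rule mult_left_mono)
          have "\<theta> * \<theta> \<le> \<theta> * 1" using \<theta> by (intro mult_left_mono) auto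
          moreover have "(1 + \<theta> / 2) * (1 + \<theta> / 4) = 1 + 3 / 4 * \<theta> + (\<theta> * \<theta>) / 8"
            by (simp add: algebra_simps)
          ultimately have "(1 + \<theta> / 2) * (1 + \<theta> / 4) \<le> 1 + \<theta>" using \<theta>(1) by argo
          then show "1 + \<theta> / 2 \<le> (1 + \<theta>) * exp (- s)" using \<theta> unfolding s(3) by (simp add: pos_le_divide_eq)
        qed (use Z0 D1 in auto)
        also have "\<dots> = (1 + \<theta>) * local_density n k * Y"
          unfolding LD Y Z_def using Q P \<rho> R by (simp add: field_simps)
        finally have "ret n k * Y \<le> (1 + \<theta>) * local_density n k * Y" using S1 by linarith
        then show ?thesis using Y0 by (rule mult_right_le_imp_le)
      qed
      show "(1 - \<theta>) * local_density n k \<le> ret n k \<and> ret n k \<le> (1 + \<theta>) * local_density n k"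
        using lower upper by blast
    qed
  qed
qed

text \<open>States of order k may lie far beyond the range where \<open>mass_scale\<close> describes
  the measure. Monotonicity of j times the measure carries the lower bound from a state of order
  sqrt n to the window (3k/4, k]. Since only k^2 >= n is required, one K1 serves all \<chi> <
  1.\<close>

lemma local_tail:
  assumes \<delta>: "\<delta> < 1"
  shows "\<exists>K1. eventually (\<lambda>n. \<forall>k. real n \<le> (real k)\<^sup>2 \<and> even (n + k) \<longrightarrow>
    ret n k \<le> K1 * exp (- (real k)\<^sup>2 / (8 * real n)) * real n powr (- (1 - \<kappa>)) / Lfun p \<delta> (sqrt (real n))) sequentially"
proof -
  obtain C where "bounded_drift_walk p C" by (rule bounded_drift)
  then interpret bounded_drift_walk p C .
  define a where "a = 1 - \<kappa>"
  have a: "a > 0" "1 - \<delta> = 2 * a" using \<delta> by (simp_all add: a_def \<kappa>_def field_simps)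
  define K where "K = exp ((1 + 2 * C) / 2)"
  have K: "K > 0" by (simp add: K_def)
  obtain M where M: "M \<ge> 1" "\<And>j k. M \<le> j \<Longrightarrow> j \<le> k \<Longrightarrow> real j * rev_meas p j \<le> real k * rev_meas p k"
    using rev_meas_increasing[OF \<delta>] by blast
  define K1 where "K1 = 4 * K * exp 1 * K0 * 4 powr a"
  have "eventually (\<lambda>n. 0 < mass_scale n \<and> (\<forall>j. 1/4 * real n \<le> (real j)\<^sup>2 \<and> (real j)\<^sup>2 \<le> real n / (1/4) \<longrightarrow>
    exp (- 1) * (mass_scale n * real j powr (- \<delta>)) \<le> rev_meas p j \<and>
    rev_meas p j \<le> exp 1 * (mass_scale n * real j powr (- \<delta>)))) sequentially"
    by (rule rev_meas_scale) auto
  then have "eventually (\<lambda>n. \<forall>k. real n \<le> (real k)\<^sup>2 \<and> even (n + k) \<longrightarrow>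
    ret n k \<le> K1 * exp (- (real k)\<^sup>2 / (8 * real n)) * real n powr (- (1 - \<kappa>)) / Lfun p \<delta> (sqrt (real n))) sequentially"
    using eventually_ge_real[of 16] eventually_ge_real[of "(2 * real M)\<^sup>2"]
  proof eventually_elim
    case (elim n)
    define t where "t = sqrt (real n)"
    have t4: "t \<ge> 4" using real_sqrt_le_mono[OF elim(2)] by (simp add: t_def)
    have tn: "t\<^sup>2 = real n" by (simp add: t_def)
    have tM: "2 * real M \<le> t" using elim(3) unfolding t_def by (rule real_le_rsqrt)
    \<comment> \<open>Of order sqrt n and, because k >= sqrt n, below every state of the window
      (3k/4, k].\<close>
    define m where "m = nat \<lfloor>3 / 4 * t\<rfloor>"
    have m: "3 / 4 * t - 1 \<le> real m" "real m \<le> 3 / 4 * t" using t4 unfolding m_def by linarith+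
    have m2: "t / 2 \<le> real m" using m t4 by linarith
    have mM: "m \<ge> M" using m2 tM by linarith
    define Q where "Q = mass_scale n"
    have Q: "Q > 0" using elim by (simp add: Q_def)
    have "1/4 * real n \<le> (real m)\<^sup>2"
    proof -
      have "(t / 2)\<^sup>2 \<le> (real m)\<^sup>2" using m2 t4 by (intro power_mono) auto
      then show ?thesis by (simp add: power_divide tn)
    qed
    moreover have "(real m)\<^sup>2 \<le> real n / (1/4)"
    proof -
      have "(real m)\<^sup>2 \<le> (2 * t)\<^sup>2" using m t4 by (intro power_mono) auto
      then show ?thesis by (simp add: power_mult_distrib tn)
    qed
    ultimately have "exp (- 1) * (Q * real m powr (- \<delta>)) \<le> rev_meas p m" using elim(1) by (simp add: Q_def)
    then have le: "real m * (exp (- 1) * (Q * real m powr (- \<delta>))) \<le> real m * rev_meas p m" by (intro mult_left_mono) auto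
    have "real m * real m powr (- \<delta>) = (real m)\<^sup>2 powr a"
    proof -
      have "real m > 0" using m2 t4 by linarith
      then have "real m * real m powr (- \<delta>) = real m powr (1 - \<delta>)" using powr_add[of "real m" 1 "- \<delta>"] by simp
      also have "\<dots> = (real m)\<^sup>2 powr a"
        unfolding a(2) mult_2 by (simp only: powr_add powr_mult power2_eq_square)
      finally show ?thesis .
    qed
    then have "exp (- 1) * Q * (real m)\<^sup>2 powr a = exp (- 1) * Q * (real m * real m powr (- \<delta>))" by simp
    also have "\<dots> = real m * (exp (- 1) * (Q * real m powr (- \<delta>)))" by (simp only: mult_ac)
    finally have eqm: "exp (- 1) * Q * (real m)\<^sup>2 powr a = real m * (exp (- 1) * (Q * real m powr (- \<delta>)))" .
    have mm: "exp (- 1) * Q * (real m)\<^sup>2 powr a \<le> real m * rev_meas p m" unfolding eqm by (rule le)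
    have "(real n / 4) powr a \<le> (real m)\<^sup>2 powr a"
      using \<open>1/4 * real n \<le> (real m)\<^sup>2\<close> a by (intro powr_mono2) auto
    then have "exp (- 1) * Q * (real n / 4) powr a \<le> exp (- 1) * Q * (real m)\<^sup>2 powr a"
      using Q by (intro mult_left_mono) auto
    with mm have mass: "exp (- 1) * Q * (real n / 4) powr a \<le> real m * rev_meas p m" by linarith
    show ?case
    proof (intro allI impI, elim conjE)
      fix k assume k: "real n \<le> (real k)\<^sup>2" "even (n + k)"
      have tk: "t \<le> real k" using real_sqrt_le_mono[OF k(1)] by (simp add: t_def)
      then have k0: "real k > 0" using t4 by linarith
      define B where "B = real m * rev_meas p m / real k"
      have B0: "B \<ge> 0" using k0 rev_meas_pos[of m] by (simp add: B_def)
      have "ret n k * ((1 - 3 / 4) * real k / 2 * B) \<le> expect p n (\<lambda>j. if 3 / 4 * real k < real j \<and> real j \<le> real k then 1 else 0) 0"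
      proof (rule window_upper[OF _ _ k(2) B0])
        fix j assume j: "3 / 4 * real k < real j" "j \<le> k"
        have "m \<le> j" using m j(1) tk by linarith
        then have "real m * rev_meas p m \<le> real j * rev_meas p j" by (rule M(2)[OF mM])
        also have "\<dots> \<le> real k * rev_meas p j" using j(2) rev_meas_pos[of j] by (intro mult_right_mono) auto
        finally show "B \<le> rev_meas p j" using k0 by (simp add: B_def field_simps)
      qed auto
      also have "\<dots> \<le> tail_prob p n (3 / 4 * real k)" by (rule expect_mono) auto
      also have "\<dots> \<le> K * exp (- (3 / 4 * real k)\<^sup>2 / (4 * real n))"
        unfolding K_def by (rule gaussian_tail) (use elim(2) in auto)
      \<comment> \<open>The left end 3k/4 of the window gives the rate (9/16)/4 = 9/64, which
        exceeds 1/8.\<close>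
      also have "\<dots> \<le> K * exp (- (real k)\<^sup>2 / (8 * real n))"
        using K elim(2) by (simp add: power_mult_distrib power_divide field_simps)
      finally have "ret n k * (real m * rev_meas p m) \<le> 8 * K * exp (- (real k)\<^sup>2 / (8 * real n))"
        using k0 by (simp add: B_def)
      moreover have "ret n k * (exp (- 1) * Q * (real n / 4) powr a) \<le> ret n k * (real m * rev_meas p m)"
        by (intro mult_left_mono mass ret_nonneg)
      ultimately have *: "ret n k * (exp (- 1) * Q * (real n / 4) powr a) \<le> 8 * K * exp (- (real k)\<^sup>2 / (8 * real n))"
        by linarith
      define W where "W = exp (- 1) * Q * (real n / 4) powr a"
      have W: "W > 0" using Q elim(2) by (simp add: W_def)
      have L: "Lfun p \<delta> (sqrt (real n)) = Q * K0 / 2" using K0 by (simp add: Q_def mass_scale_def)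
      have "K1 * exp (- (real k)\<^sup>2 / (8 * real n)) * real n powr (- (1 - \<kappa>)) / Lfun p \<delta> (sqrt (real n))
        = 8 * K * exp (- (real k)\<^sup>2 / (8 * real n)) / W"
        unfolding K1_def L W_def a_def[symmetric] using K0 Q elim(2)
        by (simp add: powr_divide powr_minus exp_minus field_simps)
      moreover have "ret n k \<le> 8 * K * exp (- (real k)\<^sup>2 / (8 * real n)) / W"
        using * W by (simp add: W_def[symmetric] pos_le_divide_eq)
      ultimately show "ret n k \<le> K1 * exp (- (real k)\<^sup>2 / (8 * real n)) * real n powr (- (1 - \<kappa>)) / Lfun p \<delta> (sqrt (real n))"
        by simp
    qed
  qed
  then show ?thesis by blast
qed

end

subsection \<open>Estimates in the scaling window\<close>

lemma eventually_imp_intro: "(Q \<Longrightarrow> eventually P F) \<Longrightarrow> eventually (\<lambda>x. Q \<longrightarrow> P x) F"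
  by (cases Q) auto

context bessel_walk
begin

text \<open>m stands for the normaliser: the constant E_0(tau_0) in part (ii) and \<mu>_0(n) in part
  (iv). Both parts then follow from one statement.\<close>

lemma sv_profile:
  assumes \<delta>: "\<delta> > -1" and sv: ret_sv and c: "c > 0" and \<theta>: "\<theta> > 0"
    and m: "eventually (\<lambda>n. 0 < m n) sequentially" "(\<lambda>n. origin_ret n * m n) \<longlonglongrightarrow> 2"
  shows "eventually (\<lambda>n. \<forall>k. sqrt (real n * c) \<le> real k \<and> real k \<le> sqrt (real n / c) \<and> even (int n - int k) \<longrightarrow>
    (2 - \<theta>) / m n * Gamma_up \<kappa> ((real k)\<^sup>2 / (2 * real n)) \<le> ret n k \<and>
    ret n k \<le> (2 + \<theta>) / m n * Gamma_up \<kappa> ((real k)\<^sup>2 / (2 * real n))) sequentially"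
proof -
  have \<kappa>: "\<kappa> > 0" using \<delta> by (simp add: \<kappa>_def)
  define e where "e = min (\<theta> / 4) (1 / 2)"
  have "e \<le> \<theta> / 4" "e \<le> 1 / 2" unfolding e_def by (rule min.cobounded1, rule min.cobounded2)
  moreover have e0: "e > 0" using \<theta> by (simp add: e_def)
  ultimately have e: "4 * e \<le> \<theta>" "e \<le> 1 / 2" by argo+
  have "e * e \<le> e * 1" using e e0 by (intro mult_left_mono) auto
  then have e2: "2 - \<theta> \<le> (1 - e) * (2 - e)" "(1 + e) * (2 + e) \<le> 2 + \<theta>"
  proof -
    have "(1 - e) * (2 - e) = 2 - 3 * e + e * e" "(1 + e) * (2 + e) = 2 + 3 * e + e * e" by (simp_all add: algebra_simps)
    moreover have "0 \<le> e * e" by simp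
    ultimately show "2 - \<theta> \<le> (1 - e) * (2 - e)" "(1 + e) * (2 + e) \<le> 2 + \<theta>"
      using \<open>e * e \<le> e * 1\<close> e e0 by argo+
  qed
  have "eventually (\<lambda>n. 2 - e < origin_ret n * m n) sequentially" "eventually (\<lambda>n. origin_ret n * m n < 2 + e) sequentially"
    using order_tendstoD[OF m(2)] e0 by auto
  with ret_profile_lower[OF \<delta> c e0] ret_profile_upper[OF \<delta> sv c e0] m(1) show ?thesis
  proof eventually_elim
    case (elim n)
    show ?case
    proof (intro allI impI, elim conjE)
      fix k assume "sqrt (real n * c) \<le> real k" "real k \<le> sqrt (real n / c)" "even (int n - int k)"
      then have k: "c * real n \<le> (real k)\<^sup>2" "(real k)\<^sup>2 \<le> real n / c" "even (n + k)"
        by (simp_all only: sqrt_scale_iff[OF c] even_int_diff_iff)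
      define g where "g = Gamma_up \<kappa> ((real k)\<^sup>2 / (2 * real n))"
      have g: "g \<ge> 0" unfolding g_def by (rule Gamma_up_nonneg[OF \<kappa>]) simp
      have "(2 - \<theta>) / m n \<le> (1 - e) * origin_ret n"
      proof -
        have "2 - \<theta> \<le> (1 - e) * (2 - e)" by fact
        also have "\<dots> \<le> (1 - e) * (origin_ret n * m n)" using elim e by (intro mult_left_mono) auto
        finally show ?thesis using elim(3) by (simp add: pos_divide_le_eq mult.assoc)
      qed
      then have "(2 - \<theta>) / m n * g \<le> (1 - e) * origin_ret n * g" using g by (rule mult_right_mono)
      also have "\<dots> \<le> ret n k" using elim(1) k by (auto simp: g_def mult_ac)
      finally have 1: "(2 - \<theta>) / m n * g \<le> ret n k" .
      have "(1 + e) * origin_ret n \<le> (2 + \<theta>) / m n"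
      proof -
        have "(1 + e) * (origin_ret n * m n) \<le> (1 + e) * (2 + e)" using elim e0 by (intro mult_left_mono) auto
        also have "\<dots> \<le> 2 + \<theta>" by fact
        finally show ?thesis using elim(3) by (simp add: pos_le_divide_eq mult.assoc)
      qed
      then have "(1 + e) * origin_ret n * g \<le> (2 + \<theta>) / m n * g" using g by (rule mult_right_mono)
      moreover have "ret n k \<le> (1 + e) * origin_ret n * g" using elim(2) k by (auto simp: g_def mult_ac)
      ultimately show "(2 - \<theta>) / m n * Gamma_up \<kappa> ((real k)\<^sup>2 / (2 * real n)) \<le> ret n k \<and>
        ret n k \<le> (2 + \<theta>) / m n * Gamma_up \<kappa> ((real k)\<^sup>2 / (2 * real n))"
        using 1 unfolding g_def by linarith
    qed
  qed
qed

lemma sv_tail: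
  assumes sv: ret_sv
  obtains c0 where "c0 > 0"
    "\<And>c m. 0 < c \<Longrightarrow> c < c0 \<Longrightarrow> eventually (\<lambda>n. 0 < m n) sequentially \<Longrightarrow> (\<lambda>n. origin_ret n * m n) \<longlonglongrightarrow> 2 \<Longrightarrow>
      eventually (\<lambda>n. \<forall>k. sqrt (real n / c) < real k \<and> even (int n - int k) \<longrightarrow>
        ret n k \<le> 8 / m n * exp (- (real k)\<^sup>2 / (8 * real n))) sequentially"
proof -
  obtain c0 where c0: "c0 > 0" "\<And>c. 0 < c \<and> c < c0 \<Longrightarrow> eventually (\<lambda>n. \<forall>k. real n / c < (real k)\<^sup>2 \<and> even (n + k) \<longrightarrow>
    ret n k \<le> 3 * exp (- (real k)\<^sup>2 / (8 * real n)) * origin_ret n) sequentially"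
    using ret_tail[OF sv] by blast
  have "eventually (\<lambda>n. \<forall>k. sqrt (real n / c) < real k \<and> even (int n - int k) \<longrightarrow>
        ret n k \<le> 8 / m n * exp (- (real k)\<^sup>2 / (8 * real n))) sequentially"
    if c: "0 < c" "c < c0" and m: "eventually (\<lambda>n. 0 < m n) sequentially" "(\<lambda>n. origin_ret n * m n) \<longlonglongrightarrow> 2" for c m
  proof -
    have "eventually (\<lambda>n. origin_ret n * m n < 8 / 3) sequentially"
      by (rule order_tendstoD(2)[OF m(2)]) simp
    with c0(2)[OF conjI[OF c]] m(1) show ?thesis
    proof eventually_elim
      case (elim n)
      show ?case
      proof (intro allI impI, elim conjE)
        fix k assume "sqrt (real n / c) < real k" "even (int n - int k)"
        then have k: "real n / c < (real k)\<^sup>2" "even (n + k)"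
          by (simp_all only: sqrt_scale_iff[OF c(1)] even_int_diff_iff)
        have "3 * origin_ret n \<le> 8 / m n"
        proof -
          have "3 * (origin_ret n * m n) \<le> 8" using elim(3) by simp
          then show ?thesis using elim(2) by (simp add: pos_le_divide_eq mult.assoc)
        qed
        then have "3 * origin_ret n * exp (- (real k)\<^sup>2 / (8 * real n)) \<le> 8 / m n * exp (- (real k)\<^sup>2 / (8 * real n))"
          by (rule mult_right_mono) simp
        moreover have "ret n k \<le> 3 * origin_ret n * exp (- (real k)\<^sup>2 / (8 * real n))"
          using elim(1) k by (auto simp: mult_ac)
        ultimately show "ret n k \<le> 8 / m n * exp (- (real k)\<^sup>2 / (8 * real n))" by linarith
      qed
    qed
  qed
  then show ?thesis using that c0(1) by blast
qed

end

context bessel_walk_lam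
begin

lemma local_profile:
  assumes \<delta>: "\<delta> < 1" and c: "0 < c" "c < 1" and \<theta>: "0 < \<theta>"
  shows "eventually (\<lambda>n. \<forall>k. sqrt (real n * c) \<le> real k \<and> real k \<le> sqrt (real n / c) \<and> even (int n - int k) \<longrightarrow>
    (1 - \<theta>) * 2 powr \<kappa> * K0 / Gamma (1 - \<kappa>) * real n powr (- (1 - \<kappa>)) / Lfun p \<delta> (sqrt (real n))
      * exp (- (real k)\<^sup>2 / (2 * real n)) \<le> ret n k \<and>
    ret n k \<le> (1 + \<theta>) * 2 powr \<kappa> * K0 / Gamma (1 - \<kappa>) * real n powr (- (1 - \<kappa>)) / Lfun p \<delta> (sqrt (real n))
      * exp (- (real k)\<^sup>2 / (2 * real n))) sequentially"
proof -
  define e where "e = min \<theta> 1"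
  have e: "0 < e" "e \<le> 1" "e \<le> \<theta>" using \<theta> by (auto simp: e_def)
  from local_limit[OF \<delta> c e(1,2)] show ?thesis
  proof eventually_elim
    case (elim n)
    have LD: "x * 2 powr \<kappa> * K0 / Gamma (1 - \<kappa>) * real n powr (- (1 - \<kappa>)) / Lfun p \<delta> (sqrt (real n))
      * exp (- (real k)\<^sup>2 / (2 * real n)) = x * local_density n k" for x k
      by (simp add: local_density_def)
    show ?case unfolding LD
    proof (intro allI impI)
      fix k assume "sqrt (real n * c) \<le> real k \<and> real k \<le> sqrt (real n / c) \<and> even (int n - int k)"
      then have "c * real n \<le> (real k)\<^sup>2 \<and> (real k)\<^sup>2 \<le> real n / c \<and> even (n + k)"
        by (simp only: sqrt_scale_iff[OF c(1)] even_int_diff_iff)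
      then have b: "(1 - e) * local_density n k \<le> ret n k" "ret n k \<le> (1 + e) * local_density n k"
        using elim by blast+
      \<comment> \<open>The sign of \<open>local_density\<close> is read off from the upper bound on
        a nonnegative probability; it is needed to pass from e to a larger \<theta>.\<close>
      have "0 \<le> (1 + e) * local_density n k" using b(2) ret_nonneg[of n k] by linarith
      then have "0 \<le> local_density n k" using e(1) by (simp add: zero_le_mult_iff)
      then have "(1 - \<theta>) * local_density n k \<le> (1 - e) * local_density n k"
        "(1 + e) * local_density n k \<le> (1 + \<theta>) * local_density n k"
        using e by (auto intro!: mult_right_mono)
      then show "(1 - \<theta>) * local_density n k \<le> ret n k \<and> ret n k \<le> (1 + \<theta>) * local_density n k"
        using b by linarith
    qed
  qed
qed

text \<open>The theorem fixes K1 before anything else, so the assumption \<delta> < 1 has to sit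
  behind the choice of K1; for other \<delta> any value will do.\<close>

lemma local_tail_scaled:
  obtains K1 where "\<And>c. \<delta> < 1 \<Longrightarrow> 0 < c \<Longrightarrow> c < 1 \<Longrightarrow>
    eventually (\<lambda>n. \<forall>k. sqrt (real n / c) < real k \<and> even (int n - int k) \<longrightarrow>
      ret n k \<le> K1 * exp (- (real k)\<^sup>2 / (8 * real n)) * real n powr (- (1 - \<kappa>)) / Lfun p \<delta> (sqrt (real n))) sequentially"
proof (cases "\<delta> < 1")
  case True
  then obtain K1 where K1: "eventually (\<lambda>n. \<forall>k. real n \<le> (real k)\<^sup>2 \<and> even (n + k) \<longrightarrow>
    ret n k \<le> K1 * exp (- (real k)\<^sup>2 / (8 * real n)) * real n powr (- (1 - \<kappa>)) / Lfun p \<delta> (sqrt (real n))) sequentially"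
    using local_tail by blast
  show ?thesis
  proof (rule that[of K1])
    fix c :: real assume c: "0 < c" "c < 1"
    show "eventually (\<lambda>n. \<forall>k. sqrt (real n / c) < real k \<and> even (int n - int k) \<longrightarrow>
      ret n k \<le> K1 * exp (- (real k)\<^sup>2 / (8 * real n)) * real n powr (- (1 - \<kappa>)) / Lfun p \<delta> (sqrt (real n))) sequentially"
      using K1
    proof eventually_elim
      case (elim n)
      have "c * real n \<le> 1 * real n" using c by (intro mult_right_mono) auto
      then have "real n \<le> real n / c" using c by (simp add: pos_le_divide_eq mult.commute)
      then have "real n / c < (real k)\<^sup>2 \<Longrightarrow> real n \<le> (real k)\<^sup>2" for k by linarith
      then show ?case unfolding sqrt_scale_iff[OF c(1)] even_int_diff_iff using elim by blast
    qed
  qed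
qed (use that in blast)

end

theorem theorem2p3:
  fixes p :: "nat \<Rightarrow> real" and \<delta> \<kappa> K0 :: real
  assumes delta: "\<delta> > -1"
    and kappa: "\<kappa> = (1 + \<delta>) / 2"
    and ellip: "\<exists>\<epsilon>>0. \<forall>x\<ge>1. \<epsilon> \<le> p x \<and> p x \<le> 1 - \<epsilon>"
    and R_small: "(\<lambda>x. Rterm p \<delta> x) \<in> o(\<lambda>x. 1 / real x)"
    and K0: "K0 > 0"
    and lam_asymp: "(\<lambda>x. lam p x) \<sim>[at_top]
                      (\<lambda>x. K0 * real x powr (2 * \<kappa> - 1) / Lfun p \<delta> (real x))"
  shows "\<exists>K1. \<forall>\<theta>>0. \<exists>c0>0. \<forall>c. 0 < c \<and> c < c0 \<longrightarrow>
     (\<exists>n0. \<forall>n\<ge>n0.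
       (\<forall>k::nat. real k < sqrt (c * n) \<and> even (int n - int k) \<longrightarrow>
          (1 - \<theta>) * walk_prob p (if even n then n else n + 1) 0 0 \<le> walk_prob p n k 0 \<and>
          walk_prob p n k 0 \<le> (1 + \<theta>) * walk_prob p (if even n then n else n + 1) 0 0)
     \<and> (E0tau p < \<infinity> \<longrightarrow>
          (\<forall>k::nat. sqrt (n * c) \<le> real k \<and> real k \<le> sqrt (n / c) \<and> even (int n - int k) \<longrightarrow>
             (2 - \<theta>) / enn2real (E0tau p) * Gamma_up \<kappa> (real k ^ 2 / (2 * n)) \<le> walk_prob p n k 0 \<and>
             walk_prob p n k 0 \<le> (2 + \<theta>) / enn2real (E0tau p) * Gamma_up \<kappa> (real k ^ 2 / (2 * n)))
        \<and> (\<forall>k::nat. real k > sqrt (n / c) \<and> even (int n - int k) \<longrightarrow>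
             walk_prob p n k 0 \<le> 8 / enn2real (E0tau p) * exp (- (real k ^ 2) / (8 * n))))
     \<and> (-1 < \<delta> \<and> \<delta> < 1 \<longrightarrow>
          (\<forall>k::nat. sqrt (n * c) \<le> real k \<and> real k \<le> sqrt (n / c) \<and> even (int n - int k) \<longrightarrow>
             (1 - \<theta>) * 2 powr \<kappa> * K0 / Gamma (1 - \<kappa>) * real n powr (- (1 - \<kappa>))
               / Lfun p \<delta> (sqrt n) * exp (- (real k ^ 2) / (2 * n)) \<le> walk_prob p n k 0 \<and>
             walk_prob p n k 0 \<le> (1 + \<theta>) * 2 powr \<kappa> * K0 / Gamma (1 - \<kappa>) * real n powr (- (1 - \<kappa>))
               / Lfun p \<delta> (sqrt n) * exp (- (real k ^ 2) / (2 * n)))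
        \<and> (\<forall>k::nat. real k > sqrt (n / c) \<and> even (int n - int k) \<longrightarrow>
             walk_prob p n k 0 \<le> K1 * exp (- (real k ^ 2) / (8 * n)) * real n powr (- (1 - \<kappa>))
               / Lfun p \<delta> (sqrt n)))
     \<and> (\<delta> = 1 \<and> E0tau p = \<infinity> \<longrightarrow>
          (\<forall>k::nat. sqrt (n * c) \<le> real k \<and> real k \<le> sqrt (n / c) \<and> even (int n - int k) \<longrightarrow>
             (2 - \<theta>) / mu0 p n * Gamma_up \<kappa> (real k ^ 2 / (2 * n)) \<le> walk_prob p n k 0 \<and>
             walk_prob p n k 0 \<le> (2 + \<theta>) / mu0 p n * Gamma_up \<kappa> (real k ^ 2 / (2 * n)))
        \<and> (\<forall>k::nat. real k > sqrt (n / c) \<and> even (int n - int k) \<longrightarrow>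
             walk_prob p n k 0 \<le> 8 / mu0 p n * exp (- (real k ^ 2) / (8 * n)))))"
proof -
  obtain \<epsilon> where \<epsilon>: "\<epsilon> > 0" "\<And>x. x \<ge> 1 \<Longrightarrow> \<epsilon> \<le> p x \<and> p x \<le> 1 - \<epsilon>" using ellip by blast
  have "(\<lambda>x. Rterm p \<delta> x / (1 / real x)) \<longlonglongrightarrow> 0" by (rule smalloD_tendsto[OF R_small])
  then have "(\<lambda>x. (Rterm p \<delta> x / (1 / real x) - \<delta>) / 2) \<longlonglongrightarrow> (0 - \<delta>) / 2"
    by (intro tendsto_intros) auto
  then have "(\<lambda>x. (Rterm p \<delta> x / (1 / real x) - \<delta>) / 2) \<longlonglongrightarrow> - \<delta> / 2" by simp
  then have drift: "(\<lambda>x. real x * (2 * p x - 1)) \<longlonglongrightarrow> - \<delta> / 2"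
  proof (rule Lim_transform_eventually)
    show "eventually (\<lambda>x. (Rterm p \<delta> x / (1 / real x) - \<delta>) / 2 = real x * (2 * p x - 1)) sequentially"
      by (rule eventually_sequentiallyI[of 1]) (simp add: Rterm_def field_simps)
  qed
  interpret bessel_walk_lam p \<delta> K0
  proof
    show "0 < p x" "p x < 1" if "1 \<le> x" for x using \<epsilon>(2)[OF that] \<epsilon>(1) by linarith+
    have "2 * \<kappa> - 1 = \<delta>" using kappa by simp
    then show "lam p \<sim>[at_top] (\<lambda>x. K0 * real x powr \<delta> / Lnat p \<delta> x)"
      using lam_asymp by (simp add: Lfun_of_nat)
  qed (use drift K0 in auto)
  have \<kappa>: "bessel_walk.\<kappa> \<delta> = \<kappa>" by (simp add: \<kappa>_def kappa)
  obtain K1 where K1: "\<And>c. \<delta> < 1 \<Longrightarrow> 0 < c \<Longrightarrow> c < 1 \<Longrightarrow>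
    eventually (\<lambda>n. \<forall>k. sqrt (real n / c) < real k \<and> even (int n - int k) \<longrightarrow>
      ret n k \<le> K1 * exp (- (real k)\<^sup>2 / (8 * real n)) * real n powr (- (1 - \<kappa>)) / Lfun p \<delta> (sqrt (real n))) sequentially"
    by (rule local_tail_scaled[unfolded \<kappa>]) (rule that)
  \<comment> \<open>The truncated means converge to the positive number E_0(tau_0), which can
    therefore replace them as a constant normaliser.\<close>
  have fin: "ret_sv" "eventually (\<lambda>n. 0 < enn2real (E0tau p)) sequentially" "(\<lambda>n. origin_ret n * enn2real (E0tau p)) \<longlonglongrightarrow> 2"
    if "E0tau p < \<infinity>"
  proof -
    have sv: ret_sv by (rule ret_sv_finite_mean[OF delta that])
    note mu = mu0_tendsto_E0tau[OF that]
    have "(\<lambda>n. origin_ret n * mu0 p n / mu0 p n * enn2real (E0tau p)) \<longlonglongrightarrow> 2 / enn2real (E0tau p) * enn2real (E0tau p)"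
      using mu by (intro tendsto_intros origin_ret_mu0[OF sv]) auto
    moreover have "eventually (\<lambda>n. origin_ret n * mu0 p n / mu0 p n * enn2real (E0tau p) = origin_ret n * enn2real (E0tau p)) sequentially"
      using order_tendstoD(1)[OF mu(1,2)] by eventually_elim auto
    ultimately have "(\<lambda>n. origin_ret n * enn2real (E0tau p)) \<longlonglongrightarrow> 2 / enn2real (E0tau p) * enn2real (E0tau p)"
      by (rule Lim_transform_eventually)
    then show "ret_sv" "eventually (\<lambda>n. 0 < enn2real (E0tau p)) sequentially" "(\<lambda>n. origin_ret n * enn2real (E0tau p)) \<longlonglongrightarrow> 2"
      using sv mu(2) by simp_all
  qed
  have crit: "ret_sv" "eventually (\<lambda>n. 0 < mu0 p n) sequentially" "(\<lambda>n. origin_ret n * mu0 p n) \<longlonglongrightarrow> 2"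
    if "\<delta> = 1" "E0tau p = \<infinity>"
  proof -
    have sv: ret_sv by (rule ret_sv_critical[OF that(1) null_infinite_mean[OF that(2)]])
    have "0 < mu0 p n" if "n \<ge> 2" for n using mu0_mono[OF that] mu0_2_pos by linarith
    then have "eventually (\<lambda>n. 0 < mu0 p n) sequentially" by (rule eventually_sequentiallyI)
    then show "ret_sv" "eventually (\<lambda>n. 0 < mu0 p n) sequentially" "(\<lambda>n. origin_ret n * mu0 p n) \<longlonglongrightarrow> 2"
      using sv origin_ret_mu0[OF sv] by simp_all
  qed
  \<comment> \<open>One threshold must serve parts (ii) and (iv) before it is known whether either
    applies. If slow variation fails, the property is vacuous and 1 is a default value.\<close>
  obtain ct where ct: "ct > 0"
    "\<And>c m. ret_sv \<Longrightarrow> 0 < c \<Longrightarrow> c < ct \<Longrightarrow> eventually (\<lambda>n. 0 < m n) sequentially \<Longrightarrow> (\<lambda>n. origin_ret n * m n) \<longlonglongrightarrow> 2 \<Longrightarrow>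
      eventually (\<lambda>n. \<forall>k. sqrt (real n / c) < real k \<and> even (int n - int k) \<longrightarrow>
        ret n k \<le> 8 / m n * exp (- (real k)\<^sup>2 / (8 * real n))) sequentially"
  proof (cases ret_sv)
    case True
    then show ?thesis
    proof (rule sv_tail)
      fix ct :: real
      assume a: "0 < ct" and b: "\<And>c m. 0 < c \<Longrightarrow> c < ct \<Longrightarrow> eventually (\<lambda>n. 0 < m n) sequentially \<Longrightarrow> (\<lambda>n. origin_ret n * m n) \<longlonglongrightarrow> 2 \<Longrightarrow>
        eventually (\<lambda>n. \<forall>k. sqrt (real n / c) < real k \<and> even (int n - int k) \<longrightarrow>
          ret n k \<le> 8 / m n * exp (- (real k)\<^sup>2 / (8 * real n))) sequentially"
      show ?thesis by (rule that[OF a]) (rule b)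
    qed
  next
    case False
    then show ?thesis using that[of 1] by simp
  qed
  show ?thesis (is "\<exists>K1. \<forall>\<theta>>0. \<exists>c0>0. \<forall>c. 0 < c \<and> c < c0 \<longrightarrow> (\<exists>n0. \<forall>n\<ge>n0. ?B K1 \<theta> c n)")
  proof (rule exI[of _ K1], intro allI impI)
    fix \<theta> :: real assume \<theta>: "\<theta> > 0"
    obtain c1 where c1: "c1 > 0" "\<And>c. c < c1 \<Longrightarrow> eventually (\<lambda>n. \<forall>k. real k < sqrt (c * real n) \<and> even (int n - int k) \<longrightarrow>
      (1 - \<theta>) * origin_ret n \<le> ret n k \<and> ret n k \<le> (1 + \<theta>) * origin_ret n) sequentially"
      by (rule ret_near_origin[OF delta \<theta>]) (rule that)
    have "eventually (?B K1 \<theta> c) sequentially" if "0 < c \<and> c < min c1 (min ct 1)" for c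
    proof -
      from that have c: "0 < c" "c < c1" "c < ct" "c < 1" by auto
      note parts = c1(2)[OF c(2)] sv_profile[OF delta fin(1) c(1) \<theta> fin(2,3), unfolded \<kappa>] ct(2)[OF fin(1) c(1,3) fin(2,3)]
        local_profile[OF _ c(1,4) \<theta>, unfolded \<kappa>] K1[OF _ c(1,4)]
        sv_profile[OF delta crit(1) c(1) \<theta> crit(2,3), unfolded \<kappa>] ct(2)[OF crit(1) c(1,3) crit(2,3)]
      show ?thesis by (intro eventually_conj eventually_imp_intro; (elim conjE)?; rule parts; assumption)
    qed
    then show "\<exists>c0>0. \<forall>c. 0 < c \<and> c < c0 \<longrightarrow> (\<exists>n0. \<forall>n\<ge>n0. ?B K1 \<theta> c n)"
      using c1(1) ct(1) unfolding eventually_sequentially by (intro exI[of _ "min c1 (min ct 1)"]) simp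
  qed
qed

end
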